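(* Let $N\ge1$, $0<\theta\le2$, and let $f\colon[0,\infty)\to[0,\infty)$ satisfy (M), (S), (C), (L) and be supercritical. Let $\varphi,\psi\colon[0,\infty)\to[0,\infty)$ be any nondecreasing functions satisfying $\varphi\asymp G$ (equivalently $\varphi\asymp f'$) and $\varphi\circ\psi\asymp\mathrm{id}$. Then there exists a unique $\lambda_0=\lambda_0(\psi)>0$ such that $\mu_c(x):=\psi(\lambda_0|x|^{-\theta})$, $x\in\mathbb{R}^N$, is a dilation-critical singularity for problem (SHE).
   Context: Problem (SHE) is $\partial_t u+(-\Delta)^{\theta/2}u=f(u)$ in $\mathbb{R}^N\times(0,\infty)$, $u(\cdot,0)=\mu$, with $\mu\ge0$ locally integrable. Let $\Gamma_\theta$ be the fundamental solution of $\partial_t u+(-\Delta)^{\theta/2}u=0$ on $\mathbb{R}^N\times(0,\infty)$. A solution of (SHE) in $Q_T=\mathbb{R}^N\times(0,T)$ is a nonnegative measurable a.e.-finite $u$ with $u(x,t)=\int\Gamma_\theta(x-y,t)\mu(y)\,dy+\int_0^t\int\Gamma_\theta(x-y,t-s)f(u(y,s))\,dy\,ds$ for a.a. $(x,t)\in Q_T$; (SHE) is locally solvable if such a solution exists for some $T>0$. (M) $f$ continuous, nondecreasing, $f(u)>0$ for $u>0$. (S) there is $\tau_0>0$ with $f\in C^1([\tau_0,\infty))$ and $\int_{\tau_0}^\infty ds/f(s)<\infty$. (C) $f$ is convex on $[\tau_1,\infty)$ for some $\tau_1\ge0$. $F(u)=\int_u^\infty ds/f(s)$ ($u>0$), $F_0=\lim_{u\to0}F(u)$,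 $G(u)=1/F(u)$ for $u>0$, $G(0)=1/F_0$ ($=0$ if $F_0=\infty$). (L) $q_f=\lim_{u\to\infty}f'(u)F(u)$ exists and is finite; $p_f$ is defined by $1/p_f+1/q_f=1$; $f$ is supercritical if $p_f>1+\theta/N$. For nonnegative $\phi,\psi$, $\phi\asymp\psi$ means there are $C_1,C_2,L>0$ with $C_1\phi(u)\le\psi(u)\le C_2\phi(u)$ for all $u\ge L$. $\mathcal{B}=\bigcap_{r>0}L^\infty(\mathbb{R}^N\setminus B_r)$. A function $\mu_c\in\mathcal{B}$, nonnegative and locally integrable, is a dilation-critical singularity for (SHE) if, with $\mu(x)=\mu_c(x/\lambda)$: (i) for every $\lambda\in(0,1)$ (SHE) is locally solvable; (ii) for every $\lambda>1$ (SHE) is not locally solvable. *)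

theory Defs
  imports "HOL-Analysis.Analysis"
begin

text \<open>Gamma theta x t = (2 pi)^(-N) * integral of e^(i x.xi - t |xi|^theta) d xi, N = DIM('a).
  Since the symbol is even and real, the imaginary part vanishes, so only the cosine appears.\<close>
definition frac_heat_kernel :: "real \<Rightarrow> 'a::euclidean_space \<Rightarrow> real \<Rightarrow> real" where
  "frac_heat_kernel \<theta> x t =
     (2 * pi) powr (- real DIM('a)) *
     (\<integral>\<xi>. cos (x \<bullet> \<xi>) * exp (- t * norm \<xi> powr \<theta>) \<partial>lborel)"

definition she_solution ::
  "real \<Rightarrow> (real \<Rightarrow> real) \<Rightarrow> ('a::euclidean_space \<Rightarrow> real) \<Rightarrow> real \<Rightarrow> ('a \<Rightarrow> real \<Rightarrow> real) \<Rightarrow> bool" where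
  "she_solution \<theta> f \<mu> T u \<longleftrightarrow>
     (\<lambda>z. u (fst z) (snd z)) \<in> borel_measurable (lborel :: ('a \<times> real) measure) \<and>
     (\<forall>x t. 0 < t \<and> t < T \<longrightarrow> 0 \<le> u x t) \<and>
     (AE z in (lborel :: ('a \<times> real) measure). 0 < snd z \<and> snd z < T \<longrightarrow>
        ennreal (u (fst z) (snd z)) =
          (\<integral>\<^sup>+ y. ennreal (frac_heat_kernel \<theta> (fst z - y) (snd z)) * ennreal (\<mu> y) \<partial>lborel)
          + (\<integral>\<^sup>+ s \<in> {0<..<snd z}.
               (\<integral>\<^sup>+ y. ennreal (frac_heat_kernel \<theta> (fst z - y) (snd z - s)) * ennreal (f (u y s)) \<partial>lborel)
             \<partial>lborel))"

definition locally_solvable ::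
  "real \<Rightarrow> (real \<Rightarrow> real) \<Rightarrow> ('a::euclidean_space \<Rightarrow> real) \<Rightarrow> bool" where
  "locally_solvable \<theta> f \<mu> \<longleftrightarrow> (\<exists>T > 0. \<exists>u. she_solution \<theta> f \<mu> T u)"

definition in_B :: "('a::euclidean_space \<Rightarrow> real) \<Rightarrow> bool" where
  "in_B \<mu> \<longleftrightarrow> \<mu> \<in> borel_measurable lborel \<and>
     (\<forall>r > 0. \<exists>M. AE x in lborel. r \<le> norm x \<longrightarrow> \<bar>\<mu> x\<bar> \<le> M)"

definition locally_integrable :: "('a::euclidean_space \<Rightarrow> real) \<Rightarrow> bool" where
  "locally_integrable \<mu> \<longleftrightarrow> (\<forall>K. compact K \<longrightarrow> set_integrable lborel K \<mu>)"

definition dilation_critical ::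
  "real \<Rightarrow> (real \<Rightarrow> real) \<Rightarrow> ('a::euclidean_space \<Rightarrow> real) \<Rightarrow> bool" where
  "dilation_critical \<theta> f \<mu>c \<longleftrightarrow>
     in_B \<mu>c \<and> (\<forall>x. 0 \<le> \<mu>c x) \<and> locally_integrable \<mu>c \<and>
     (\<forall>c. 0 < c \<and> c < 1 \<longrightarrow> locally_solvable \<theta> f (\<lambda>x. \<mu>c ((1 / c) *\<^sub>R x))) \<and>
     (\<forall>c. 1 < c \<longrightarrow> \<not> locally_solvable \<theta> f (\<lambda>x. \<mu>c ((1 / c) *\<^sub>R x)))"

definition F_fun :: "(real \<Rightarrow> real) \<Rightarrow> real \<Rightarrow> real" where
  "F_fun f u = (LINT s:{u..}|lborel. 1 / f s)"

text \<open>F_0 = lim_{u -> 0} F(u) = integral over (0,infty) of 1/f, possibly infinite.\<close>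
definition F0_fun :: "(real \<Rightarrow> real) \<Rightarrow> ennreal" where
  "F0_fun f = (\<integral>\<^sup>+ s \<in> {0<..}. ennreal (1 / f s) \<partial>lborel)"

definition G_fun :: "(real \<Rightarrow> real) \<Rightarrow> real \<Rightarrow> real" where
  "G_fun f u = (if 0 < u then 1 / F_fun f u
                else if F0_fun f = \<infinity> then 0 else 1 / enn2real (F0_fun f))"

text \<open>p_f with 1/p_f + 1/q_f = 1 (p_f = infinity when q_f = 1).\<close>
definition p_of_q :: "real \<Rightarrow> ereal" where
  "p_of_q q = (if q = 1 then \<infinity> else ereal (q / (q - 1)))"

definition asymp_equiv :: "(real \<Rightarrow> real) \<Rightarrow> (real \<Rightarrow> real) \<Rightarrow> bool" where
  "asymp_equiv \<phi> \<psi> \<longleftrightarrow>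
     (\<exists>C1 C2 L. 0 < C1 \<and> 0 < C2 \<and> 0 < L \<and>
        (\<forall>u \<ge> L. C1 * \<phi> u \<le> \<psi> u \<and> \<psi> u \<le> C2 * \<phi> u))"

end

theory Submission
  imports Defs "HOL-Probability.Characteristic_Functions" "HOL-Real_Asymp.Real_Asymp"
begin

text \<open>Dilating \<open>\<psi>(l|x|\<^bsup>-\<theta>\<^esup>)\<close> by c only replaces l by \<open>l c\<^sup>\<theta>\<close>, and solvability is inherited by smaller
  initial data (monotone iteration below a supersolution). So the set of all l for which the problem
  is solvable is an interval starting at 0, and the only candidate for the critical value is its
  supremum. One has to show that this set is neither empty nor unbounded.

  Since \<open>G(\<psi>(s))\<close> is comparable to s, the datum behaves like \<open>F\<^bsup>-1\<^esup>(|x|\<^sup>\<theta>/l)\<close> near the origin. For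
  small l, fix \<open>q - 1 < r < min q (N/\<theta>)\<close>, put \<open>J = F\<^bsup>-r\<^esup>\<close>, which is convex near infinity, and let z be
  the caloric extension of \<open>J(\<mu>)\<close>; then \<open>J\<^bsup>-1\<^esup>(2z)\<close> is a supersolution for a short time. For large l,
  Jensen's inequality along a solution u shows \<open>S(t)\<mu> \<le> F\<^bsup>-1\<^esup>(t)\<close>, whereas Jensen's inequality for the
  convex function \<open>a \<mapsto> F\<^bsup>-1\<^esup>(a\<^sup>2)\<close> yields \<open>S(t)\<mu> \<ge> F\<^bsup>-1\<^esup>(\<delta>t) - O(\<surd>t)\<close> near the origin with small \<open>\<delta>\<close>.
  These contradict each other as \<open>f F\<^bsup>1/2\<^esup> \<rightarrow> \<infinity>\<close>.

  Of the kernel one only needs positivity, unit mass, the semigroup law, the bound \<open>O(t\<^bsup>-N/\<theta>\<^esup>)\<close> and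
  the moment of order \<open>\<theta>/2\<close>. Positivity holds because \<open>exp(-t(1 - e\<^bsup>-s\<^esup>)\<^sup>\<alpha>)\<close> is a power series in \<open>e\<^bsup>-s\<^esup>\<close>
  with nonnegative coefficients, so that \<open>exp(-t|\<xi>|\<^sup>\<theta>)\<close> is a limit of nonnegative combinations of
  Gaussians.\<close>

section \<open>Integrals of radial functions\<close>

lemma nn_integral_powr_Ioo_0:
  fixes p R :: real
  assumes "0 < p" "0 \<le> R"
  shows "(\<integral>\<^sup>+s\<in>{0<..<R}. ennreal (s powr (p - 1)) \<partial>lborel) = ennreal (R powr p / p)"
proof -
  have "((\<lambda>s. s powr (p - 1)) has_integral R powr (p - 1 + 1) / (p - 1 + 1)) {0<..<R}"
    using assms by (intro has_integral_Icc_iff_Ioo[THEN iffD1] has_integral_powr_from_0) auto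
  then show ?thesis by (intro nn_integral_has_integral_lebesgue') auto
qed

lemma nn_integral_powr_Ioi:
  fixes p R :: real
  assumes "0 < p" "0 < R"
  shows "(\<integral>\<^sup>+s\<in>{R<..}. ennreal (s powr (- p - 1)) \<partial>lborel) = ennreal (R powr - p / p)"
proof -
  have "((\<lambda>s. s powr (- p - 1)) has_integral - (R powr (- p - 1 + 1)) / (- p - 1 + 1)) {R..}"
    using assms by (intro has_integral_powr_to_inf) auto
  then have "(\<integral>\<^sup>+s\<in>{R..}. ennreal (s powr (- p - 1)) \<partial>lborel) = ennreal (R powr - p / p)"
    by (intro nn_integral_has_integral_lebesgue') auto
  moreover have "(\<integral>\<^sup>+s\<in>{R<..}. ennreal (s powr (- p - 1)) \<partial>lborel) =
      (\<integral>\<^sup>+s\<in>{R..}. ennreal (s powr (- p - 1)) \<partial>lborel)"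
    using AE_lborel_singleton[of R]
    by (intro nn_integral_cong_AE, eventually_elim) (auto simp: indicator_def)
  ultimately show ?thesis by simp
qed

lemma nn_integral_powr_mult_le_of_tails:
  fixes w :: "real \<Rightarrow> ennreal"
  assumes b_bounds: "0 < b" "b < c" and A_nonneg: "0 \<le> A" and B_nonneg: "0 \<le> B" and R_pos: "0 < R"
    and w: "\<And>\<rho>. 0 < \<rho> \<Longrightarrow> w \<rho> \<le> ennreal B" "\<And>\<rho>. 0 < \<rho> \<Longrightarrow> w \<rho> \<le> ennreal (A * \<rho> powr c)"
  shows "(\<integral>\<^sup>+\<rho>\<in>{0<..}. ennreal (\<rho> powr (- b - 1)) * w \<rho> \<partial>lborel) \<le>
    ennreal (A * (R powr (c - b) / (c - b)) + B * (R powr - b / b))"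
proof -
  have "(\<integral>\<^sup>+\<rho>\<in>{0<..}. ennreal (\<rho> powr (- b - 1)) * w \<rho> \<partial>lborel) \<le>
      (\<integral>\<^sup>+\<rho>. ennreal A * (ennreal (\<rho> powr (c - b - 1)) * indicator {0<..<R} \<rho>) +
        ennreal B * (ennreal (\<rho> powr (- b - 1)) * indicator {R<..} \<rho>) \<partial>lborel)"
  proof (rule nn_integral_mono_AE)
    show "AE \<rho> in lborel. ennreal (\<rho> powr (- b - 1)) * w \<rho> * indicator {0<..} \<rho> \<le>
        ennreal A * (ennreal (\<rho> powr (c - b - 1)) * indicator {0<..<R} \<rho>) +
        ennreal B * (ennreal (\<rho> powr (- b - 1)) * indicator {R<..} \<rho>)"
      using AE_lborel_singleton[of R]
    proof eventually_elim
      case (elim \<rho>)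
      have "\<rho> powr (- b - 1) * \<rho> powr c = \<rho> powr (c - b - 1)"
        unfolding powr_add[symmetric] by (rule arg_cong) simp
      then have near: "ennreal (\<rho> powr (- b - 1)) * w \<rho> \<le> ennreal A * ennreal (\<rho> powr (c - b - 1))"
        if "0 < \<rho>"
        using mult_left_mono[OF w(2)[OF that], of "ennreal (\<rho> powr (- b - 1))"] A_nonneg
        by (simp add: ennreal_mult[symmetric] mult.left_commute)
      have far: "ennreal (\<rho> powr (- b - 1)) * w \<rho> \<le> ennreal B * ennreal (\<rho> powr (- b - 1))" if "0 < \<rho>"
        using mult_left_mono[OF w(1)[OF that], of "ennreal (\<rho> powr (- b - 1))"]
        by (simp add: mult.commute)
      show ?case using elim near far R_pos by (cases \<rho> R rule: linorder_cases) (auto simp: indicator_def)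
    qed
  qed
  also have "\<dots> = ennreal A * ennreal (R powr (c - b) / (c - b)) + ennreal B * ennreal (R powr - b / b)"
    using b_bounds R_pos nn_integral_powr_Ioo_0[of "c - b" R] nn_integral_powr_Ioi[of b R]
    by (simp add: nn_integral_add nn_integral_cmult)
  also have "\<dots> = ennreal (A * (R powr (c - b) / (c - b)) + B * (R powr - b / b))"
    using b_bounds A_nonneg B_nonneg
    by (simp add: ennreal_mult[symmetric] ennreal_plus[symmetric] del: ennreal_plus)
  finally show ?thesis .
qed

lemma nn_integral_norm_powr_layer_cake:
  fixes A :: "'a::euclidean_space set"
  assumes a_pos: "0 < a" and [measurable]: "A \<in> sets borel"
  shows "(\<integral>\<^sup>+x\<in>A. ennreal (norm x powr - a) \<partial>lborel) =
    (\<integral>\<^sup>+\<rho>\<in>{0<..}. ennreal (a * \<rho> powr (- a - 1)) * emeasure lborel (A \<inter> ball 0 \<rho>) \<partial>lborel)"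
proof -
  let ?density = "\<lambda>x::'a. \<lambda>\<rho>. ennreal (a * \<rho> powr (- a - 1)) * (if x \<in> A \<and> norm x < \<rho> then 1 else 0)"
  have layers: "ennreal (norm x powr - a) * indicator A x = (\<integral>\<^sup>+\<rho>. ?density x \<rho> \<partial>lborel)" if "x \<noteq> 0" for x
  proof -
    have "ennreal (norm x powr - a) = ennreal a * (\<integral>\<^sup>+\<rho>\<in>{norm x<..}. ennreal (\<rho> powr (- a - 1)) \<partial>lborel)"
      using a_pos that by (simp add: nn_integral_powr_Ioi ennreal_mult[symmetric])
    also have "\<dots> = (\<integral>\<^sup>+\<rho>\<in>{norm x<..}. ennreal (a * \<rho> powr (- a - 1)) \<partial>lborel)"
      using a_pos by (simp add: nn_integral_cmult[symmetric] ennreal_mult mult.assoc)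
    finally show ?thesis
      by (cases "x \<in> A") (auto simp: indicator_def intro!: nn_integral_cong)
  qed
  have "(\<integral>\<^sup>+x\<in>A. ennreal (norm x powr - a) \<partial>lborel) = (\<integral>\<^sup>+x. \<integral>\<^sup>+\<rho>. ?density x \<rho> \<partial>lborel \<partial>lborel)"
    using AE_lborel_singleton[of "0::'a"] by (intro nn_integral_cong_AE, eventually_elim) (rule layers)
  also have "\<dots> = (\<integral>\<^sup>+\<rho>. \<integral>\<^sup>+x. ?density x \<rho> \<partial>lborel \<partial>lborel)"
    by (rule lborel_pair.Fubini'[symmetric]) measurable
  also have "\<dots> = (\<integral>\<^sup>+\<rho>\<in>{0<..}. ennreal (a * \<rho> powr (- a - 1)) * emeasure lborel (A \<inter> ball 0 \<rho>) \<partial>lborel)"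
  proof (intro nn_integral_cong)
    fix \<rho> :: real
    have "(\<integral>\<^sup>+x. ?density x \<rho> \<partial>lborel) =
        (\<integral>\<^sup>+x. ennreal (a * \<rho> powr (- a - 1)) * indicator (A \<inter> ball 0 \<rho>) x \<partial>lborel)"
      by (intro nn_integral_cong) (auto simp: indicator_def)
    also have "\<dots> = ennreal (a * \<rho> powr (- a - 1)) * emeasure lborel (A \<inter> ball 0 \<rho>)"
      by (rule nn_integral_cmult_indicator) simp
    finally show "(\<integral>\<^sup>+x. ?density x \<rho> \<partial>lborel) =
        ennreal (a * \<rho> powr (- a - 1)) * emeasure lborel (A \<inter> ball 0 \<rho>) * indicator {0<..} \<rho>"
      by (auto simp: indicator_def ball_empty)
  qed
  finally show ?thesis .
qed

lemma nn_integral_norm_powr_ball_le: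
  fixes a R :: real
  assumes a_bounds: "0 < a" "a < DIM('a::euclidean_space)" and R_pos: "0 < R"
  shows "(\<integral>\<^sup>+x\<in>ball (0::'a) R. ennreal (norm x powr - a) \<partial>lborel) \<le>
    ennreal (unit_ball_vol (DIM('a)) * (DIM('a) / (DIM('a) - a)) * R powr (DIM('a) - a))"
proof -
  let ?N = "real DIM('a)" and ?\<omega> = "unit_ball_vol (DIM('a))"
  let ?w = "\<lambda>\<rho>. emeasure lborel (ball (0::'a) R \<inter> ball 0 \<rho>)"
  have "?w \<rho> \<le> emeasure lborel (ball (0::'a) R)" for \<rho> by (intro emeasure_mono) auto
  then have w_le: "?w \<rho> \<le> ennreal (?\<omega> * R powr ?N)" for \<rho>
    using R_pos by (simp add: emeasure_ball powr_realpow)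
  have w_le_powr: "?w \<rho> \<le> ennreal (?\<omega> * \<rho> powr ?N)" if "0 < \<rho>" for \<rho>
  proof -
    have "?w \<rho> \<le> emeasure lborel (ball (0::'a) \<rho>)" by (intro emeasure_mono) auto
    then show ?thesis using that by (simp add: emeasure_ball powr_realpow)
  qed
  have "(\<integral>\<^sup>+x\<in>ball (0::'a) R. ennreal (norm x powr - a) \<partial>lborel) =
      (\<integral>\<^sup>+\<rho>\<in>{0<..}. ennreal (\<rho> powr (- a - 1)) * (ennreal a * ?w \<rho>) \<partial>lborel)"
    using a_bounds by (subst nn_integral_norm_powr_layer_cake) (auto simp: ennreal_mult ac_simps)
  also have "\<dots> \<le> ennreal (a * ?\<omega> * (R powr (?N - a) / (?N - a)) + a * ?\<omega> * R powr ?N * (R powr - a / a))"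
  proof (rule nn_integral_powr_mult_le_of_tails)
    show "ennreal a * ?w \<rho> \<le> ennreal (a * ?\<omega> * R powr ?N)" for \<rho>
      using mult_left_mono[OF w_le, of "ennreal a"] a_bounds
      by (simp add: ennreal_mult[symmetric] mult.assoc)
    show "ennreal a * ?w \<rho> \<le> ennreal (a * ?\<omega> * \<rho> powr ?N)" if "0 < \<rho>" for \<rho>
      using mult_left_mono[OF w_le_powr[OF that], of "ennreal a"] a_bounds
      by (simp add: ennreal_mult[symmetric] mult.assoc)
  qed (use a_bounds R_pos in auto)
  also have "a * ?\<omega> * (R powr (?N - a) / (?N - a)) + a * ?\<omega> * R powr ?N * (R powr - a / a) =
      ?\<omega> * (?N / (?N - a)) * R powr (?N - a)"
    using a_bounds R_pos
    by (simp add: powr_diff powr_minus_divide divide_simps) (simp add: algebra_simps)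
  finally show ?thesis .
qed

lemma nn_integral_norm_powr_outside_ball:
  fixes a R :: real
  assumes a_gt: "DIM('a::euclidean_space) < a" and R_pos: "0 < R"
  shows "(\<integral>\<^sup>+x\<in>- ball (0::'a) R. ennreal (norm x powr - a) \<partial>lborel) < \<infinity>"
proof -
  let ?N = "real DIM('a)" and ?\<omega> = "unit_ball_vol (DIM('a))"
  let ?w = "\<lambda>\<rho>. emeasure lborel (- ball (0::'a) R \<inter> ball 0 \<rho>)"
  have a_pos: "0 < a" using a_gt by linarith
  have layer_le: "ennreal (a * \<rho> powr (- a - 1)) * ?w \<rho> * indicator {0<..} \<rho> \<le>
      ennreal (a * ?\<omega>) * (ennreal (\<rho> powr (- (a - ?N) - 1)) * indicator {R<..} \<rho>)" for \<rho>
  proof (cases "R < \<rho>")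
    case True
    have "?w \<rho> \<le> emeasure lborel (ball (0::'a) \<rho>)" by (intro emeasure_mono) auto
    also have "\<dots> = ennreal (?\<omega> * \<rho> ^ DIM('a))" using True R_pos by (simp add: emeasure_ball)
    finally have "ennreal (a * \<rho> powr (- a - 1)) * ?w \<rho> \<le>
        ennreal (a * \<rho> powr (- a - 1)) * ennreal (?\<omega> * \<rho> ^ DIM('a))"
      by (rule mult_left_mono) simp
    also have "\<rho> ^ DIM('a) = \<rho> powr ?N" using True R_pos by (simp add: powr_realpow)
    also have "ennreal (a * \<rho> powr (- a - 1)) * ennreal (?\<omega> * \<rho> powr ?N) =
        ennreal (a * ?\<omega>) * ennreal (\<rho> powr (- a - 1) * \<rho> powr ?N)"
      using a_pos by (simp add: ennreal_mult[symmetric] ac_simps)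
    also have "\<rho> powr (- a - 1) * \<rho> powr ?N = \<rho> powr (- (a - ?N) - 1)"
      unfolding powr_add[symmetric] by (rule arg_cong) simp
    finally show ?thesis using True R_pos by simp
  next
    case False
    then have "- ball (0::'a) R \<inter> ball 0 \<rho> = {}" by auto
    then show ?thesis by simp
  qed
  have "(\<integral>\<^sup>+x\<in>- ball (0::'a) R. ennreal (norm x powr - a) \<partial>lborel) =
      (\<integral>\<^sup>+\<rho>\<in>{0<..}. ennreal (a * \<rho> powr (- a - 1)) * ?w \<rho> \<partial>lborel)"
    using a_pos by (intro nn_integral_norm_powr_layer_cake) auto
  also have "\<dots> \<le>
      (\<integral>\<^sup>+\<rho>. ennreal (a * ?\<omega>) * (ennreal (\<rho> powr (- (a - ?N) - 1)) * indicator {R<..} \<rho>) \<partial>lborel)"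
    by (intro nn_integral_mono layer_le)
  also have "\<dots> = ennreal (a * ?\<omega>) * ennreal (R powr - (a - ?N) / (a - ?N))"
    using a_gt R_pos nn_integral_powr_Ioi[of "a - ?N" R] by (simp add: nn_integral_cmult)
  also have "\<dots> < \<infinity>" by (simp add: ennreal_mult_less_top)
  finally show ?thesis .
qed

lemma locally_integrable_of_le_norm_powr:
  fixes \<mu> :: "'a::euclidean_space \<Rightarrow> real" and a c d :: real
  assumes a_bounds: "0 < a" "a < DIM('a)" and [measurable]: "\<mu> \<in> borel_measurable borel"
    and nonneg: "\<And>x. 0 \<le> \<mu> x"
    and cd_nonneg: "0 \<le> c" "0 \<le> d" and \<mu>_le: "\<And>x. \<mu> x \<le> c + d * norm x powr - a"
  shows "locally_integrable \<mu>"
  unfolding locally_integrable_def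
proof (intro allI impI)
  fix A :: "'a set" assume A_compact: "compact A"
  then have [measurable]: "A \<in> sets borel" by (rule borel_compact)
  obtain R where R: "R > 0" "A \<subseteq> ball 0 R"
    using bounded_subset_ballD[OF compact_imp_bounded[OF A_compact], of 0] by auto
  have [measurable]: "ball (0::'a) R \<in> sets borel" by simp
  have "(\<integral>\<^sup>+x. ennreal (norm (indicat_real A x *\<^sub>R \<mu> x)) \<partial>lborel) \<le>
      (\<integral>\<^sup>+x. ennreal c * indicator (ball 0 R) (x::'a) +
        ennreal d * (ennreal (norm x powr - a) * indicator (ball 0 R) x) \<partial>lborel)"
  proof (rule nn_integral_mono)
    fix x :: 'a
    have "ennreal (\<mu> x) \<le> ennreal (c + d * norm x powr - a)" using \<mu>_le by (rule ennreal_leI)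
    also have "\<dots> = ennreal c + ennreal d * ennreal (norm x powr - a)"
      using cd_nonneg by (simp add: ennreal_mult)
    finally show "ennreal (norm (indicat_real A x *\<^sub>R \<mu> x)) \<le>
        ennreal c * indicator (ball 0 R) x + ennreal d *
          (ennreal (norm x powr - a) * indicator (ball 0 R) x)"
      using R(2) nonneg[of x] by (cases "x \<in> A") (auto simp: indicator_def)
  qed
  also have "\<dots> = ennreal c * emeasure lborel (ball (0::'a) R) +
      ennreal d * (\<integral>\<^sup>+x\<in>ball (0::'a) R. ennreal (norm x powr - a) \<partial>lborel)"
    by (simp add: nn_integral_add nn_integral_cmult nn_integral_cmult_indicator)
  also have "\<dots> < \<infinity>"
    using nn_integral_norm_powr_ball_le[OF a_bounds R(1)] emeasure_lborel_ball_finite[of "0::'a" R]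
    by (simp add: ennreal_mult_less_top le_less_trans)
  finally show "set_integrable lborel A \<mu>"
    unfolding set_integrable_def integrable_iff_bounded by simp
qed

lemma integrable_exp_norm_powr:
  fixes t \<theta> :: real
  assumes t_pos: "0 < t" and \<theta>_pos: "0 < \<theta>"
  shows "integrable lborel (\<lambda>\<xi>::'a::euclidean_space. exp (- t * norm \<xi> powr \<theta>))"
proof -
  obtain k :: nat where k_large: "DIM('a) < \<theta> * k"
    using reals_Archimedean3[OF \<theta>_pos] by (auto simp: mult.commute)
  have decay: "exp (- t * norm \<xi> powr \<theta>) \<le> fact k / t ^ k * norm \<xi> powr - (\<theta> * k)" if "\<xi> \<noteq> 0" for \<xi> :: 'a
  proof -
    have "(t * norm \<xi> powr \<theta>) ^ k / fact k \<le> exp (t * norm \<xi> powr \<theta>)"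
      using t_pos sum_le_suminf[OF summable_exp_generic[of "t * norm \<xi> powr \<theta>"], of "{k}"]
      by (simp add: exp_def divide_inverse_commute)
    then show ?thesis
      using t_pos that
      by (simp add: exp_minus powr_minus power_mult_distrib powr_powr powr_realpow[symmetric]
         field_simps)
  qed
  have "(\<integral>\<^sup>+\<xi>. ennreal (exp (- t * norm (\<xi>::'a) powr \<theta>)) \<partial>lborel) \<le>
      (\<integral>\<^sup>+\<xi>. indicator (ball 0 1) (\<xi>::'a) +
        ennreal (fact k / t ^ k) * (ennreal (norm \<xi> powr - (\<theta> * k)) * indicator (- ball 0 1) \<xi>) \<partial>lborel)"
  proof (rule nn_integral_mono)
    fix \<xi> :: 'a
    show "ennreal (exp (- t * norm \<xi> powr \<theta>)) \<le> indicator (ball 0 1) \<xi> +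
        ennreal (fact k / t ^ k) * (ennreal (norm \<xi> powr - (\<theta> * k)) * indicator (- ball 0 1) \<xi>)"
      using t_pos decay[of \<xi>]
      by (cases "norm \<xi> < 1"; cases "\<xi> = 0") (auto simp: ennreal_mult[symmetric] intro: ennreal_leI)
  qed
  also have "\<dots> = emeasure lborel (ball (0::'a) 1) +
      ennreal (fact k / t ^ k) * (\<integral>\<^sup>+\<xi>\<in>- ball (0::'a) 1. ennreal (norm \<xi> powr - (\<theta> * k)) \<partial>lborel)"
  proof -
    have [measurable]: "ball (0::'a) 1 \<in> sets borel" by simp
    show ?thesis by (simp add: nn_integral_add nn_integral_cmult)
  qed
  also have "\<dots> < \<infinity>"
    using nn_integral_norm_powr_outside_ball[OF k_large, of 1] emeasure_lborel_ball_finite[of "0::'a" 1]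
    by (simp add: ennreal_mult_less_top)
  finally show ?thesis by (simp add: integrable_iff_bounded)
qed

section \<open>Cosine transforms\<close>

lemma integral_lborel_affine:
  fixes h :: "'a::euclidean_space \<Rightarrow> real"
  assumes c_nonzero: "c \<noteq> 0" and [measurable]: "h \<in> borel_measurable borel"
  shows "(LBINT x. h x) = \<bar>c\<bar> ^ DIM('a) * (LBINT x. h (t + c *\<^sub>R x))"
  by (subst lborel_affine[OF c_nonzero, of t], subst integral_density) (auto simp: integral_distr)

lemma integral_lborel_reflect:
  fixes h :: "'a::euclidean_space \<Rightarrow> real"
  assumes "h \<in> borel_measurable borel"
  shows "(LBINT x. h (- x)) = (LBINT x. h x)"
  using integral_lborel_affine[of "- 1" h 0] assms by simp

lemma nn_integral_lborel_reflect:
  fixes h :: "'a::euclidean_space \<Rightarrow> ennreal"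
  assumes [measurable]: "h \<in> borel_measurable borel"
  shows "(\<integral>\<^sup>+y. h (x - y) \<partial>lborel) = (\<integral>\<^sup>+y. h y \<partial>lborel)"
proof -
  have "(\<integral>\<^sup>+y. h y \<partial>lborel) =
      (\<integral>\<^sup>+y. h y \<partial>density (distr lborel borel (\<lambda>y. x + (- 1) *\<^sub>R y)) (\<lambda>_. ennreal (\<bar>- 1\<bar> ^ DIM('a))))"
    by (subst lborel_affine[of "- 1" x]) simp_all
  also have "\<dots> = (\<integral>\<^sup>+y. h (x + (- 1) *\<^sub>R y) \<partial>lborel)"
    by (subst nn_integral_density) (auto simp: nn_integral_distr)
  finally show ?thesis by simp
qed

lemma integrable_mult_bounded:
  fixes f g :: "'a \<Rightarrow> real"
  assumes f_integrable: "integrable M f" and [measurable]: "g \<in> borel_measurable M"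
    and bound: "AE x in M. \<bar>g x\<bar> \<le> B"
  shows "integrable M (\<lambda>x. g x * f x)"
proof (rule Bochner_Integration.integrable_bound)
  show "integrable M (\<lambda>x. B * \<bar>f x\<bar>)" using f_integrable by (intro integrable_mult_right integrable_abs)
  show "(\<lambda>x. g x * f x) \<in> borel_measurable M" using f_integrable by measurable
  show "AE x in M. norm (g x * f x) \<le> norm (B * \<bar>f x\<bar>)"
    using bound
  proof eventually_elim
    case (elim x)
    then have "\<bar>g x\<bar> * \<bar>f x\<bar> \<le> \<bar>B\<bar> * \<bar>f x\<bar>" by (intro mult_right_mono) auto
    then show ?case by (simp add: abs_mult)
  qed
qed

lemma integrable_pair_mult:
  fixes f :: "'a::euclidean_space \<Rightarrow> real" and g :: "'b::euclidean_space \<Rightarrow> real"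
  assumes "integrable lborel f" "integrable lborel g"
  shows "integrable (lborel \<Otimes>\<^sub>M lborel) (\<lambda>(x, y). f x * g y)"
proof -
  have [measurable]: "f \<in> borel_measurable borel" "g \<in> borel_measurable borel"
    using assms[THEN borel_measurable_integrable] by auto
  show ?thesis
    using assms by (intro lborel_pair.Fubini_integrable) (auto simp: abs_mult)
qed

definition cos_transform :: "('a::euclidean_space \<Rightarrow> real) \<Rightarrow> 'a \<Rightarrow> real" where
  "cos_transform m x = (LBINT \<xi>. cos (x \<bullet> \<xi>) * m \<xi>)"

lemma cos_transform_0: "cos_transform m 0 = (LBINT \<xi>. m \<xi>)"
  by (simp add: cos_transform_def)

lemma integrable_cos_mult:
  assumes "integrable lborel m"
  shows "integrable lborel (\<lambda>\<xi>. cos (x \<bullet> \<xi>) * m \<xi>)"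
  using assms by (rule integrable_mult_bounded[where B = 1]) auto

lemma integrable_sin_mult:
  assumes "integrable lborel m"
  shows "integrable lborel (\<lambda>\<xi>. sin (x \<bullet> \<xi>) * m \<xi>)"
  using assms by (rule integrable_mult_bounded[where B = 1]) auto

lemma abs_cos_transform_le:
  assumes "integrable lborel m"
  shows "\<bar>cos_transform m x\<bar> \<le> (LBINT \<xi>. \<bar>m \<xi>\<bar>)"
  unfolding cos_transform_def
  by (rule integral_abs_bound[THEN order_trans], rule integral_mono')
     (use assms in \<open>auto simp: abs_mult mult_left_le_one_le\<close>)

lemma borel_measurable_cos_transform [measurable]:
  fixes m :: "'a::euclidean_space \<Rightarrow> real"
  assumes [measurable]: "m \<in> borel_measurable borel"
  shows "cos_transform m \<in> borel_measurable borel"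
  unfolding cos_transform_def by measurable

lemma integral_cos_transform_mult:
  fixes m g :: "'a::euclidean_space \<Rightarrow> real"
  assumes m_integrable: "integrable lborel m" and g_integrable: "integrable lborel g"
  shows "(LBINT x. cos_transform m x * g x) = (LBINT \<xi>. m \<xi> * cos_transform g \<xi>)"
proof -
  have "integrable (lborel \<Otimes>\<^sub>M lborel) (\<lambda>p. cos (fst p \<bullet> snd p) * (case p of (\<xi>, x) \<Rightarrow> m \<xi> * g x))"
    by (rule integrable_mult_bounded[OF integrable_pair_mult[OF m_integrable g_integrable], where B = 1])
       auto
  then have "integrable (lborel \<Otimes>\<^sub>M lborel) (\<lambda>(\<xi>, x). m \<xi> * (cos (\<xi> \<bullet> x) * g x))"
    by (simp add: split_beta' mult.left_commute)
  from lborel_pair.Fubini_integral[OF this]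
  have "(LBINT x. LBINT \<xi>. m \<xi> * (cos (\<xi> \<bullet> x) * g x)) = (LBINT \<xi>. LBINT x. m \<xi> * (cos (\<xi> \<bullet> x) * g x))" .
  moreover have "(LBINT \<xi>. m \<xi> * (cos (\<xi> \<bullet> x) * g x)) = cos_transform m x * g x" for x
    unfolding cos_transform_def
    by (subst integral_mult_left_zero[symmetric]) (simp add: inner_commute ac_simps)
  ultimately show ?thesis by (simp add: cos_transform_def)
qed

lemma integral_shifted_cos_mult_even:
  assumes m_integrable: "integrable lborel m" and even: "\<And>\<xi>. m (- \<xi>) = m \<xi>"
  shows "(LBINT y. cos ((x - y) \<bullet> \<xi>) * m y) = cos (x \<bullet> \<xi>) * cos_transform m \<xi>"
proof -
  have [measurable]: "m \<in> borel_measurable borel"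
    using borel_measurable_integrable[OF m_integrable] by simp
  have "(LBINT y. sin (\<xi> \<bullet> - y) * m (- y)) = (LBINT y. sin (\<xi> \<bullet> y) * m y)"
    by (rule integral_lborel_reflect[where h = "\<lambda>y. sin (\<xi> \<bullet> y) * m y"]) measurable
  then have odd: "(LBINT y. sin (\<xi> \<bullet> y) * m y) = 0" by (simp add: even)
  have "(LBINT y. cos ((x - y) \<bullet> \<xi>) * m y) =
      (LBINT y. cos (x \<bullet> \<xi>) * (cos (\<xi> \<bullet> y) * m y) + sin (x \<bullet> \<xi>) * (sin (\<xi> \<bullet> y) * m y))"
    by (intro Bochner_Integration.integral_cong refl)
       (simp add: inner_diff_left cos_diff inner_commute algebra_simps)
  also have "\<dots> = cos (x \<bullet> \<xi>) * cos_transform m \<xi> + sin (x \<bullet> \<xi>) * (LBINT y. sin (\<xi> \<bullet> y) * m y)"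
    unfolding cos_transform_def
    by (subst Bochner_Integration.integral_add)
       (auto intro!: integrable_mult_right integrable_cos_mult integrable_sin_mult m_integrable)
  finally show ?thesis by (simp add: odd)
qed

lemma cos_transform_convolution:
  fixes m k :: "'a::euclidean_space \<Rightarrow> real"
  assumes m_integrable: "integrable lborel m" and k_integrable: "integrable lborel k"
    and even: "\<And>\<xi>. k (- \<xi>) = k \<xi>"
  shows "(LBINT y. cos_transform m (x - y) * k y) = cos_transform (\<lambda>\<xi>. m \<xi> * cos_transform k \<xi>) x"
proof -
  have "integrable (lborel \<Otimes>\<^sub>M lborel) (\<lambda>p. cos ((x - snd p) \<bullet> fst p) * (case p of (\<xi>, y) \<Rightarrow> m \<xi> * k y))"
    by (rule integrable_mult_bounded[OF integrable_pair_mult[OF m_integrable k_integrable], where B = 1])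
       auto
  then have "integrable (lborel \<Otimes>\<^sub>M lborel) (\<lambda>(\<xi>, y). m \<xi> * (cos ((x - y) \<bullet> \<xi>) * k y))"
    by (simp add: split_beta' mult.left_commute)
  from lborel_pair.Fubini_integral[OF this]
  have "(LBINT y. LBINT \<xi>. m \<xi> * (cos ((x - y) \<bullet> \<xi>) * k y)) =
      (LBINT \<xi>. LBINT y. m \<xi> * (cos ((x - y) \<bullet> \<xi>) * k y))" .
  moreover have "(LBINT \<xi>. m \<xi> * (cos ((x - y) \<bullet> \<xi>) * k y)) = cos_transform m (x - y) * k y" for y
    unfolding cos_transform_def by (subst integral_mult_left_zero[symmetric]) (simp add: ac_simps)
  moreover have "(LBINT y. m \<xi> * (cos ((x - y) \<bullet> \<xi>) * k y)) = cos (x \<bullet> \<xi>) * (m \<xi> * cos_transform k \<xi>)"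
    for \<xi>
    using integral_shifted_cos_mult_even[OF k_integrable even] by simp
  ultimately show ?thesis by (simp only: cos_transform_def[of "\<lambda>\<xi>. m \<xi> * cos_transform k \<xi>" x])
qed

definition gaussian :: "real \<Rightarrow> 'a::real_normed_vector \<Rightarrow> real" where
  "gaussian \<delta> x = exp (- \<delta> * (norm x)\<^sup>2)"

lemma gaussian_pos [simp]: "0 < gaussian \<delta> x"
  by (simp add: gaussian_def)

lemma gaussian_nonneg [simp]: "0 \<le> gaussian \<delta> x"
  by (simp add: gaussian_def)

lemma gaussian_le_1 [simp]: "0 \<le> \<delta> \<Longrightarrow> gaussian \<delta> x \<le> 1"
  by (simp add: gaussian_def)

lemma gaussian_at_0 [simp]: "gaussian \<delta> 0 = 1"
  by (simp add: gaussian_def)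

lemma gaussian_minus [simp]: "gaussian \<delta> (- x) = gaussian \<delta> x"
  by (simp add: gaussian_def)

lemma gaussian_add: "gaussian (\<delta> + \<epsilon>) x = gaussian \<delta> x * gaussian \<epsilon> x"
  by (simp add: gaussian_def exp_add[symmetric] algebra_simps)

lemma gaussian_power: "gaussian \<delta> x ^ n = gaussian (\<delta> * n) x"
  unfolding gaussian_def by (subst exp_of_nat_mult[symmetric]) (simp add: algebra_simps)

lemma gaussian_scaleR: "gaussian \<delta> (c *\<^sub>R x) = gaussian (\<delta> * c\<^sup>2) x"
  by (simp add: gaussian_def power_mult_distrib)

lemma borel_measurable_gaussian [measurable]:
  "gaussian \<delta> \<in> borel_measurable (borel :: 'a::{second_countable_topology, real_normed_vector} measure)"
  unfolding gaussian_def by measurable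

lemma integral_gaussian_iexp:
  fixes x \<delta> :: real
  assumes "0 < \<delta>"
  shows "integrable lborel (\<lambda>\<xi>. iexp (x * \<xi>) * complex_of_real (exp (- \<delta> * \<xi>\<^sup>2)))"
    and "(CLBINT \<xi>. iexp (x * \<xi>) * complex_of_real (exp (- \<delta> * \<xi>\<^sup>2))) =
           complex_of_real (sqrt (pi / \<delta>) * exp (- x\<^sup>2 / (4 * \<delta>)))"
proof -
  define scale where "scale = sqrt (2 * \<delta>)"
  have scale: "scale > 0" "scale\<^sup>2 = 2 * \<delta>" using assms by (auto simp: scale_def)
  define h where "h = (\<lambda>y. complex_of_real (std_normal_density y) * iexp ((x / scale) * y))"
  have integrable_h: "integrable lborel h"
  proof (rule Bochner_Integration.integrable_bound)
    show "integrable lborel std_normal_density"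
      using integrable_normal_density[of 1 0] by simp
  qed (auto simp: h_def norm_mult)
  have "char std_normal_distribution (x / scale) =
      (CLBINT y. std_normal_density y *\<^sub>R iexp ((x / scale) * y))"
    unfolding char_def by (subst integral_density) auto
  then have integral_h: "(CLBINT y. h y) = complex_of_real (exp (- (x / scale)\<^sup>2 / 2))"
    by (simp add: h_def char_std_normal_distribution scaleR_conv_of_real)
  have substitute: "h (0 + scale * \<xi>) * complex_of_real (sqrt (2 * pi)) =
      iexp (x * \<xi>) * complex_of_real (exp (- \<delta> * \<xi>\<^sup>2))" for \<xi>
    using scale by (simp add: h_def std_normal_density_def power_mult_distrib field_simps)
  have "integrable lborel (\<lambda>\<xi>. h (0 + scale * \<xi>) * complex_of_real (sqrt (2 * pi)))"
    using integrable_h scale by (intro integrable_mult_left lborel_integrable_real_affine) auto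
  then show "integrable lborel (\<lambda>\<xi>. iexp (x * \<xi>) * complex_of_real (exp (- \<delta> * \<xi>\<^sup>2)))"
    unfolding substitute .
  have "(CLBINT y. h y) = \<bar>scale\<bar> *\<^sub>R (CLBINT \<xi>. h (0 + scale * \<xi>))"
    using scale by (intro lborel_integral_real_affine) auto
  then have "(CLBINT \<xi>. h (0 + scale * \<xi>)) = complex_of_real (exp (- (x / scale)\<^sup>2 / 2) / scale)"
    using scale integral_h by (simp add: scaleR_conv_of_real field_simps)
  then have "(CLBINT \<xi>. h (0 + scale * \<xi>) * complex_of_real (sqrt (2 * pi))) =
      complex_of_real (exp (- (x / scale)\<^sup>2 / 2) / scale * sqrt (2 * pi))"
    by simp
  also have "exp (- (x / scale)\<^sup>2 / 2) / scale * sqrt (2 * pi) = sqrt (pi / \<delta>) * exp (- x\<^sup>2 / (4 * \<delta>))"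
    using assms
    by (simp add: power_divide scale) (simp add: scale_def real_sqrt_mult real_sqrt_divide field_simps)
  finally show "(CLBINT \<xi>. iexp (x * \<xi>) * complex_of_real (exp (- \<delta> * \<xi>\<^sup>2))) =
      complex_of_real (sqrt (pi / \<delta>) * exp (- x\<^sup>2 / (4 * \<delta>)))"
    unfolding substitute .
qed

lemma power2_norm_eq_sum_Basis: "(norm x)\<^sup>2 = (\<Sum>b\<in>Basis. (x \<bullet> b)\<^sup>2)" for x :: "'a::euclidean_space"
  unfolding power2_norm_eq_inner by (subst euclidean_inner) (simp add: power2_eq_square)

lemma lborel_prod_Basis:
  fixes h :: "'a::euclidean_space \<Rightarrow> real \<Rightarrow> complex"
  assumes h: "\<And>b. b \<in> Basis \<Longrightarrow> integrable lborel (h b)"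
  shows "integrable lborel (\<lambda>\<xi>::'a. \<Prod>b\<in>Basis. h b (\<xi> \<bullet> b))"
    and "(CLBINT \<xi>::'a. (\<Prod>b\<in>Basis. h b (\<xi> \<bullet> b))) = (\<Prod>b\<in>Basis. (CLBINT s. h b s))"
proof -
  interpret product_sigma_finite "\<lambda>b::'a. lborel :: real measure" ..
  have [measurable]: "(\<lambda>\<xi>::'a. \<Prod>b\<in>Basis. h b (\<xi> \<bullet> b)) \<in> borel_measurable borel"
  proof (rule borel_measurable_prod)
    fix b :: 'a assume "b \<in> Basis"
    then have [measurable]: "h b \<in> borel_measurable borel"
      using borel_measurable_integrable[OF h] by simp
    show "(\<lambda>\<xi>. h b (\<xi> \<bullet> b)) \<in> borel_measurable borel" by measurable
  qed
  have coordinates: "(\<Prod>b\<in>Basis. h b ((\<Sum>c\<in>Basis. y c *\<^sub>R c) \<bullet> b)) = (\<Prod>b\<in>Basis. h b (y b))" for y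
    by (intro prod.cong refl)
       (simp add: inner_sum_left inner_Basis if_distrib sum.If_cases cong: if_cong)
  show "integrable lborel (\<lambda>\<xi>::'a. \<Prod>b\<in>Basis. h b (\<xi> \<bullet> b))"
    by (subst lborel_eq, subst integrable_distr_eq)
       (auto simp: coordinates intro!: product_integrable_prod h)
  show "(CLBINT \<xi>::'a. (\<Prod>b\<in>Basis. h b (\<xi> \<bullet> b))) = (\<Prod>b\<in>Basis. (CLBINT s. h b s))"
    by (subst lborel_eq, subst integral_distr) (auto simp: coordinates intro!: product_integral_prod h)
qed

lemma
  fixes x :: "'a::euclidean_space" and \<delta> :: real
  assumes \<delta>_pos: "0 < \<delta>"
  shows integrable_gaussian: "integrable lborel (gaussian \<delta> :: 'a \<Rightarrow> real)"
    and cos_transform_gaussian: "cos_transform (gaussian \<delta>) x =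
      sqrt (pi / \<delta>) ^ DIM('a) * gaussian (1 / (4 * \<delta>)) x"
proof -
  let ?factor = "\<lambda>x b \<xi>. iexp (((x::'a) \<bullet> b) * \<xi>) * complex_of_real (exp (- \<delta> * \<xi>\<^sup>2))"
  have factorise: "(\<Prod>b\<in>Basis. ?factor x b (\<xi> \<bullet> b)) =
      iexp (x \<bullet> \<xi>) * complex_of_real (gaussian \<delta> \<xi>)" for x \<xi> :: 'a
    unfolding prod.distrib gaussian_def power2_norm_eq_sum_Basis
    by (subst (3) euclidean_inner)
       (simp add: exp_sum[symmetric] sum_distrib_left sum_negf flip: of_real_prod)
  have integrable: "integrable lborel (\<lambda>\<xi>. iexp (x \<bullet> \<xi>) * complex_of_real (gaussian \<delta> \<xi>))" for x :: 'a
    unfolding factorise[symmetric] by (intro lborel_prod_Basis integral_gaussian_iexp \<delta>_pos)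
  show "integrable lborel (gaussian \<delta> :: 'a \<Rightarrow> real)"
    using integrable_Re[OF integrable[of 0]] by simp
  have "(CLBINT \<xi>. iexp (x \<bullet> \<xi>) * complex_of_real (gaussian \<delta> \<xi>)) =
      (\<Prod>b\<in>Basis. (CLBINT s. ?factor x b s))"
    unfolding factorise[symmetric] by (intro lborel_prod_Basis integral_gaussian_iexp \<delta>_pos)
  also have "\<dots> = (\<Prod>b\<in>Basis. complex_of_real (sqrt (pi / \<delta>) * exp (- (x \<bullet> b)\<^sup>2 / (4 * \<delta>))))"
    using \<delta>_pos by (intro prod.cong refl integral_gaussian_iexp)
  also have "\<dots> = complex_of_real (sqrt (pi / \<delta>) ^ DIM('a) * gaussian (1 / (4 * \<delta>)) x)"
    unfolding gaussian_def power2_norm_eq_sum_Basis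
    by (simp add: prod.distrib exp_sum[symmetric] sum_negf sum_divide_distrib flip: of_real_prod)
  finally have "Re (CLBINT \<xi>. iexp (x \<bullet> \<xi>) * complex_of_real (gaussian \<delta> \<xi>)) =
      sqrt (pi / \<delta>) ^ DIM('a) * gaussian (1 / (4 * \<delta>)) x"
    by simp
  then show "cos_transform (gaussian \<delta>) x =
      sqrt (pi / \<delta>) ^ DIM('a) * gaussian (1 / (4 * \<delta>)) x"
    using integral_Re[OF integrable[of x]] by (simp add: cos_transform_def Re_exp)
qed

lemma integral_gaussian:
  assumes "0 < \<delta>"
  shows "(LBINT \<xi>::'a::euclidean_space. gaussian \<delta> \<xi>) = sqrt (pi / \<delta>) ^ DIM('a)"
  using cos_transform_gaussian[OF assms, of "0::'a"] by (simp add: cos_transform_0)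

definition gaussian_mean :: "real \<Rightarrow> ('a::euclidean_space \<Rightarrow> real) \<Rightarrow> 'a \<Rightarrow> real" where
  "gaussian_mean r m x = (LBINT \<zeta>. m (x + r *\<^sub>R \<zeta>) * gaussian 1 \<zeta>) / sqrt pi ^ DIM('a)"

lemma gaussian_mean_nonneg: "(\<And>y. 0 \<le> m y) \<Longrightarrow> 0 \<le> gaussian_mean r m x"
  by (auto simp: gaussian_mean_def intro!: divide_nonneg_nonneg integral_nonneg_AE)

lemma gaussian_mean_const: "gaussian_mean r (\<lambda>_. c) x = c"
  using integral_gaussian[of 1, where 'a = 'a] by (simp add: gaussian_mean_def)

lemma tendsto_gaussian_mean:
  fixes x :: "'a::euclidean_space"
  assumes m_continuous: "continuous_on UNIV m" and bound: "\<And>\<xi>. \<bar>m \<xi>\<bar> \<le> B" and r_tendsto_0: "r \<longlonglongrightarrow> 0"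
  shows "(\<lambda>n. gaussian_mean (r n) m x) \<longlonglongrightarrow> m x"
proof -
  have [measurable]: "m \<in> borel_measurable borel"
    using m_continuous by (rule borel_measurable_continuous_onI)
  have "(\<lambda>n. LBINT \<zeta>. m (x + r n *\<^sub>R \<zeta>) * gaussian 1 \<zeta>) \<longlonglongrightarrow> (LBINT \<zeta>::'a. m x * gaussian 1 \<zeta>)"
  proof (rule integral_dominated_convergence)
    show "integrable lborel (\<lambda>\<zeta>::'a. B * gaussian 1 \<zeta>)"
      using integrable_gaussian[of 1, where 'a = 'a] by simp
    show "AE \<zeta> in lborel. (\<lambda>n. m (x + r n *\<^sub>R \<zeta>) * gaussian 1 \<zeta>) \<longlonglongrightarrow> m x * gaussian 1 \<zeta>"
    proof (rule AE_I2)
      fix \<zeta> :: 'a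
      have "(\<lambda>n. x + r n *\<^sub>R \<zeta>) \<longlonglongrightarrow> x + 0 *\<^sub>R \<zeta>" by (intro tendsto_intros r_tendsto_0)
      then have "(\<lambda>n. m (x + r n *\<^sub>R \<zeta>)) \<longlonglongrightarrow> m x"
        using m_continuous by (intro continuous_on_tendsto_compose[OF m_continuous]) auto
      then show "(\<lambda>n. m (x + r n *\<^sub>R \<zeta>) * gaussian 1 \<zeta>) \<longlonglongrightarrow> m x * gaussian 1 \<zeta>"
        by (intro tendsto_intros)
    qed
    show "AE \<zeta> in lborel. norm (m (x + r n *\<^sub>R \<zeta>) * gaussian 1 \<zeta>) \<le> B * gaussian 1 \<zeta>" for n
      using bound by (auto simp: abs_mult mult_right_mono)
  qed measurable
  then have "(\<lambda>n. gaussian_mean (r n) m x) \<longlonglongrightarrow> gaussian_mean 0 (\<lambda>_. m x) x"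
    unfolding gaussian_mean_def by (intro tendsto_intros) auto
  then show ?thesis by (simp add: gaussian_mean_const)
qed

lemma cos_transform_cos_gaussian:
  fixes \<eta> \<xi> :: "'a::euclidean_space"
  assumes \<delta>_pos: "0 < \<delta>"
  shows "cos_transform (\<lambda>x. cos (\<eta> \<bullet> x) * gaussian \<delta> x) \<xi> =
    sqrt (pi / \<delta>) ^ DIM('a) / 2 *
      (gaussian (1 / (4 * \<delta>)) (\<xi> - \<eta>) + gaussian (1 / (4 * \<delta>)) (\<xi> + \<eta>))"
proof -
  let ?\<gamma> = "gaussian \<delta> :: 'a \<Rightarrow> real"
  have "cos_transform (\<lambda>x. cos (\<eta> \<bullet> x) * ?\<gamma> x) \<xi> =
      (LBINT x. 1 / 2 * (cos ((\<xi> - \<eta>) \<bullet> x) * ?\<gamma> x + cos ((\<xi> + \<eta>) \<bullet> x) * ?\<gamma> x))"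
    unfolding cos_transform_def
    by (intro Bochner_Integration.integral_cong refl)
       (simp add: inner_diff_left inner_add_left cos_add cos_diff field_simps)
  also have "\<dots> = 1 / 2 * (cos_transform ?\<gamma> (\<xi> - \<eta>) + cos_transform ?\<gamma> (\<xi> + \<eta>))"
    unfolding cos_transform_def
    by (subst integral_mult_right_zero, subst Bochner_Integration.integral_add)
       (intro integrable_cos_mult integrable_gaussian \<delta>_pos refl)+
  finally show ?thesis
    unfolding cos_transform_gaussian[OF \<delta>_pos] by (simp add: distrib_left)
qed

lemma integral_gaussian_mult_eq_gaussian_mean:
  fixes m :: "'a::euclidean_space \<Rightarrow> real"
  assumes [measurable]: "m \<in> borel_measurable borel" and \<delta>_pos: "0 < \<delta>"
  shows "sqrt (pi / \<delta>) ^ DIM('a) * (LBINT \<xi>. gaussian (1 / (4 * \<delta>)) (\<xi> - \<eta>) * m \<xi>) =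
    (2 * pi) ^ DIM('a) * gaussian_mean (2 * sqrt \<delta>) m \<eta>"
proof -
  let ?N = "DIM('a)" and ?\<gamma> = "gaussian (1 / (4 * \<delta>)) :: 'a \<Rightarrow> real"
  have "(LBINT \<xi>. ?\<gamma> (\<xi> - \<eta>) * m \<xi>) =
      \<bar>2 * sqrt \<delta>\<bar> ^ ?N * (LBINT \<zeta>. ?\<gamma> ((\<eta> + (2 * sqrt \<delta>) *\<^sub>R \<zeta>) - \<eta>) * m (\<eta> + (2 * sqrt \<delta>) *\<^sub>R \<zeta>))"
    using \<delta>_pos by (intro integral_lborel_affine) auto
  also have "(\<lambda>\<zeta>. ?\<gamma> ((\<eta> + (2 * sqrt \<delta>) *\<^sub>R \<zeta>) - \<eta>)) = gaussian 1"
    using \<delta>_pos by (simp add: gaussian_scaleR power_mult_distrib fun_eq_iff)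
  finally have rescaled: "(LBINT \<xi>. ?\<gamma> (\<xi> - \<eta>) * m \<xi>) =
      \<bar>2 * sqrt \<delta>\<bar> ^ ?N * (LBINT \<zeta>. gaussian 1 \<zeta> * m (\<eta> + (2 * sqrt \<delta>) *\<^sub>R \<zeta>))" .
  have "sqrt (pi / \<delta>) * \<bar>2 * sqrt \<delta>\<bar> = 2 * pi / sqrt pi"
    using \<delta>_pos by (simp add: real_sqrt_divide field_simps)
  then have "sqrt (pi / \<delta>) ^ ?N * \<bar>2 * sqrt \<delta>\<bar> ^ ?N = (2 * pi) ^ ?N / sqrt pi ^ ?N"
    by (simp only: power_mult_distrib[symmetric] power_divide[symmetric])
  then show ?thesis
    unfolding rescaled
    by (simp add: gaussian_mean_def mult.commute[of "gaussian _ _"] mult.assoc[symmetric])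
qed

lemma integral_cos_transform_mult_cos_gaussian:
  fixes \<eta> :: "'a::euclidean_space"
  assumes m_integrable: "integrable lborel m" and even: "\<And>\<xi>. m (- \<xi>) = m \<xi>" and \<delta>_pos: "0 < \<delta>"
  shows "(LBINT x. cos_transform m x * (cos (\<eta> \<bullet> x) * gaussian \<delta> x)) =
    (2 * pi) ^ DIM('a) * gaussian_mean (2 * sqrt \<delta>) m \<eta>"
proof -
  let ?N = "DIM('a)"
  have [measurable]: "m \<in> borel_measurable borel"
    using borel_measurable_integrable[OF m_integrable] by simp
  define \<gamma> where "\<gamma> = (gaussian (1 / (4 * \<delta>)) :: 'a \<Rightarrow> real)"
  have [measurable]: "\<gamma> \<in> borel_measurable borel" unfolding \<gamma>_def by measurable
  have integrable: "integrable lborel (\<lambda>\<xi>. \<gamma> (\<xi> - a) * m \<xi>)" for a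
    using m_integrable by (rule integrable_mult_bounded[where B = 1]) (use \<delta>_pos in \<open>auto simp: \<gamma>_def\<close>)
  have "(LBINT \<xi>. \<gamma> (- \<xi> - (- \<eta>)) * m (- \<xi>)) = (LBINT \<xi>. \<gamma> (\<xi> - (- \<eta>)) * m \<xi>)"
    by (rule integral_lborel_reflect[where h = "\<lambda>\<xi>. \<gamma> (\<xi> - (- \<eta>)) * m \<xi>"]) measurable
  then have reflect: "(LBINT \<xi>. \<gamma> (\<xi> - (- \<eta>)) * m \<xi>) = (LBINT \<xi>. \<gamma> (\<xi> - \<eta>) * m \<xi>)"
    using gaussian_minus[of _ "_ - \<eta>"] by (simp add: \<gamma>_def even)
  have "(LBINT x. cos_transform m x * (cos (\<eta> \<bullet> x) * gaussian \<delta> x)) =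
      (LBINT \<xi>. sqrt (pi / \<delta>) ^ ?N / 2 * (\<gamma> (\<xi> - \<eta>) * m \<xi> + \<gamma> (\<xi> - (- \<eta>)) * m \<xi>))"
    unfolding
      integral_cos_transform_mult[OF m_integrable integrable_cos_mult[OF integrable_gaussian[OF \<delta>_pos]]]
      cos_transform_cos_gaussian[OF \<delta>_pos]
    by (simp add: \<gamma>_def algebra_simps)
  also have "\<dots> = sqrt (pi / \<delta>) ^ ?N * (LBINT \<xi>. \<gamma> (\<xi> - \<eta>) * m \<xi>)"
    unfolding integral_mult_right_zero Bochner_Integration.integral_add[OF integrable integrable] reflect
    by simp
  also have "\<dots> = (2 * pi) ^ ?N * gaussian_mean (2 * sqrt \<delta>) m \<eta>"
    unfolding \<gamma>_def using \<delta>_pos by (intro integral_gaussian_mult_eq_gaussian_mean) measurable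
  finally show ?thesis .
qed

lemma tendsto_mult_gaussian_1:
  fixes x :: "'a::real_normed_vector"
  shows "(\<lambda>n. a * gaussian (1 / Suc n) x) \<longlonglongrightarrow> a"
proof -
  have "(\<lambda>n. gaussian (1 / Suc n) x) \<longlonglongrightarrow> 1"
    unfolding gaussian_def by real_asymp
  from tendsto_mult[OF tendsto_const this] show ?thesis by simp
qed

context
  fixes m :: "'a::euclidean_space \<Rightarrow> real"
  assumes m: "integrable lborel m" "\<And>\<xi>. m (- \<xi>) = m \<xi>" "continuous_on UNIV m" "bounded (range m)"
    and nonneg: "\<And>x. 0 \<le> cos_transform m x"
begin

lemma tendsto_gaussian_regularisation:
  "(\<lambda>n. LBINT x. cos_transform m x * (cos (\<eta> \<bullet> x) * gaussian (1 / Suc n) x))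
    \<longlonglongrightarrow> (2 * pi) ^ DIM('a) * m \<eta>"
proof -
  obtain B where "\<And>\<xi>. \<bar>m \<xi>\<bar> \<le> B" using m(4) by (auto simp: bounded_iff)
  moreover have "(\<lambda>n. 2 * sqrt (1 / Suc n)) \<longlonglongrightarrow> 0" by real_asymp
  ultimately have "(\<lambda>n. gaussian_mean (2 * sqrt (1 / Suc n)) m \<eta>) \<longlonglongrightarrow> m \<eta>"
    by (intro tendsto_gaussian_mean m)
  then have "(\<lambda>n. (2 * pi) ^ DIM('a) * gaussian_mean (2 * sqrt (1 / Suc n)) m \<eta>)
      \<longlonglongrightarrow> (2 * pi) ^ DIM('a) * m \<eta>"
    by (intro tendsto_intros)
  then show ?thesis
    by (subst integral_cos_transform_mult_cos_gaussian[OF m(1,2)]) auto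
qed

lemma has_bochner_integral_cos_transform:
  "has_bochner_integral lborel (cos_transform m) ((2 * pi) ^ DIM('a) * m 0)"
proof (rule has_bochner_integral_monotone_convergence)
  have [measurable]: "m \<in> borel_measurable borel" using borel_measurable_integrable[OF m(1)] by simp
  show "integrable lborel (\<lambda>x. cos_transform m x * gaussian (1 / Suc n) x)" for n
    by (rule integrable_mult_bounded[OF integrable_gaussian])
       (use abs_cos_transform_le[OF m(1)] in auto)
  show "AE x in lborel. mono (\<lambda>n. cos_transform m x * gaussian (1 / Suc n) x)"
    using nonneg
    by (auto intro!: AE_I2 monoI mult_left_mono mult_right_mono simp: gaussian_def divide_simps)
  show "AE x in lborel. (\<lambda>n. cos_transform m x * gaussian (1 / Suc n) x) \<longlonglongrightarrow> cos_transform m x"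
    by (intro AE_I2 tendsto_mult_gaussian_1)
  show "(\<lambda>n. LBINT x. cos_transform m x * gaussian (1 / Suc n) x) \<longlonglongrightarrow> (2 * pi) ^ DIM('a) * m 0"
    using tendsto_gaussian_regularisation[of 0] by simp
  show "cos_transform m \<in> borel_measurable lborel" by simp
qed

lemma cos_transform_inversion: "cos_transform (cos_transform m) \<eta> = (2 * pi) ^ DIM('a) * m \<eta>"
proof (rule LIMSEQ_unique)
  have integrable: "integrable lborel (cos_transform m)"
    using has_bochner_integral_cos_transform by (simp add: has_bochner_integral_iff)
  show "(\<lambda>n. LBINT x. cos_transform m x * (cos (\<eta> \<bullet> x) * gaussian (1 / Suc n) x))
      \<longlonglongrightarrow> cos_transform (cos_transform m) \<eta>"
    unfolding cos_transform_def[of "cos_transform m"]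
  proof (rule integral_dominated_convergence[OF _ _ integrable])
    show "AE x in lborel. (\<lambda>n. cos_transform m x * (cos (\<eta> \<bullet> x) * gaussian (1 / Suc n) x))
        \<longlonglongrightarrow> cos (\<eta> \<bullet> x) * cos_transform m x"
      using tendsto_mult_gaussian_1 by (intro AE_I2) (simp add: mult.assoc[symmetric] mult.commute)
    show "AE x in lborel. norm (cos_transform m x * (cos (\<eta> \<bullet> x) * gaussian (1 / Suc n) x))
        \<le> cos_transform m x" for n
      using nonneg by (auto simp: abs_mult intro!: AE_I2 mult_left_le mult_le_one)
  qed (use borel_measurable_integrable[OF integrable] in measurable)
qed (rule tendsto_gaussian_regularisation)

end

section \<open>Positive definite multipliers\<close>

text \<open>Testing against all Gaussian cut-offs, rather than requiring integrability, makes the class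
  trivially stable under multiplication by Gaussians.\<close>
definition pos_definite :: "('a::euclidean_space \<Rightarrow> real) \<Rightarrow> bool" where
  "pos_definite m \<longleftrightarrow> m \<in> borel_measurable borel \<and> (\<exists>B. AE \<xi> in lborel. \<bar>m \<xi>\<bar> \<le> B) \<and>
     (\<forall>x. \<forall>\<delta>>0. 0 \<le> cos_transform (\<lambda>\<xi>. m \<xi> * gaussian \<delta> \<xi>) x)"

lemma pos_definite_measurable: "pos_definite m \<Longrightarrow> m \<in> borel_measurable borel"
  by (simp add: pos_definite_def)

lemma pos_definite_bounded:
  assumes "pos_definite m"
  obtains B where "AE \<xi> in lborel. \<bar>m \<xi>\<bar> \<le> B"
  using assms by (auto simp: pos_definite_def)

lemma pos_definite_cos_transform_nonneg:
  "pos_definite m \<Longrightarrow> 0 < \<delta> \<Longrightarrow> 0 \<le> cos_transform (\<lambda>\<xi>. m \<xi> * gaussian \<delta> \<xi>) x"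
  by (simp add: pos_definite_def)

lemma pos_definite_integrable_mult_gaussian:
  fixes m :: "'a::euclidean_space \<Rightarrow> real"
  assumes "pos_definite m" "0 < \<delta>"
  shows "integrable lborel (\<lambda>\<xi>. m \<xi> * gaussian \<delta> \<xi>)"
  using assms by (auto simp: pos_definite_def intro: integrable_mult_bounded integrable_gaussian)

lemma pos_definite_1: "pos_definite (\<lambda>_::'a::euclidean_space. 1)"
  by (auto simp: pos_definite_def cos_transform_gaussian)

lemma pos_definite_mult_gaussian:
  fixes m :: "'a::euclidean_space \<Rightarrow> real"
  assumes m_pos_definite: "pos_definite m" and l_nonneg: "0 \<le> l"
  shows "pos_definite (\<lambda>\<xi>. gaussian l \<xi> * m \<xi>)"
  unfolding pos_definite_def
proof (intro conjI allI impI)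
  have [measurable]: "m \<in> borel_measurable borel" using m_pos_definite by (rule pos_definite_measurable)
  show "(\<lambda>\<xi>. gaussian l \<xi> * m \<xi>) \<in> borel_measurable borel" by measurable
  obtain B where "AE \<xi> in lborel. \<bar>m \<xi>\<bar> \<le> B" using m_pos_definite by (rule pos_definite_bounded)
  then have "AE \<xi> in lborel. \<bar>gaussian l \<xi> * m \<xi>\<bar> \<le> 1 * B"
    by eventually_elim (simp only: abs_mult, intro mult_mono, use l_nonneg in auto)
  then show "\<exists>B. AE \<xi> in lborel. \<bar>gaussian l \<xi> * m \<xi>\<bar> \<le> B" by blast
  fix x :: 'a and \<delta> :: real assume "0 < \<delta>"
  then have "0 \<le> cos_transform (\<lambda>\<xi>. m \<xi> * gaussian (l + \<delta>) \<xi>) x"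
    using l_nonneg by (intro pos_definite_cos_transform_nonneg m_pos_definite) auto
  then show "0 \<le> cos_transform (\<lambda>\<xi>. gaussian l \<xi> * m \<xi> * gaussian \<delta> \<xi>) x"
    by (simp add: gaussian_add ac_simps)
qed

lemma pos_definite_nonneg_combination:
  fixes m :: "nat \<Rightarrow> 'a::euclidean_space \<Rightarrow> real"
  assumes m_pos_definite: "\<And>i. pos_definite (m i)" and c_nonneg: "\<And>i. 0 \<le> c i"
  shows "pos_definite (\<lambda>\<xi>. \<Sum>i<n. c i * m i \<xi>)"
  unfolding pos_definite_def
proof (intro conjI allI impI)
  have [measurable]: "m i \<in> borel_measurable borel" for i
    using m_pos_definite by (rule pos_definite_measurable)
  show "(\<lambda>\<xi>. \<Sum>i<n. c i * m i \<xi>) \<in> borel_measurable borel" by measurable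
  have "\<forall>i. \<exists>B. AE \<xi> in lborel. \<bar>m i \<xi>\<bar> \<le> B" using m_pos_definite by (auto simp: pos_definite_def)
  then obtain B where "\<And>i. AE \<xi> in lborel. \<bar>m i \<xi>\<bar> \<le> B i" by metis
  then have "AE \<xi> in lborel. \<forall>i. \<bar>m i \<xi>\<bar> \<le> B i" by (simp add: AE_all_countable)
  then have "AE \<xi> in lborel. \<bar>\<Sum>i<n. c i * m i \<xi>\<bar> \<le> (\<Sum>i<n. c i * B i)"
  proof eventually_elim
    case (elim \<xi>)
    have "\<bar>\<Sum>i<n. c i * m i \<xi>\<bar> \<le> (\<Sum>i<n. \<bar>c i * m i \<xi>\<bar>)" by (rule sum_abs)
    also have "\<dots> \<le> (\<Sum>i<n. c i * B i)"
      using elim c_nonneg by (intro sum_mono) (simp add: abs_mult mult_left_mono)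
    finally show ?case .
  qed
  then show "\<exists>B. AE \<xi> in lborel. \<bar>\<Sum>i<n. c i * m i \<xi>\<bar> \<le> B" by blast
  fix x :: 'a and \<delta> :: real assume \<delta>_pos: "0 < \<delta>"
  have "cos_transform (\<lambda>\<xi>. (\<Sum>i<n. c i * m i \<xi>) * gaussian \<delta> \<xi>) x =
      (LBINT \<xi>. \<Sum>i<n. c i * (cos (x \<bullet> \<xi>) * (m i \<xi> * gaussian \<delta> \<xi>)))"
    by (simp add: cos_transform_def sum_distrib_left sum_distrib_right ac_simps)
  also have "\<dots> = (\<Sum>i<n. c i * cos_transform (\<lambda>\<xi>. m i \<xi> * gaussian \<delta> \<xi>) x)"
    unfolding cos_transform_def
    by (subst Bochner_Integration.integral_sum)
       (auto intro!: integrable_mult_right integrable_cos_mult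
             pos_definite_integrable_mult_gaussian[OF m_pos_definite \<delta>_pos])
  also have "\<dots> \<ge> 0"
    using c_nonneg pos_definite_cos_transform_nonneg[OF m_pos_definite \<delta>_pos]
    by (intro sum_nonneg mult_nonneg_nonneg) auto
  finally show "0 \<le> cos_transform (\<lambda>\<xi>. (\<Sum>i<n. c i * m i \<xi>) * gaussian \<delta> \<xi>) x" .
qed

lemma tendsto_cos_transform_mult_gaussian:
  fixes m :: "'a::euclidean_space \<Rightarrow> real"
  assumes [measurable]: "\<And>n::nat. h n \<in> borel_measurable borel" "m \<in> borel_measurable borel"
    and \<delta>_pos: "0 < \<delta>"
    and bound: "\<And>n. AE \<xi> in lborel. \<bar>h n \<xi>\<bar> \<le> B" and lim: "AE \<xi> in lborel. (\<lambda>n. h n \<xi>) \<longlonglongrightarrow> m \<xi>"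
  shows "(\<lambda>n. cos_transform (\<lambda>\<xi>. h n \<xi> * gaussian \<delta> \<xi>) x) \<longlonglongrightarrow> cos_transform (\<lambda>\<xi>. m \<xi> * gaussian \<delta> \<xi>) x"
  unfolding cos_transform_def
proof (rule integral_dominated_convergence)
  show "integrable lborel (\<lambda>\<xi>::'a. B * gaussian \<delta> \<xi>)"
    using integrable_gaussian[OF \<delta>_pos] by (rule integrable_mult_right)
  show "AE \<xi> in lborel. (\<lambda>n. cos (x \<bullet> \<xi>) * (h n \<xi> * gaussian \<delta> \<xi>)) \<longlonglongrightarrow> cos (x \<bullet> \<xi>) * (m \<xi> * gaussian \<delta> \<xi>)"
    using lim by eventually_elim (intro tendsto_intros)
  show "AE \<xi> in lborel. norm (cos (x \<bullet> \<xi>) * (h n \<xi> * gaussian \<delta> \<xi>)) \<le> B * gaussian \<delta> \<xi>" for n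
    using bound[of n]
  proof eventually_elim
    case (elim \<xi>)
    then have "\<bar>cos (x \<bullet> \<xi>)\<bar> * (\<bar>h n \<xi>\<bar> * gaussian \<delta> \<xi>) \<le> 1 * (B * gaussian \<delta> \<xi>)"
      by (intro mult_mono mult_right_mono) auto
    then show ?case by (simp add: abs_mult)
  qed
qed measurable

lemma pos_definite_limit:
  fixes m :: "'a::euclidean_space \<Rightarrow> real"
  assumes h_pos_definite: "\<And>n::nat. pos_definite (h n)" and bound: "\<And>n. AE \<xi> in lborel. \<bar>h n \<xi>\<bar> \<le> B"
    and m_measurable: "m \<in> borel_measurable borel" and lim: "AE \<xi> in lborel. (\<lambda>n. h n \<xi>) \<longlonglongrightarrow> m \<xi>"
  shows "pos_definite m"
  unfolding pos_definite_def
proof (intro conjI allI impI)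
  have "AE \<xi> in lborel. \<forall>n. \<bar>h n \<xi>\<bar> \<le> B" using bound by (simp add: AE_all_countable)
  then have "AE \<xi> in lborel. \<bar>m \<xi>\<bar> \<le> B"
    using lim
  proof eventually_elim
    case (elim \<xi>)
    from elim(2) have "(\<lambda>n. \<bar>h n \<xi>\<bar>) \<longlonglongrightarrow> \<bar>m \<xi>\<bar>" by (rule tendsto_rabs)
    then show ?case by (rule LIMSEQ_le_const2) (use elim(1) in auto)
  qed
  then show "\<exists>B. AE \<xi> in lborel. \<bar>m \<xi>\<bar> \<le> B" by blast
  fix x :: 'a and \<delta> :: real assume \<delta>_pos: "0 < \<delta>"
  show "0 \<le> cos_transform (\<lambda>\<xi>. m \<xi> * gaussian \<delta> \<xi>) x"
    using tendsto_cos_transform_mult_gaussian[OF pos_definite_measurable[OF h_pos_definite] m_measurable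
       \<delta>_pos bound lim]
    by (rule LIMSEQ_le_const) (use pos_definite_cos_transform_nonneg[OF h_pos_definite \<delta>_pos] in blast)
qed fact

lemma pos_definite_nonneg_series:
  fixes m :: "nat \<Rightarrow> 'a::euclidean_space \<Rightarrow> real"
  assumes m_pos_definite: "\<And>i. pos_definite (m i)" and c_nonneg: "\<And>i. 0 \<le> c i"
    and nonneg: "\<And>i \<xi>. 0 \<le> m i \<xi>"
    and g_measurable: "g \<in> borel_measurable borel" and g_le: "\<And>\<xi>. g \<xi> \<le> B"
    and sums: "AE \<xi> in lborel. (\<lambda>i. c i * m i \<xi>) sums g \<xi>"
  shows "pos_definite g"
proof (rule pos_definite_limit[where B = B])
  show "pos_definite (\<lambda>\<xi>. \<Sum>i<n. c i * m i \<xi>)" for n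
    using m_pos_definite c_nonneg by (rule pos_definite_nonneg_combination)
  show "AE \<xi> in lborel. \<bar>\<Sum>i<n. c i * m i \<xi>\<bar> \<le> B" for n
    using sums
  proof eventually_elim
    case (elim \<xi>)
    have "(\<Sum>i<n. c i * m i \<xi>) \<le> g \<xi>"
      using sum_le_suminf[OF sums_summable[OF elim], of "{..<n}"] c_nonneg nonneg sums_unique[OF elim]
      by simp
    moreover have "0 \<le> (\<Sum>i<n. c i * m i \<xi>)" using c_nonneg nonneg by (intro sum_nonneg) auto
    ultimately show ?case using g_le[of \<xi>] by linarith
  qed
  show "AE \<xi> in lborel. (\<lambda>n. \<Sum>i<n. c i * m i \<xi>) \<longlonglongrightarrow> g \<xi>" using sums by (simp add: sums_def)
qed (rule g_measurable)

lemma gbinomial_Suc_alternating_nonpos: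
  fixes \<alpha> :: real
  assumes "0 < \<alpha>" "\<alpha> \<le> 1"
  shows "(\<alpha> gchoose Suc n) * (- 1) ^ Suc n \<le> 0"
proof (induction n)
  case 0 then show ?case using assms by simp
next
  case (Suc n)
  have "real (Suc (Suc n)) * (\<alpha> gchoose Suc (Suc n)) = (\<alpha> gchoose Suc n) * (\<alpha> - real (Suc n))"
    using gbinomial_mult_1[of \<alpha> "Suc n"] by (simp add: algebra_simps)
  then have recurrence:
      "(\<alpha> gchoose Suc (Suc n)) = (\<alpha> gchoose Suc n) * (\<alpha> - real (Suc n)) / real (Suc (Suc n))"
    by (simp add: divide_simps mult.commute)
  have "(\<alpha> gchoose Suc (Suc n)) * (- 1) ^ Suc (Suc n) =
      ((\<alpha> gchoose Suc n) * (- 1) ^ Suc n) * ((real (Suc n) - \<alpha>) / real (Suc (Suc n)))"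
    unfolding recurrence by (simp add: divide_simps algebra_simps)
  also have "\<dots> \<le> 0" by (rule mult_nonpos_nonneg[OF Suc]) (use assms in simp)
  finally show ?case .
qed

lemma sums_one_minus_powr:
  fixes \<alpha> x :: real
  assumes "\<bar>x\<bar> < 1"
  shows "(\<lambda>n. - ((\<alpha> gchoose Suc n) * (- 1) ^ Suc n) * x ^ Suc n) sums (1 - (1 - x) powr \<alpha>)"
proof -
  have "(\<lambda>n. (\<alpha> gchoose n) * (- x) ^ n) sums (1 + (- x)) powr \<alpha>"
    using assms by (intro gen_binomial_real) auto
  then have "(\<lambda>n. (\<alpha> gchoose Suc n) * (- x) ^ Suc n) sums ((1 - x) powr \<alpha> - 1)"
    by (subst sums_Suc_iff) simp
  from sums_minus[OF this] show ?thesis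
    by (simp add: power_minus[of x "Suc _"] mult.assoc del: power_Suc)
qed

lemma pos_definite_one_minus_powr_power:
  assumes \<alpha>_bounds: "0 < \<alpha>" "\<alpha> \<le> 1" and l_pos: "0 < l"
  shows "pos_definite (\<lambda>\<xi>::'a::euclidean_space. (1 - (1 - gaussian l \<xi>) powr \<alpha>) ^ k)"
proof (induction k)
  case 0 show ?case using pos_definite_1 by simp
next
  case (Suc k)
  define p where "p = (\<lambda>\<xi>::'a. 1 - (1 - gaussian l \<xi>) powr \<alpha>)"
  have [measurable]: "p \<in> borel_measurable borel" unfolding p_def by measurable
  have p_range: "0 \<le> p \<xi>" "p \<xi> \<le> 1" for \<xi>
    using \<alpha>_bounds l_pos powr_mono2[of \<alpha> "1 - gaussian l \<xi>" 1] by (auto simp: p_def)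
  have "pos_definite (\<lambda>\<xi>. p \<xi> ^ Suc k)"
  proof (rule pos_definite_nonneg_series[where m = "\<lambda>n \<xi>. gaussian (l * Suc n) \<xi> * p \<xi> ^ k" and B = 1
        and c = "\<lambda>n. - ((\<alpha> gchoose Suc n) * (- 1) ^ Suc n)"])
    show "pos_definite (\<lambda>\<xi>. gaussian (l * Suc n) \<xi> * p \<xi> ^ k)" for n
      using l_pos Suc by (intro pos_definite_mult_gaussian) (auto simp: p_def)
    show "0 \<le> - ((\<alpha> gchoose Suc n) * (- 1) ^ Suc n)" for n
      using gbinomial_Suc_alternating_nonpos[OF \<alpha>_bounds] by simp
    show "p \<xi> ^ Suc k \<le> 1" for \<xi> using p_range by (intro power_le_one)
    show "AE \<xi> in lborel. (\<lambda>n. - ((\<alpha> gchoose Suc n) * (- 1) ^ Suc n) *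
        (gaussian (l * Suc n) \<xi> * p \<xi> ^ k)) sums p \<xi> ^ Suc k"
      using AE_lborel_singleton[of "0::'a"]
    proof eventually_elim
      case (elim \<xi>)
      then have "\<bar>gaussian l \<xi>\<bar> < 1" using l_pos by (simp add: gaussian_def)
      then have "(\<lambda>n. - ((\<alpha> gchoose Suc n) * (- 1) ^ Suc n) * gaussian l \<xi> ^ Suc n) sums p \<xi>"
        unfolding p_def by (rule sums_one_minus_powr)
      then have "(\<lambda>n. - ((\<alpha> gchoose Suc n) * (- 1) ^ Suc n) * gaussian l \<xi> ^ Suc n * p \<xi> ^ k)
          sums (p \<xi> * p \<xi> ^ k)"
        by (rule sums_mult2)
      then show ?case by (simp only: gaussian_power mult.assoc power_Suc[of "p \<xi>"])
    qed
  qed (use p_range in auto)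
  then show ?case by (simp add: p_def)
qed

text \<open>With \<open>p = 1 - (1 - x)\<^sup>\<alpha>\<close> and \<open>x = exp (- l |\<xi>|\<^sup>2)\<close>, both p (as a power series in x) and
  \<open>exp (a p)\<close> (as a power series in p) have nonnegative coefficients.\<close>
lemma pos_definite_exp_one_minus_powr:
  assumes \<alpha>_bounds: "0 < \<alpha>" "\<alpha> \<le> 1" and l_pos: "0 < l" and a_nonneg: "0 \<le> a"
  shows "pos_definite (\<lambda>\<xi>::'a::euclidean_space. exp (- a * (1 - gaussian l \<xi>) powr \<alpha>))"
proof -
  define p where "p = (\<lambda>\<xi>::'a. 1 - (1 - gaussian l \<xi>) powr \<alpha>)"
  have p_range: "0 \<le> p \<xi>" "p \<xi> \<le> 1" for \<xi>
    using \<alpha>_bounds l_pos powr_mono2[of \<alpha> "1 - gaussian l \<xi>" 1] by (auto simp: p_def)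
  have "pos_definite (\<lambda>\<xi>. exp (- a * (1 - p \<xi>)))"
  proof (rule pos_definite_nonneg_series[where m = "\<lambda>n \<xi>. p \<xi> ^ n" and B = 1 and
     c = "\<lambda>n. exp (- a) * (a ^ n / fact n)"])
    show "pos_definite (\<lambda>\<xi>. p \<xi> ^ n)" for n
      unfolding p_def using \<alpha>_bounds l_pos by (rule pos_definite_one_minus_powr_power)
    show "AE \<xi> in lborel. (\<lambda>n. exp (- a) * (a ^ n / fact n) * p \<xi> ^ n) sums exp (- a * (1 - p \<xi>))"
    proof (rule AE_I2)
      fix \<xi>
      have "(\<lambda>n. exp (- a) * ((a * p \<xi>) ^ n /\<^sub>R fact n)) sums (exp (- a) * exp (a * p \<xi>))"
        by (intro sums_mult exp_converges)
      moreover have "exp (- a) * exp (a * p \<xi>) = exp (- a * (1 - p \<xi>))"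
        by (simp add: exp_add[symmetric] algebra_simps)
      ultimately show "(\<lambda>n. exp (- a) * (a ^ n / fact n) * p \<xi> ^ n) sums exp (- a * (1 - p \<xi>))"
        by (simp add: power_mult_distrib divide_inverse ac_simps)
    qed
  qed (use a_nonneg p_range in \<open>auto simp: p_def\<close>)
  then show ?thesis by (simp add: p_def)
qed

definition frac_heat_symbol :: "real \<Rightarrow> real \<Rightarrow> 'a::euclidean_space \<Rightarrow> real" where
  "frac_heat_symbol \<theta> t \<xi> = exp (- t * norm \<xi> powr \<theta>)"

lemma pos_definite_frac_heat_symbol:
  assumes \<theta>_bounds: "0 < \<theta>" "\<theta> \<le> 2" and t_pos: "0 < t"
  shows "pos_definite (frac_heat_symbol \<theta> t :: 'a::euclidean_space \<Rightarrow> real)"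
proof (rule pos_definite_limit[where B = 1])
  let ?approx =
      "\<lambda>n. \<lambda>\<xi>::'a. exp (- (t * Suc n powr (\<theta> / 2)) * (1 - gaussian (1 / Suc n) \<xi>) powr (\<theta> / 2))"
  show "pos_definite (?approx n)" for n
    using \<theta>_bounds t_pos by (intro pos_definite_exp_one_minus_powr) auto
  show "AE \<xi> in lborel. \<bar>?approx n \<xi>\<bar> \<le> 1" for n using t_pos by auto
  show "AE \<xi> in lborel. (\<lambda>n. ?approx n \<xi>) \<longlonglongrightarrow> frac_heat_symbol \<theta> t \<xi>"
    using AE_lborel_singleton[of "0::'a"]
  proof eventually_elim
    case (elim \<xi>)
    then have norm_pos: "0 < norm \<xi>" by simp
    then have "(\<lambda>n. Suc n * (1 - gaussian (1 / Suc n) \<xi>)) \<longlonglongrightarrow> (norm \<xi>)\<^sup>2"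
      unfolding gaussian_def by real_asymp
    then have "(\<lambda>n. exp (- t * (Suc n * (1 - gaussian (1 / Suc n) \<xi>)) powr (\<theta> / 2)))
        \<longlonglongrightarrow> exp (- t * ((norm \<xi>)\<^sup>2) powr (\<theta> / 2))"
      using norm_pos by (intro tendsto_intros) auto
    moreover have "((norm \<xi>)\<^sup>2) powr (\<theta> / 2) = norm \<xi> powr \<theta>" by (simp add: powr_powr flip: powr_numeral)
    ultimately show ?case by (simp add: frac_heat_symbol_def powr_mult mult.assoc)
  qed
  show "frac_heat_symbol \<theta> t \<in> borel_measurable borel" unfolding frac_heat_symbol_def by measurable
qed

lemma cos_transform_nonneg:
  fixes m :: "'a::euclidean_space \<Rightarrow> real"
  assumes m_pos_definite: "pos_definite m" and integrable: "integrable lborel m"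
  shows "0 \<le> cos_transform m x"
proof (rule LIMSEQ_le_const)
  have [measurable]: "m \<in> borel_measurable borel" using m_pos_definite by (rule pos_definite_measurable)
  show "(\<lambda>n. cos_transform (\<lambda>\<xi>. m \<xi> * gaussian (1 / Suc n) \<xi>) x) \<longlonglongrightarrow> cos_transform m x"
    unfolding cos_transform_def
  proof (rule integral_dominated_convergence)
    show "integrable lborel (\<lambda>\<xi>. \<bar>m \<xi>\<bar>)" using integrable by (rule integrable_abs)
    show "AE \<xi> in lborel. (\<lambda>n. cos (x \<bullet> \<xi>) * (m \<xi> * gaussian (1 / Suc n) \<xi>)) \<longlonglongrightarrow> cos (x \<bullet> \<xi>) * m \<xi>"
      by (intro AE_I2 tendsto_mult tendsto_const tendsto_mult_gaussian_1)
    show "AE \<xi> in lborel. norm (cos (x \<bullet> \<xi>) * (m \<xi> * gaussian (1 / Suc n) \<xi>)) \<le> \<bar>m \<xi>\<bar>" for n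
    proof (rule AE_I2)
      fix \<xi> :: 'a
      have "\<bar>cos (x \<bullet> \<xi>)\<bar> * (\<bar>m \<xi>\<bar> * gaussian (1 / Suc n) \<xi>) \<le> 1 * (\<bar>m \<xi>\<bar> * 1)"
        by (intro mult_mono) auto
      then show "norm (cos (x \<bullet> \<xi>) * (m \<xi> * gaussian (1 / Suc n) \<xi>)) \<le> \<bar>m \<xi>\<bar>"
        by (simp add: abs_mult)
    qed
  qed measurable
  show "\<exists>N. \<forall>n\<ge>N. 0 \<le> cos_transform (\<lambda>\<xi>. m \<xi> * gaussian (1 / Suc n) \<xi>) x"
    by (intro exI allI impI pos_definite_cos_transform_nonneg m_pos_definite) simp
qed

section \<open>The fractional heat kernel\<close>

text \<open>The integral on the right is a constant multiple of \<open>|y|\<^sup>a\<close>; it turns estimates for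
  \<open>1 - exp (- \<delta>|y|\<^sup>2)\<close>, which the Fourier transform controls, into estimates for moments.\<close>
lemma norm_powr_le_nn_integral_one_minus_gaussian:
  fixes y :: "'a::euclidean_space"
  assumes a_pos: "0 < a"
  shows "ennreal (norm y powr a) \<le> ennreal (a / (2 * (1 - exp (- 1)))) *
    (\<integral>\<^sup>+\<delta>\<in>{0<..}. ennreal (\<delta> powr (- (a / 2) - 1)) * ennreal (1 - gaussian \<delta> y) \<partial>lborel)"
proof (cases "y = 0")
  case False
  define D E where "D = norm y powr - 2" and "E = (1 - exp (- 1) :: real)"
  have D: "0 < D" "D * (norm y)\<^sup>2 = 1" "D powr - (a / 2) = norm y powr a"
    using False by (simp_all add: D_def powr_powr) (simp add: powr_minus)
  have E_pos: "0 < E" by (simp add: E_def)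
  have "ennreal (norm y powr a) = ennreal (a / (2 * E)) *
      (\<integral>\<^sup>+\<delta>. ennreal E * (ennreal (\<delta> powr (- (a / 2) - 1)) * indicator {D<..} \<delta>) \<partial>lborel)"
    using a_pos D E_pos nn_integral_powr_Ioi[of "a / 2" D]
    by (simp add: nn_integral_cmult ennreal_mult[symmetric])
  also have "\<dots> \<le> ennreal (a / (2 * E)) *
      (\<integral>\<^sup>+\<delta>\<in>{0<..}. ennreal (\<delta> powr (- (a / 2) - 1)) * ennreal (1 - gaussian \<delta> y) \<partial>lborel)"
  proof (intro mult_left_mono nn_integral_mono)
    fix \<delta> :: real
    have "E \<le> 1 - gaussian \<delta> y" if "D < \<delta>"
      using that mult_right_mono[of D \<delta> "(norm y)\<^sup>2"] D by (simp add: gaussian_def E_def)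
    then show "ennreal E * (ennreal (\<delta> powr (- (a / 2) - 1)) * indicator {D<..} \<delta>)
        \<le> ennreal (\<delta> powr (- (a / 2) - 1)) * ennreal (1 - gaussian \<delta> y) * indicator {0<..} \<delta>"
      using D(1) by (auto simp: indicator_def mult.commute intro!: mult_right_mono ennreal_leI)
  qed simp
  finally show ?thesis by (simp only: E_def)
qed simp

lemma nn_integral_norm_powr_le_one_minus_gaussian:
  fixes k :: "'a::euclidean_space \<Rightarrow> ennreal"
  assumes a_pos: "0 < a" and [measurable]: "k \<in> borel_measurable borel"
  shows "(\<integral>\<^sup>+y. k y * ennreal (norm y powr a) \<partial>lborel) \<le> ennreal (a / (2 * (1 - exp (- 1)))) *
    (\<integral>\<^sup>+\<delta>\<in>{0<..}. ennreal (\<delta> powr (- (a / 2) - 1)) *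
      (\<integral>\<^sup>+y. k y * ennreal (1 - gaussian \<delta> y) \<partial>lborel) \<partial>lborel)"
proof -
  let ?c = "ennreal (a / (2 * (1 - exp (- 1))))"
  let ?w = "\<lambda>\<delta>. ennreal (\<delta> powr (- (a / 2) - 1)) * indicator {0<..} \<delta>"
  have "(\<integral>\<^sup>+y. k y * ennreal (norm y powr a) \<partial>lborel) \<le>
      (\<integral>\<^sup>+y. \<integral>\<^sup>+\<delta>. ?c * (?w \<delta> * (k y * ennreal (1 - gaussian \<delta> y))) \<partial>lborel \<partial>lborel)"
  proof (rule nn_integral_mono)
    fix y :: 'a
    have "k y * ennreal (norm y powr a) \<le> k y * (?c * (\<integral>\<^sup>+\<delta>\<in>{0<..}. ennreal (\<delta> powr (- (a / 2) - 1)) *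
        ennreal (1 - gaussian \<delta> y) \<partial>lborel))"
      using a_pos by (intro mult_left_mono norm_powr_le_nn_integral_one_minus_gaussian) auto
    also have "\<dots> = (\<integral>\<^sup>+\<delta>. ?c * (?w \<delta> * (k y * ennreal (1 - gaussian \<delta> y))) \<partial>lborel)"
      by (simp add: nn_integral_cmult[symmetric] gaussian_def ac_simps)
    finally show "k y * ennreal (norm y powr a) \<le> \<dots>" .
  qed
  also have "\<dots> = (\<integral>\<^sup>+\<delta>. \<integral>\<^sup>+y. ?c * (?w \<delta> * (k y * ennreal (1 - gaussian \<delta> y))) \<partial>lborel \<partial>lborel)"
    unfolding gaussian_def by (rule lborel_pair.Fubini'[symmetric]) measurable
  also have "\<dots> = ?c * (\<integral>\<^sup>+\<delta>\<in>{0<..}. ennreal (\<delta> powr (- (a / 2) - 1)) *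
      (\<integral>\<^sup>+y. k y * ennreal (1 - gaussian \<delta> y) \<partial>lborel) \<partial>lborel)"
    unfolding gaussian_def by (simp add: nn_integral_cmult) (simp add: ac_simps)
  finally show ?thesis .
qed

lemma frac_heat_kernel_eq_cos_transform:
  "frac_heat_kernel \<theta> x t = cos_transform (frac_heat_symbol \<theta> t) x / (2 * pi) ^ DIM('a)"
  for x :: "'a::euclidean_space"
  by (simp add: frac_heat_kernel_def cos_transform_def frac_heat_symbol_def powr_minus_divide
     powr_realpow)

lemma frac_heat_kernel_minus: "frac_heat_kernel \<theta> (- x) t = frac_heat_kernel \<theta> x t"
  by (simp add: frac_heat_kernel_def)

lemma borel_measurable_frac_heat_kernel [measurable]:
  fixes X :: "'b \<Rightarrow> 'a::euclidean_space"
  assumes [measurable]: "X \<in> borel_measurable M" "\<tau> \<in> borel_measurable M"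
  shows "(\<lambda>z. frac_heat_kernel \<theta> (X z) (\<tau> z)) \<in> borel_measurable M"
proof -
  have "(\<lambda>z. LBINT \<xi>::'a. cos (fst z \<bullet> \<xi>) * exp (- snd z * norm \<xi> powr \<theta>))
      \<in> borel_measurable (borel \<Otimes>\<^sub>M borel)"
    by (rule lborel.borel_measurable_lebesgue_integral) (unfold split_beta', measurable)
  then have "(\<lambda>z::'a \<times> real. frac_heat_kernel \<theta> (fst z) (snd z)) \<in> borel_measurable (borel \<Otimes>\<^sub>M borel)"
    unfolding frac_heat_kernel_def by (intro borel_measurable_times borel_measurable_const)
  from measurable_compose[OF measurable_Pair[OF assms] this] show ?thesis by simp
qed

locale fractional_diffusion =
  fixes \<theta> :: real
  assumes \<theta>_pos: "0 < \<theta>" and \<theta>_le_2: "\<theta> \<le> 2"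
begin

abbreviation K :: "'a::euclidean_space \<Rightarrow> real \<Rightarrow> real" where
  "K \<equiv> frac_heat_kernel \<theta>"

lemma integrable_frac_heat_symbol:
  "0 < t \<Longrightarrow> integrable lborel (frac_heat_symbol \<theta> t :: 'a::euclidean_space \<Rightarrow> real)"
  using integrable_exp_norm_powr[OF _ \<theta>_pos] by (simp add: frac_heat_symbol_def[abs_def])

lemma frac_heat_symbol_inversion_hypotheses:
  assumes "0 < t"
  shows "integrable lborel (frac_heat_symbol \<theta> t :: 'a::euclidean_space \<Rightarrow> real)"
    and "\<And>\<xi>::'a. frac_heat_symbol \<theta> t (- \<xi>) = frac_heat_symbol \<theta> t \<xi>"
    and "continuous_on UNIV (frac_heat_symbol \<theta> t :: 'a \<Rightarrow> real)"
    and "bounded (range (frac_heat_symbol \<theta> t :: 'a \<Rightarrow> real))"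
    and "\<And>x::'a. 0 \<le> cos_transform (frac_heat_symbol \<theta> t) x"
proof -
  show "integrable lborel (frac_heat_symbol \<theta> t :: 'a \<Rightarrow> real)"
    using assms by (rule integrable_frac_heat_symbol)
  then show "0 \<le> cos_transform (frac_heat_symbol \<theta> t) x" for x :: 'a
    using pos_definite_frac_heat_symbol[OF \<theta>_pos \<theta>_le_2 assms] by (intro cos_transform_nonneg)
  show "continuous_on UNIV (frac_heat_symbol \<theta> t :: 'a \<Rightarrow> real)"
    unfolding frac_heat_symbol_def using \<theta>_pos by (intro continuous_intros continuous_on_powr') auto
  show "bounded (range (frac_heat_symbol \<theta> t :: 'a \<Rightarrow> real))"
    using assms by (auto simp: bounded_iff frac_heat_symbol_def intro!: exI[of _ 1])
qed (simp add: frac_heat_symbol_def)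

lemma frac_heat_kernel_nonneg: "0 < t \<Longrightarrow> 0 \<le> K (x::'a::euclidean_space) t"
  by (simp add: frac_heat_kernel_eq_cos_transform frac_heat_symbol_inversion_hypotheses)

lemma frac_heat_kernel_le_origin:
  fixes x :: "'a::euclidean_space"
  assumes "0 < t"
  shows "K x t \<le> K (0::'a) t"
  using abs_cos_transform_le[OF integrable_frac_heat_symbol[OF assms], of x]
  by (simp add: frac_heat_kernel_eq_cos_transform cos_transform_0 frac_heat_symbol_def divide_right_mono)

lemma frac_heat_kernel_origin_scaling:
  assumes t_pos: "0 < t"
  shows "K (0::'a::euclidean_space) t = t powr - (DIM('a) / \<theta>) * K (0::'a) 1"
proof -
  define scale where "scale = t powr (- 1 / \<theta>)"
  have scale: "scale > 0" "t * scale powr \<theta> = 1"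
    using t_pos \<theta>_pos by (auto simp: scale_def powr_powr powr_neg_one)
  have "(LBINT \<xi>. frac_heat_symbol \<theta> t (\<xi>::'a)) =
      \<bar>scale\<bar> ^ DIM('a) * (LBINT \<xi>. frac_heat_symbol \<theta> t (0 + scale *\<^sub>R \<xi>::'a))"
    using scale by (intro integral_lborel_affine) (auto simp: frac_heat_symbol_def)
  also have "(\<lambda>\<xi>::'a. frac_heat_symbol \<theta> t (0 + scale *\<^sub>R \<xi>)) = frac_heat_symbol \<theta> 1"
    using scale by (simp add: fun_eq_iff frac_heat_symbol_def powr_mult flip: mult.assoc)
  also have "\<bar>scale\<bar> ^ DIM('a) = t powr - (DIM('a) / \<theta>)"
    using t_pos by (simp add: scale_def powr_powr flip: powr_realpow)
  finally show ?thesis by (simp add: frac_heat_kernel_eq_cos_transform cos_transform_0)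
qed

lemma has_bochner_integral_frac_heat_kernel:
  assumes "0 < t"
  shows "has_bochner_integral lborel (\<lambda>x::'a::euclidean_space. K x t) 1"
  using has_bochner_integral_divide[OF has_bochner_integral_cos_transform
      [OF frac_heat_symbol_inversion_hypotheses[OF assms, where 'a = 'a]], of "(2 * pi) ^ DIM('a)"]
  by (simp add: frac_heat_kernel_eq_cos_transform frac_heat_symbol_def)

lemma integrable_frac_heat_kernel: "0 < t \<Longrightarrow> integrable lborel (\<lambda>x::'a::euclidean_space. K x t)"
  using has_bochner_integral_frac_heat_kernel by (auto simp: has_bochner_integral_iff)

lemma cos_transform_frac_heat_kernel:
  assumes "0 < t"
  shows "cos_transform (\<lambda>x::'a::euclidean_space. K x t) = frac_heat_symbol \<theta> t"
proof
  fix \<eta> :: 'a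
  have "cos_transform (\<lambda>x::'a. K x t) \<eta> =
      cos_transform (cos_transform (frac_heat_symbol \<theta> t)) \<eta> / (2 * pi) ^ DIM('a)"
    by (simp add: frac_heat_kernel_eq_cos_transform cos_transform_def[of "\<lambda>x. _ x / _"]
        cos_transform_def[of "cos_transform _"])
  also have "\<dots> = frac_heat_symbol \<theta> t \<eta>"
    by (simp add: cos_transform_inversion[OF frac_heat_symbol_inversion_hypotheses[OF assms]])
  finally show "cos_transform (\<lambda>x::'a. K x t) \<eta> = frac_heat_symbol \<theta> t \<eta>" .
qed

lemma integral_frac_heat_kernel_convolution:
  fixes x :: "'a::euclidean_space"
  assumes t_pos: "0 < t" and s_pos: "0 < s"
  shows "(LBINT y. K (x - y) t * K y s) = K x (t + s)"
proof -
  have "(LBINT y. K (x - y) t * K y s) =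
      (LBINT y. cos_transform (frac_heat_symbol \<theta> t) (x - y) * K y s) / (2 * pi) ^ DIM('a)"
    by (simp add: frac_heat_kernel_eq_cos_transform[of \<theta> "x - _"])
  also have "(LBINT y. cos_transform (frac_heat_symbol \<theta> t) (x - y) * K y s) =
      cos_transform (\<lambda>\<xi>. frac_heat_symbol \<theta> t \<xi> * cos_transform (\<lambda>y. K y s) \<xi>) x"
    using t_pos s_pos
    by (intro cos_transform_convolution integrable_frac_heat_symbol integrable_frac_heat_kernel
       frac_heat_kernel_minus)
  also have "(\<lambda>\<xi>::'a. frac_heat_symbol \<theta> t \<xi> * cos_transform (\<lambda>y. K y s) \<xi>) = frac_heat_symbol \<theta> (t + s)"
    using s_pos
    by (simp add: cos_transform_frac_heat_kernel fun_eq_iff frac_heat_symbol_def exp_add[symmetric]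
       algebra_simps)
  finally show ?thesis by (simp add: frac_heat_kernel_eq_cos_transform)
qed

lemma nn_integral_frac_heat_kernel:
  assumes "0 < t"
  shows "(\<integral>\<^sup>+x. ennreal (K (x::'a::euclidean_space) t) \<partial>lborel) = 1"
  using assms has_bochner_integral_frac_heat_kernel[OF assms, where 'a = 'a]
  by (subst nn_integral_eq_integral) (auto simp: has_bochner_integral_iff frac_heat_kernel_nonneg)

lemma nn_integral_frac_heat_kernel_semigroup:
  fixes x w :: "'a::euclidean_space"
  assumes t_pos: "0 < t" and s_pos: "0 < s"
  shows "(\<integral>\<^sup>+y. ennreal (K (x - y) t) * ennreal (K (y - w) s) \<partial>lborel) = ennreal (K (x - w) (t + s))"
proof -
  have "(\<integral>\<^sup>+y. ennreal (K (x - y) t) * ennreal (K (y - w) s) \<partial>lborel) =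
      (\<integral>\<^sup>+y. ennreal (K (x - w - (x - y)) s) * ennreal (K (x - y) t) \<partial>lborel)"
    by (simp add: mult.commute)
  also have "\<dots> = (\<integral>\<^sup>+y. ennreal (K (x - w - y) s * K y t) \<partial>lborel)"
    using t_pos s_pos
    by (subst nn_integral_lborel_reflect[where h = "\<lambda>y. ennreal (K (x - w - y) s) * ennreal (K y t)"])
       (auto simp: ennreal_mult frac_heat_kernel_nonneg)
  also have "\<dots> = ennreal (LBINT y. K (x - w - y) s * K y t)"
  proof (rule nn_integral_eq_integral)
    show "integrable lborel (\<lambda>y. K (x - w - y) s * K y t)"
      using s_pos
      by (intro integrable_mult_bounded[OF integrable_frac_heat_kernel[OF t_pos],
         where B = "K (0::'a) s"])
         (auto simp: frac_heat_kernel_nonneg frac_heat_kernel_le_origin)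
  qed (use t_pos s_pos in \<open>auto simp: frac_heat_kernel_nonneg\<close>)
  also have "(LBINT y. K (x - w - y) s * K y t) = K (x - w) (t + s)"
    using t_pos s_pos by (simp add: integral_frac_heat_kernel_convolution add.commute)
  finally show ?thesis .
qed

lemma integrable_norm_powr_gaussian:
  "integrable lborel (\<lambda>\<zeta>::'a::euclidean_space. norm \<zeta> powr \<theta> * gaussian 1 \<zeta>)"
proof (rule Bochner_Integration.integrable_bound)
  show "integrable lborel (\<lambda>\<zeta>::'a. 2 * gaussian (1 / 2) \<zeta>)"
    by (intro integrable_mult_right integrable_gaussian) simp
  show "AE \<zeta> in lborel. norm (norm (\<zeta>::'a) powr \<theta> * gaussian 1 \<zeta>) \<le> norm (2 * gaussian (1 / 2) \<zeta>)"
  proof (rule AE_I2)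
    fix \<zeta> :: 'a
    have "norm \<zeta> powr \<theta> \<le> max 1 (norm \<zeta>) powr 2"
      using \<theta>_pos \<theta>_le_2 powr_mono2[of \<theta> "norm \<zeta>" "max 1 (norm \<zeta>)"] powr_mono[of \<theta> 2 "max 1 (norm \<zeta>)"]
      by simp
    also have "\<dots> \<le> 1 + (norm \<zeta>)\<^sup>2" by (auto simp: max_def)
    also have "\<dots> \<le> 2 * exp ((norm \<zeta>)\<^sup>2 / 2)"
      using exp_ge_add_one_self[of "(norm \<zeta>)\<^sup>2 / 2"] by linarith
    finally have "norm \<zeta> powr \<theta> * gaussian 1 \<zeta> \<le> 2 * exp ((norm \<zeta>)\<^sup>2 / 2) * gaussian 1 \<zeta>"
      by (rule mult_right_mono) simp
    also have "\<dots> = 2 * gaussian (1 / 2) \<zeta>" by (simp add: gaussian_def flip: exp_add)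
    finally show "norm (norm \<zeta> powr \<theta> * gaussian 1 \<zeta>) \<le> norm (2 * gaussian (1 / 2) \<zeta>)" by simp
  qed
qed measurable

lemma one_minus_gaussian_mean_frac_heat_symbol_le:
  assumes t_pos: "0 < t" and r_pos: "0 < r"
  shows "1 - gaussian_mean r (frac_heat_symbol \<theta> t) (0::'a::euclidean_space)
    \<le> t * r powr \<theta> * gaussian_mean 1 (\<lambda>\<zeta>::'a. norm \<zeta> powr \<theta>) 0"
proof -
  have [measurable]: "frac_heat_symbol \<theta> t \<in> borel_measurable (borel :: 'a measure)"
    unfolding frac_heat_symbol_def by measurable
  have mean_integrable: "integrable lborel (\<lambda>\<zeta>::'a. frac_heat_symbol \<theta> t (r *\<^sub>R \<zeta>) * gaussian 1 \<zeta>)"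
    using t_pos
    by (intro integrable_mult_bounded[OF integrable_gaussian, where B = 1])
       (auto simp: frac_heat_symbol_def)
  have "(LBINT \<zeta>::'a. gaussian 1 \<zeta>) - (LBINT \<zeta>::'a. frac_heat_symbol \<theta> t (r *\<^sub>R \<zeta>) * gaussian 1 \<zeta>) =
      (LBINT \<zeta>::'a. gaussian 1 \<zeta> - frac_heat_symbol \<theta> t (r *\<^sub>R \<zeta>) * gaussian 1 \<zeta>)"
    using mean_integrable
    by (intro Bochner_Integration.integral_diff[symmetric] integrable_gaussian) auto
  also have "\<dots> \<le> (LBINT \<zeta>::'a. t * r powr \<theta> * (norm \<zeta> powr \<theta> * gaussian 1 \<zeta>))"
  proof (rule integral_mono)
    show "integrable lborel (\<lambda>\<zeta>::'a. gaussian 1 \<zeta> - frac_heat_symbol \<theta> t (r *\<^sub>R \<zeta>) * gaussian 1 \<zeta>)"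
      using mean_integrable by (intro Bochner_Integration.integrable_diff integrable_gaussian) auto
    show "integrable lborel (\<lambda>\<zeta>::'a. t * r powr \<theta> * (norm \<zeta> powr \<theta> * gaussian 1 \<zeta>))"
      by (intro integrable_mult_right integrable_norm_powr_gaussian)
    fix \<zeta> :: 'a
    have "1 - frac_heat_symbol \<theta> t (r *\<^sub>R \<zeta>) \<le> t * r powr \<theta> * norm \<zeta> powr \<theta>"
      using exp_ge_add_one_self[of "- t * norm (r *\<^sub>R \<zeta>) powr \<theta>"] r_pos
      by (simp add: frac_heat_symbol_def powr_mult)
    then have "(1 - frac_heat_symbol \<theta> t (r *\<^sub>R \<zeta>)) * gaussian 1 \<zeta> \<le>
        t * r powr \<theta> * norm \<zeta> powr \<theta> * gaussian 1 \<zeta>"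
      by (rule mult_right_mono) simp
    then show "gaussian 1 \<zeta> - frac_heat_symbol \<theta> t (r *\<^sub>R \<zeta>) * gaussian 1 \<zeta> \<le>
        t * r powr \<theta> * (norm \<zeta> powr \<theta> * gaussian 1 \<zeta>)"
      by (simp add: left_diff_distrib mult.assoc)
  qed
  also have "\<dots> = t * r powr \<theta> * (LBINT \<zeta>::'a. norm \<zeta> powr \<theta> * gaussian 1 \<zeta>)" by simp
  finally have "(sqrt pi ^ DIM('a) -
      (LBINT \<zeta>::'a. frac_heat_symbol \<theta> t (r *\<^sub>R \<zeta>) * gaussian 1 \<zeta>)) / sqrt pi ^ DIM('a)
      \<le> t * r powr \<theta> * (LBINT \<zeta>::'a. norm \<zeta> powr \<theta> * gaussian 1 \<zeta>) / sqrt pi ^ DIM('a)"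
    using integral_gaussian[of 1, where 'a = 'a] by (intro divide_right_mono) auto
  then show ?thesis by (simp add: gaussian_mean_def diff_divide_distrib)
qed

lemma nn_integral_frac_heat_kernel_one_minus_gaussian_le:
  assumes t_pos: "0 < t" and \<delta>_pos: "0 < \<delta>"
  shows "(\<integral>\<^sup>+x. ennreal (K (x::'a::euclidean_space) t) * ennreal (1 - gaussian \<delta> x) \<partial>lborel)
    \<le> ennreal (t * (2 * sqrt \<delta>) powr \<theta> * gaussian_mean 1 (\<lambda>\<zeta>::'a. norm \<zeta> powr \<theta>) 0)"
proof -
  note integrable_K = integrable_frac_heat_kernel[OF t_pos, where 'a = 'a]
  have integrable_gaussian_K: "integrable lborel (\<lambda>x::'a. gaussian \<delta> x * K x t)"
    using \<delta>_pos by (intro integrable_mult_bounded[OF integrable_K, where B = 1]) auto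
  have "(LBINT x. gaussian \<delta> (x::'a) * K x t) =
      gaussian_mean (2 * sqrt \<delta>) (frac_heat_symbol \<theta> t) (0::'a)"
    using integral_cos_transform_mult_cos_gaussian
      [OF frac_heat_symbol_inversion_hypotheses(1,2)[OF t_pos] \<delta>_pos, of "0::'a"]
    by (simp add: frac_heat_kernel_eq_cos_transform mult.commute divide_eq_eq)
  then have "(LBINT x::'a. K x t - gaussian \<delta> x * K x t) =
      1 - gaussian_mean (2 * sqrt \<delta>) (frac_heat_symbol \<theta> t) (0::'a)"
    using has_bochner_integral_frac_heat_kernel[OF t_pos, where 'a = 'a] integrable_gaussian_K
    by (simp add: has_bochner_integral_iff)
  also have "\<dots> \<le> t * (2 * sqrt \<delta>) powr \<theta> * gaussian_mean 1 (\<lambda>\<zeta>::'a. norm \<zeta> powr \<theta>) 0"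
    using t_pos \<delta>_pos by (intro one_minus_gaussian_mean_frac_heat_symbol_le) auto
  finally have tail: "(LBINT x::'a. K x t - gaussian \<delta> x * K x t)
      \<le> t * (2 * sqrt \<delta>) powr \<theta> * gaussian_mean 1 (\<lambda>\<zeta>::'a. norm \<zeta> powr \<theta>) 0" .
  have "(\<integral>\<^sup>+x. ennreal (K (x::'a) t) * ennreal (1 - gaussian \<delta> x) \<partial>lborel) =
      (\<integral>\<^sup>+x. ennreal (K (x::'a) t - gaussian \<delta> x * K x t) \<partial>lborel)"
    using t_pos \<delta>_pos by (simp add: ennreal_mult[symmetric] frac_heat_kernel_nonneg algebra_simps)
  also have "\<dots> = ennreal (LBINT x::'a. K x t - gaussian \<delta> x * K x t)"
    using t_pos \<delta>_pos integrable_K integrable_gaussian_K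
    by (intro nn_integral_eq_integral Bochner_Integration.integrable_diff)
       (auto simp: mult_left_le_one_le frac_heat_kernel_nonneg)
  also have "\<dots> \<le> ennreal (t * (2 * sqrt \<delta>) powr \<theta> * gaussian_mean 1 (\<lambda>\<zeta>::'a. norm \<zeta> powr \<theta>) 0)"
    using tail by (rule ennreal_leI)
  finally show ?thesis .
qed

lemma nn_integral_frac_heat_kernel_one_minus_gaussian_le_1:
  assumes "0 < t"
  shows "(\<integral>\<^sup>+x. ennreal (K (x::'a::euclidean_space) t) * ennreal (1 - gaussian \<delta> x) \<partial>lborel) \<le> 1"
proof -
  have "(\<integral>\<^sup>+x. ennreal (K (x::'a) t) * ennreal (1 - gaussian \<delta> x) \<partial>lborel) \<le>
      (\<integral>\<^sup>+x. ennreal (K (x::'a) t) * 1 \<partial>lborel)"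
    by (intro nn_integral_mono mult_left_mono) auto
  then show ?thesis using assms by (simp add: nn_integral_frac_heat_kernel)
qed

lemma frac_heat_kernel_moment_le:
  assumes a_bounds: "0 < a" "a < \<theta>" and t_pos: "0 < t"
  defines "A \<equiv> 2 powr \<theta> * gaussian_mean 1 (\<lambda>\<zeta>::'a::euclidean_space. norm \<zeta> powr \<theta>) 0"
    and "B \<equiv> a / (2 * (1 - exp (- 1)))"
  shows "(\<integral>\<^sup>+y. ennreal (K (y::'a) t) * ennreal (norm y powr a) \<partial>lborel)
    \<le> ennreal (B * (2 * A / (\<theta> - a) + 2 / a) * t powr (a / \<theta>))"
proof -
  let ?tail = "\<lambda>\<delta>. \<integral>\<^sup>+y. ennreal (K (y::'a) t) * ennreal (1 - gaussian \<delta> y) \<partial>lborel"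
  have A_nonneg: "0 \<le> A" by (simp add: A_def gaussian_mean_nonneg)
  have B_nonneg: "0 \<le> B" using a_bounds(1) by (simp add: B_def)
  have tail_le_1: "?tail \<delta> \<le> ennreal 1" for \<delta>
    using nn_integral_frac_heat_kernel_one_minus_gaussian_le_1[OF t_pos] by simp
  have tail_le: "?tail \<delta> \<le> ennreal (A * t * \<delta> powr (\<theta> / 2))" if "0 < \<delta>" for \<delta>
    using nn_integral_frac_heat_kernel_one_minus_gaussian_le[OF t_pos that, where 'a = 'a] that
    by (simp add: A_def powr_mult powr_half_sqrt[symmetric] powr_powr ac_simps)
  define D where "D = t powr (- 2 / \<theta>)"
  have D: "0 < D" "D powr - (a / 2) = t powr (a / \<theta>)" using t_pos by (simp_all add: D_def powr_powr)
  have "1 + - 2 / \<theta> * (\<theta> / 2 - a / 2) = a / \<theta>" using \<theta>_pos by (simp add: field_simps)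
  then have t_mult_D_powr: "t * D powr (\<theta> / 2 - a / 2) = t powr (a / \<theta>)"
    using t_pos powr_add[of t 1 "- 2 / \<theta> * (\<theta> / 2 - a / 2)"] by (simp add: D_def powr_powr)
  define near_plus_far where
    "near_plus_far = A * t * (D powr (\<theta> / 2 - a / 2) / (\<theta> / 2 - a / 2)) + 1 * (D powr - (a / 2) / (a / 2))"
  have near_plus_far_eq: "near_plus_far = (2 * A / (\<theta> - a) + 2 / a) * t powr (a / \<theta>)"
    unfolding near_plus_far_def
    using a_bounds by (simp add: D(2) t_mult_D_powr[symmetric] divide_simps) (simp add: algebra_simps)
  have "(\<integral>\<^sup>+y. ennreal (K (y::'a) t) * ennreal (norm y powr a) \<partial>lborel) \<le>
      ennreal B * (\<integral>\<^sup>+\<delta>\<in>{0<..}. ennreal (\<delta> powr (- (a / 2) - 1)) * ?tail \<delta> \<partial>lborel)"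
    unfolding B_def using a_bounds(1) by (intro nn_integral_norm_powr_le_one_minus_gaussian) measurable
  also have "\<dots> \<le> ennreal B * ennreal near_plus_far"
    unfolding near_plus_far_def using a_bounds A_nonneg t_pos D(1) tail_le tail_le_1
    by (intro mult_left_mono nn_integral_powr_mult_le_of_tails) auto
  also have "\<dots> = ennreal (B * near_plus_far)" using B_nonneg by (rule ennreal_mult'[symmetric])
  finally show ?thesis by (simp add: near_plus_far_eq mult.assoc)
qed

lemma frac_heat_kernel_moment:
  assumes a_bounds: "0 < a" "a < \<theta>"
  shows "\<exists>C>0. \<forall>t>0. (\<integral>\<^sup>+y. ennreal (K (y::'a::euclidean_space) t) * ennreal (norm y powr a) \<partial>lborel)
    \<le> ennreal (C * t powr (a / \<theta>))"
proof -
  have "0 \<le> 2 powr \<theta> * gaussian_mean 1 (\<lambda>\<zeta>::'a. norm \<zeta> powr \<theta>) 0" by (simp add: gaussian_mean_nonneg)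
  then have "0 < a / (2 * (1 - exp (- 1))) *
      (2 * (2 powr \<theta> * gaussian_mean 1 (\<lambda>\<zeta>::'a. norm \<zeta> powr \<theta>) 0) / (\<theta> - a) + 2 / a)"
    using a_bounds by (intro mult_pos_pos add_nonneg_pos divide_nonneg_pos) auto
  then show ?thesis using frac_heat_kernel_moment_le[OF a_bounds, where 'a = 'a] by blast
qed

end

section \<open>The heat semigroup\<close>

definition heat_semigroup :: "real \<Rightarrow> real \<Rightarrow> ('a::euclidean_space \<Rightarrow> ennreal) \<Rightarrow> 'a \<Rightarrow> ennreal" where
  "heat_semigroup \<theta> t h x = (\<integral>\<^sup>+y. ennreal (frac_heat_kernel \<theta> (x - y) t) * h y \<partial>lborel)"

lemma borel_measurable_heat_semigroup_time_dependent:
  fixes h :: "'a::euclidean_space \<Rightarrow> real \<Rightarrow> ennreal"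
  assumes h_measurable: "case_prod h \<in> borel_measurable (borel \<Otimes>\<^sub>M borel)"
    and [measurable]: "X \<in> borel_measurable M" "\<tau> \<in> borel_measurable M" "\<sigma> \<in> borel_measurable M"
  shows "(\<lambda>z. heat_semigroup \<theta> (\<tau> z) (\<lambda>y. h y (\<sigma> z)) (X z)) \<in> borel_measurable M"
  unfolding heat_semigroup_def
proof (rule lborel.borel_measurable_nn_integral)
  have [measurable]: "(\<lambda>(z, y). h y (\<sigma> z)) \<in> borel_measurable (M \<Otimes>\<^sub>M lborel)"
    unfolding split_beta' by (rule measurable_Pair_compose_split[OF h_measurable]) measurable
  show "(\<lambda>(z, y). ennreal (frac_heat_kernel \<theta> (X z - y) (\<tau> z)) * h y (\<sigma> z))
      \<in> borel_measurable (M \<Otimes>\<^sub>M lborel)"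
    unfolding split_beta' by measurable
qed

lemma borel_measurable_heat_semigroup [measurable]:
  fixes h :: "'a::euclidean_space \<Rightarrow> ennreal"
  assumes [measurable]: "h \<in> borel_measurable borel" "X \<in> borel_measurable M" "\<tau> \<in> borel_measurable M"
  shows "(\<lambda>z. heat_semigroup \<theta> (\<tau> z) h (X z)) \<in> borel_measurable M"
  by (rule borel_measurable_heat_semigroup_time_dependent[where h = "\<lambda>y _. h y" and \<sigma> = "\<lambda>_. 0"])
     measurable

lemma heat_semigroup_mono_AE:
  "AE y in lborel. h y \<le> g y \<Longrightarrow> heat_semigroup \<theta> t h x \<le> heat_semigroup \<theta> t g x"
  unfolding heat_semigroup_def
  by (rule nn_integral_mono_AE) (auto elim!: eventually_mono intro: mult_left_mono)

lemma heat_semigroup_mono: "(\<And>y. h y \<le> g y) \<Longrightarrow> heat_semigroup \<theta> t h x \<le> heat_semigroup \<theta> t g x"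
  by (simp add: heat_semigroup_mono_AE)

lemma heat_semigroup_cong_AE:
  assumes "AE y in lborel. h y = g y"
  shows "heat_semigroup \<theta> t h x = heat_semigroup \<theta> t g x"
  using assms by (intro antisym heat_semigroup_mono_AE) (auto elim: eventually_mono)

lemma heat_semigroup_cmult:
  "h \<in> borel_measurable borel \<Longrightarrow> heat_semigroup \<theta> t (\<lambda>y. c * h y) x = c * heat_semigroup \<theta> t h x"
  unfolding heat_semigroup_def by (subst nn_integral_cmult[symmetric]) (auto simp: mult.left_commute)

lemma heat_semigroup_add:
  "h \<in> borel_measurable borel \<Longrightarrow> g \<in> borel_measurable borel \<Longrightarrow>
    heat_semigroup \<theta> t (\<lambda>y. h y + g y) x = heat_semigroup \<theta> t h x + heat_semigroup \<theta> t g x"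
  unfolding heat_semigroup_def by (subst nn_integral_add[symmetric]) (auto simp: distrib_left)

lemma tendsto_heat_semigroup:
  assumes "\<And>n. h n \<in> borel_measurable borel" "\<And>y. incseq (\<lambda>n. h n y)" "\<And>y. (\<lambda>n. h n y) \<longlonglongrightarrow> g y"
  shows "(\<lambda>n. heat_semigroup \<theta> t (h n) x) \<longlonglongrightarrow> heat_semigroup \<theta> t g x"
  unfolding heat_semigroup_def
proof (rule nn_integral_LIMSEQ)
  show "incseq (\<lambda>n y. ennreal (frac_heat_kernel \<theta> (x - y) t) * h n y)"
    using assms(2) by (auto simp: incseq_def intro!: le_funI mult_left_mono)
  show "(\<lambda>n. ennreal (frac_heat_kernel \<theta> (x - y) t) * h n y)
      \<longlonglongrightarrow> ennreal (frac_heat_kernel \<theta> (x - y) t) * g y" for y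
    using assms(3) by (intro ennreal_tendsto_cmult) auto
qed (use assms(1) in measurable)

lemma heat_semigroup_nn_integral:
  fixes h :: "'a::euclidean_space \<Rightarrow> real \<Rightarrow> ennreal"
  assumes h_measurable: "case_prod h \<in> borel_measurable (borel \<Otimes>\<^sub>M borel)"
  shows "heat_semigroup \<theta> t (\<lambda>y. \<integral>\<^sup>+s. h y s \<partial>lborel) x = (\<integral>\<^sup>+s. heat_semigroup \<theta> t (\<lambda>y. h y s) x \<partial>lborel)"
proof -
  have h_section: "h y \<in> borel_measurable lborel" for y
    using measurable_Pair_compose_split[OF h_measurable, of "\<lambda>_. y" lborel "\<lambda>s. s"] by simp
  have [measurable]: "(\<lambda>p. h (fst p) (snd p)) \<in> borel_measurable (lborel \<Otimes>\<^sub>M lborel)"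
    by (rule measurable_Pair_compose_split[OF h_measurable]) measurable
  have "heat_semigroup \<theta> t (\<lambda>y. \<integral>\<^sup>+s. h y s \<partial>lborel) x =
      (\<integral>\<^sup>+y. \<integral>\<^sup>+s. ennreal (frac_heat_kernel \<theta> (x - y) t) * h y s \<partial>lborel \<partial>lborel)"
    unfolding heat_semigroup_def by (intro nn_integral_cong nn_integral_cmult[symmetric] h_section)
  also have "\<dots> = (\<integral>\<^sup>+s. \<integral>\<^sup>+y. ennreal (frac_heat_kernel \<theta> (x - y) t) * h y s \<partial>lborel \<partial>lborel)"
    by (rule lborel_pair.Fubini'[symmetric]) (unfold split_beta', measurable)
  finally show ?thesis by (simp add: heat_semigroup_def)
qed

lemma norm_powr_diff_le:
  fixes x y :: "'a::real_normed_vector"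
  assumes "0 < a"
  shows "norm (x - y) powr a \<le> 2 powr a * (norm x powr a + norm y powr a)"
proof -
  have "norm (x - y) \<le> 2 * max (norm x) (norm y)" using norm_triangle_ineq4[of x y] by linarith
  then have "norm (x - y) powr a \<le> (2 * max (norm x) (norm y)) powr a"
    using assms by (intro powr_mono2) auto
  also have "\<dots> = 2 powr a * max (norm x) (norm y) powr a" by (simp add: powr_mult)
  also have "\<dots> \<le> 2 powr a * (norm x powr a + norm y powr a)"
    by (intro mult_left_mono) (auto simp: max_def)
  finally show ?thesis .
qed

context fractional_diffusion
begin

abbreviation S :: "real \<Rightarrow> ('a::euclidean_space \<Rightarrow> ennreal) \<Rightarrow> 'a \<Rightarrow> ennreal" where
  "S \<equiv> heat_semigroup \<theta>"

lemma nn_integral_frac_heat_kernel_diff: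
  assumes "0 < t"
  shows "(\<integral>\<^sup>+y. ennreal (K ((x::'a::euclidean_space) - y) t) \<partial>lborel) = 1"
  using nn_integral_lborel_reflect[of "\<lambda>y. ennreal (K y t)" x]
    nn_integral_frac_heat_kernel[OF assms, where 'a = 'a]
  by simp

lemma heat_semigroup_const: "0 < t \<Longrightarrow> S t (\<lambda>_. c) x = c"
  by (simp add: heat_semigroup_def nn_integral_multc nn_integral_frac_heat_kernel_diff)

text \<open>Integrating a tangent inequality against the kernel is how Jensen's inequality enters all
  arguments below.\<close>
lemma heat_semigroup_affine_mono:
  assumes t_pos: "0 < t" and h_g_measurable: "h \<in> borel_measurable borel" "g \<in> borel_measurable borel"
    and pointwise_le: "AE y in lborel. a + b * h y \<le> c + g y"
  shows "a + b * S t h x \<le> c + S t g x"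
proof -
  have "a + b * S t h x = S t (\<lambda>y. a + b * h y) x"
    using t_pos h_g_measurable
    by (simp add: heat_semigroup_add heat_semigroup_cmult heat_semigroup_const)
  also have "\<dots> \<le> S t (\<lambda>y. c + g y) x" using pointwise_le by (rule heat_semigroup_mono_AE)
  also have "\<dots> = c + S t g x"
    using t_pos h_g_measurable by (simp add: heat_semigroup_add heat_semigroup_const)
  finally show ?thesis .
qed

lemma heat_semigroup_compose:
  assumes t_pos: "0 < t" and s_pos: "0 < s" and [measurable]: "h \<in> borel_measurable borel"
  shows "S t (S s h) x = S (t + s) h x"
proof -
  have "S t (S s h) x =
      (\<integral>\<^sup>+y. \<integral>\<^sup>+w. ennreal (K (x - y) t) * (ennreal (K (y - w) s) * h w) \<partial>lborel \<partial>lborel)"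
    unfolding heat_semigroup_def by (intro nn_integral_cong nn_integral_cmult[symmetric]) measurable
  also have "\<dots> = (\<integral>\<^sup>+w. \<integral>\<^sup>+y. ennreal (K (x - y) t) * (ennreal (K (y - w) s) * h w) \<partial>lborel \<partial>lborel)"
    by (rule lborel_pair.Fubini'[symmetric]) measurable
  also have "\<dots> = (\<integral>\<^sup>+w. (\<integral>\<^sup>+y. ennreal (K (x - y) t) * ennreal (K (y - w) s) \<partial>lborel) * h w \<partial>lborel)"
    by (intro nn_integral_cong) (simp add: mult.assoc[symmetric] nn_integral_multc)
  also have "\<dots> = S (t + s) h x"
    using t_pos s_pos by (simp add: nn_integral_frac_heat_kernel_semigroup heat_semigroup_def)
  finally show ?thesis .
qed

lemma heat_semigroup_le_near_plus_far:
  fixes w :: "'a::euclidean_space \<Rightarrow> ennreal"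
  assumes t_pos: "0 < t" and [measurable]: "w \<in> borel_measurable borel"
    and w_le_far: "\<And>y. R \<le> norm y \<Longrightarrow> w y \<le> c"
  shows "S t w x \<le> ennreal (K (0::'a) t) * (\<integral>\<^sup>+y\<in>ball 0 R. w y \<partial>lborel) + c"
proof -
  have [measurable]: "ball (0::'a) R \<in> sets borel" by simp
  have "S t w x \<le>
      (\<integral>\<^sup>+y. ennreal (K (0::'a) t) * (w y * indicator (ball 0 R) y) + ennreal (K (x - y) t) * c \<partial>lborel)"
    unfolding heat_semigroup_def
  proof (rule nn_integral_mono)
    fix y :: 'a
    show "ennreal (K (x - y) t) * w y \<le>
        ennreal (K (0::'a) t) * (w y * indicator (ball 0 R) y) + ennreal (K (x - y) t) * c"
    proof (cases "norm y < R")
      case True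
      then have "ennreal (K (x - y) t) * w y \<le> ennreal (K (0::'a) t) * (w y * indicator (ball 0 R) y)"
        using t_pos by (simp add: mult_right_mono ennreal_leI frac_heat_kernel_le_origin)
      then show ?thesis by (rule add_increasing2[rotated]) simp
    next
      case False
      then have "ennreal (K (x - y) t) * w y \<le> ennreal (K (x - y) t) * c"
        by (intro mult_left_mono w_le_far) auto
      then show ?thesis by (rule add_increasing[rotated]) simp
    qed
  qed
  also have "\<dots> = ennreal (K (0::'a) t) * (\<integral>\<^sup>+y\<in>ball 0 R. w y \<partial>lborel) + c"
    using t_pos
    by (simp add: nn_integral_add nn_integral_cmult nn_integral_multc nn_integral_frac_heat_kernel_diff)
  finally show ?thesis .
qed

lemma heat_semigroup_norm_powr_le:
  assumes r_bounds: "0 < r" "\<theta> * r < DIM('a::euclidean_space)"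
  shows "\<exists>C>0. \<forall>t>0. \<forall>x::'a. S t (\<lambda>y. ennreal (norm y powr - (\<theta> * r))) x \<le> ennreal (C * t powr - r)"
proof -
  let ?N = "real DIM('a)" and ?a = "\<theta> * r"
  define V where "V = unit_ball_vol ?N * (?N / (?N - ?a))"
  have V_nonneg: "0 \<le> V" using r_bounds by (simp add: V_def)
  have K_origin: "0 \<le> K (0::'a) 1" by (simp add: frac_heat_kernel_nonneg)
  have "0 < K (0::'a) 1 * V + 1" using V_nonneg K_origin by (intro add_nonneg_pos) auto
  moreover have "S t (\<lambda>y. ennreal (norm y powr - ?a)) x \<le> ennreal ((K (0::'a) 1 * V + 1) * t powr - r)"
    if t_pos: "0 < t" for t and x :: 'a
  proof -
    define R where "R = t powr (1 / \<theta>)"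
    have R: "0 < R" "R powr - ?a = t powr - r" using t_pos \<theta>_pos by (simp_all add: R_def powr_powr)
    have "- (?N / \<theta>) + 1 / \<theta> * (?N - ?a) = - r" using \<theta>_pos by (simp add: field_simps)
    then have "t powr - (?N / \<theta>) * R powr (?N - ?a) = t powr - r"
      by (simp add: R_def powr_powr powr_add[symmetric])
    then have scaling: "K (0::'a) t * R powr (?N - ?a) = K (0::'a) 1 * t powr - r"
      using t_pos by (simp add: frac_heat_kernel_origin_scaling[OF t_pos] mult.commute)
    have "ennreal (norm y powr - ?a) \<le> ennreal (t powr - r)" if "R \<le> norm y" for y :: 'a
      using that R powr_mono2'[of "- ?a" R "norm y"] r_bounds \<theta>_pos by (intro ennreal_leI) simp
    then have "S t (\<lambda>y. ennreal (norm y powr - ?a)) x \<le>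
        ennreal (K (0::'a) t) * (\<integral>\<^sup>+y\<in>ball (0::'a) R. ennreal (norm y powr - ?a) \<partial>lborel) +
          ennreal (t powr - r)"
      using t_pos by (intro heat_semigroup_le_near_plus_far) auto
    also have "\<dots> \<le> ennreal (K (0::'a) t) * ennreal (V * R powr (?N - ?a)) + ennreal (t powr - r)"
      using r_bounds R(1) \<theta>_pos unfolding V_def
      by (intro add_right_mono mult_left_mono nn_integral_norm_powr_ball_le) auto
    also have "\<dots> = ennreal (K (0::'a) t * R powr (?N - ?a) * V + t powr - r)"
      using V_nonneg t_pos
      by (simp add: ennreal_mult[symmetric] frac_heat_kernel_nonneg ac_simps flip: ennreal_plus)
    also have "\<dots> = ennreal ((K (0::'a) 1 * V + 1) * t powr - r)"
      unfolding scaling by (simp add: algebra_simps)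
    finally show ?thesis .
  qed
  ultimately show ?thesis by blast
qed

lemma heat_semigroup_norm_powr_le_kernel_moment:
  fixes x :: "'a::euclidean_space"
  assumes t_pos: "0 < t" and a_pos: "0 < a"
  shows "S t (\<lambda>y. ennreal (norm y powr a)) x \<le> ennreal (2 powr a) * (ennreal (norm x powr a) +
    (\<integral>\<^sup>+w. ennreal (K (w::'a) t) * ennreal (norm w powr a) \<partial>lborel))"
proof -
  have "S t (\<lambda>y. ennreal (norm y powr a)) x =
      (\<integral>\<^sup>+y. ennreal (K (x - y) t) * ennreal (norm (x - (x - y)) powr a) \<partial>lborel)"
    by (simp add: heat_semigroup_def)
  also have "\<dots> = (\<integral>\<^sup>+w. ennreal (K w t) * ennreal (norm (x - w) powr a) \<partial>lborel)"
    by (rule nn_integral_lborel_reflect[where h = "\<lambda>w. ennreal (K w t) * ennreal (norm (x - w) powr a)"])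
       measurable
  also have "\<dots> \<le> (\<integral>\<^sup>+w. ennreal (2 powr a) *
      (ennreal (norm x powr a) * ennreal (K (w::'a) t) + ennreal (K w t) *
        ennreal (norm w powr a)) \<partial>lborel)"
  proof (rule nn_integral_mono)
    fix w :: 'a
    have "ennreal (K w t) * ennreal (norm (x - w) powr a) \<le>
        ennreal (K w t) * ennreal (2 powr a * (norm x powr a + norm w powr a))"
      using a_pos by (intro mult_left_mono ennreal_leI norm_powr_diff_le) auto
    then show "ennreal (K w t) * ennreal (norm (x - w) powr a) \<le> ennreal (2 powr a) *
        (ennreal (norm x powr a) * ennreal (K w t) + ennreal (K w t) * ennreal (norm w powr a))"
      by (simp add: ennreal_mult distrib_left ac_simps)
  qed
  also have "\<dots> = ennreal (2 powr a) * (ennreal (norm x powr a) +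
      (\<integral>\<^sup>+w. ennreal (K (w::'a) t) * ennreal (norm w powr a) \<partial>lborel))"
    using t_pos by (simp add: nn_integral_add nn_integral_cmult nn_integral_frac_heat_kernel)
  finally show ?thesis .
qed

lemma heat_semigroup_moment_le:
  assumes a_bounds: "0 < a" "a < \<theta>"
  shows "\<exists>C>0. \<forall>t>0. \<forall>x::'a::euclidean_space. norm x \<le> t powr (1 / \<theta>) \<longrightarrow>
    S t (\<lambda>y. ennreal (norm y powr a)) x \<le> ennreal (C * t powr (a / \<theta>))"
proof -
  obtain C where C_pos: "C > 0" and moment: "\<And>t. 0 < t \<Longrightarrow>
      (\<integral>\<^sup>+y. ennreal (K (y::'a) t) * ennreal (norm y powr a) \<partial>lborel) \<le> ennreal (C * t powr (a / \<theta>))"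
    using frac_heat_kernel_moment[OF a_bounds, where 'a = 'a] by blast
  have "S t (\<lambda>y. ennreal (norm y powr a)) x \<le> ennreal (2 powr a * (1 + C) * t powr (a / \<theta>))"
    if t_pos: "0 < t" and norm_x_le: "norm x \<le> t powr (1 / \<theta>)" for t and x :: 'a
  proof -
    have "norm x powr a \<le> t powr (a / \<theta>)"
      using powr_mono2[OF _ _ norm_x_le, of a] a_bounds by (simp add: powr_powr)
    then have "S t (\<lambda>y. ennreal (norm y powr a)) x \<le>
        ennreal (2 powr a) * (ennreal (t powr (a / \<theta>)) + ennreal (C * t powr (a / \<theta>)))"
      by (intro order_trans[OF heat_semigroup_norm_powr_le_kernel_moment[OF t_pos a_bounds(1)]]
          mult_left_mono add_mono ennreal_leI moment t_pos) auto
    also have "\<dots> = ennreal (2 powr a * (1 + C) * t powr (a / \<theta>))"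
      using C_pos by (simp add: ennreal_mult[symmetric] algebra_simps flip: ennreal_plus)
    finally show ?thesis .
  qed
  moreover have "0 < 2 powr a * (1 + C)" using C_pos by simp
  ultimately show ?thesis by blast
qed

end

section \<open>Supersolutions and comparison\<close>

definition duhamel ::
  "real \<Rightarrow> (real \<Rightarrow> real) \<Rightarrow> ('a::euclidean_space \<Rightarrow> real) \<Rightarrow> ('a \<Rightarrow> real \<Rightarrow> real) \<Rightarrow> 'a \<Rightarrow> real \<Rightarrow> ennreal" where
  "duhamel \<theta> f \<mu> u x t = heat_semigroup \<theta> t (\<lambda>y. ennreal (\<mu> y)) x +
     (\<integral>\<^sup>+s\<in>{0<..<t}. heat_semigroup \<theta> (t - s) (\<lambda>y. ennreal (f (u y s))) x \<partial>lborel)"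

lemma she_solution_iff:
  fixes u :: "'a::euclidean_space \<Rightarrow> real \<Rightarrow> real"
  shows "she_solution \<theta> f \<mu> T u \<longleftrightarrow>
    case_prod u \<in> borel_measurable (borel \<Otimes>\<^sub>M borel) \<and> (\<forall>x t. 0 < t \<and> t < T \<longrightarrow> 0 \<le> u x t) \<and>
    (AE (x, t) in lborel. 0 < t \<and> t < T \<longrightarrow> ennreal (u x t) = duhamel \<theta> f \<mu> u x t)"
  by (simp add: she_solution_def duhamel_def heat_semigroup_def borel_prod case_prod_unfold)

lemma borel_measurable_duhamel:
  fixes u :: "'a::euclidean_space \<Rightarrow> real \<Rightarrow> real"
  assumes [measurable]: "\<mu> \<in> borel_measurable borel"
    and f_u_measurable: "(\<lambda>(y, s). f (u y s)) \<in> borel_measurable (borel \<Otimes>\<^sub>M borel)"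
  shows "case_prod (duhamel \<theta> f \<mu> u) \<in> borel_measurable (borel \<Otimes>\<^sub>M borel)"
  unfolding split_beta' duhamel_def
proof (rule borel_measurable_add)
  show "(\<lambda>p. heat_semigroup \<theta> (snd p) (\<lambda>y. ennreal (\<mu> y)) (fst p)) \<in> borel_measurable (borel \<Otimes>\<^sub>M borel)"
    by measurable
  show "(\<lambda>p. \<integral>\<^sup>+s\<in>{0<..<snd p}. heat_semigroup \<theta> (snd p - s) (\<lambda>y. ennreal (f (u y s))) (fst p) \<partial>lborel)
      \<in> borel_measurable (borel \<Otimes>\<^sub>M borel)"
  proof (rule lborel.borel_measurable_nn_integral)
    let ?M = "(borel \<Otimes>\<^sub>M borel) \<Otimes>\<^sub>M lborel :: (('a \<times> real) \<times> real) measure"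
    have [measurable]:
        "(\<lambda>z. heat_semigroup \<theta> (snd (fst z) - snd z) (\<lambda>y. ennreal (f (u y (snd z)))) (fst (fst z)))
        \<in> borel_measurable ?M"
      using f_u_measurable
      by (intro borel_measurable_heat_semigroup_time_dependent[where h = "\<lambda>y s. ennreal (f (u y s))"])
        (auto simp: split_beta')
    have "(\<lambda>z. heat_semigroup \<theta> (snd (fst z) - snd z) (\<lambda>y. ennreal (f (u y (snd z)))) (fst (fst z)) *
        (if 0 < snd z \<and> snd z < snd (fst z) then 1 else 0)) \<in> borel_measurable ?M"
      by measurable
    then show "(\<lambda>(p, s). heat_semigroup \<theta> (snd p - s) (\<lambda>y. ennreal (f (u y s))) (fst p) *
        indicator {0<..<snd p} s)
        \<in> borel_measurable ?M"
      by (rule measurable_cong[THEN iffD1, rotated]) (auto simp: indicator_def)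
  qed
qed

lemma duhamel_mono:
  assumes "\<And>y. \<mu> y \<le> \<mu>' y"
    and "\<And>y s. 0 < s \<Longrightarrow> s < t \<Longrightarrow> f (u y s) \<le> f (u' y s)"
  shows "duhamel \<theta> f \<mu> u x t \<le> duhamel \<theta> f \<mu>' u' x t"
  unfolding duhamel_def using assms
  by (intro add_mono nn_integral_mono heat_semigroup_mono ennreal_leI)
     (auto simp: indicator_def intro!: heat_semigroup_mono ennreal_leI)

lemma tendsto_duhamel:
  fixes u :: "'a::euclidean_space \<Rightarrow> real \<Rightarrow> real"
  assumes f_v_measurable: "\<And>n::nat. (\<lambda>(y, s). f (v n y s)) \<in> borel_measurable (borel \<Otimes>\<^sub>M borel)"
    and f_v_incseq: "\<And>y s. incseq (\<lambda>n. f (v n y s))" and lim: "\<And>y s. (\<lambda>n. f (v n y s)) \<longlonglongrightarrow> f (u y s)"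
  shows "(\<lambda>n. duhamel \<theta> f \<mu> (v n) x t) \<longlonglongrightarrow> duhamel \<theta> f \<mu> u x t"
  unfolding duhamel_def
proof (rule tendsto_add[OF tendsto_const nn_integral_LIMSEQ])
  let ?I = "\<lambda>w s. heat_semigroup \<theta> (t - s) (\<lambda>y. ennreal (f (w y s))) x"
  have [measurable]: "?I (v n) \<in> borel_measurable borel" for n
    using f_v_measurable[of n]
    by (intro borel_measurable_heat_semigroup_time_dependent[where h = "\<lambda>y s. ennreal (f (v n y s))"])
       (auto simp: split_beta')
  show "(\<lambda>s. ?I (v n) s * indicator {0<..<t} s) \<in> borel_measurable lborel" for n by measurable
  show "incseq (\<lambda>n s. ?I (v n) s * indicator {0<..<t} s)"
    using f_v_incseq
    by (auto simp: incseq_def intro!: le_funI mult_right_mono heat_semigroup_mono ennreal_leI)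
  fix s
  have "(\<lambda>y. f (v n y s)) \<in> borel_measurable borel" for n
    using measurable_Pair_compose_split[OF f_v_measurable[of n], of "\<lambda>y. y" borel "\<lambda>_. s"] by simp
  then have "(\<lambda>n. ?I (v n) s) \<longlonglongrightarrow> ?I u s"
    using f_v_incseq lim by (intro tendsto_heat_semigroup) (auto simp: incseq_def intro!: ennreal_leI)
  then show "(\<lambda>n. ?I (v n) s * indicator {0<..<t} s) \<longlonglongrightarrow> ?I u s * indicator {0<..<t} s"
    by (auto simp: indicator_def)
qed

locale source_term =
  fixes f :: "real \<Rightarrow> real"
  assumes f_nonneg: "\<And>u. 0 \<le> u \<Longrightarrow> 0 \<le> f u"
    and f_continuous: "continuous_on {0..} f"
    and f_mono_on: "mono_on {0..} f"
begin

lemma f_mono: "0 \<le> u \<Longrightarrow> u \<le> v \<Longrightarrow> f u \<le> f v"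
  using mono_onD[OF f_mono_on, of u v] by simp

lemma borel_measurable_f_comp:
  assumes [measurable]: "g \<in> borel_measurable M" and nonneg: "\<And>x. 0 \<le> g x"
  shows "(\<lambda>x. f (g x)) \<in> borel_measurable M"
proof -
  have "continuous_on UNIV (\<lambda>a. f (max 0 a))"
    by (rule continuous_on_compose2[OF f_continuous]) (auto intro!: continuous_intros)
  then have [measurable]: "(\<lambda>a. f (max 0 a)) \<in> borel_measurable borel"
    by (rule borel_measurable_continuous_onI)
  have "(\<lambda>x. f (max 0 (g x))) \<in> borel_measurable M" by measurable
  then show ?thesis using nonneg by (simp add: max_absorb2)
qed

lemma borel_measurable_f_comp_pair:
  assumes "case_prod u \<in> borel_measurable M" "\<And>x t. 0 \<le> u x t"
  shows "(\<lambda>(x, t). f (u x t)) \<in> borel_measurable M"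
  using borel_measurable_f_comp[OF assms(1)] assms(2) by (simp add: split_beta')

text \<open>Truncation at v keeps the iterates finite even where Duhamel's integral is infinite.\<close>
primrec picard ::
  "real \<Rightarrow> ('a::euclidean_space \<Rightarrow> real) \<Rightarrow> ('a \<Rightarrow> real \<Rightarrow> real) \<Rightarrow> nat \<Rightarrow> 'a \<Rightarrow> real \<Rightarrow> real" where
  "picard \<theta> \<mu> v 0 = (\<lambda>x t. 0)"
| "picard \<theta> \<mu> v (Suc n) = (\<lambda>x t. enn2real (min (duhamel \<theta> f \<mu> (picard \<theta> \<mu> v n) x t) (ennreal (v x t))))"

lemma picard_nonneg: "0 \<le> picard \<theta> \<mu> v n x t"
  by (cases n) auto

lemma ennreal_picard_Suc:
  "ennreal (picard \<theta> \<mu> v (Suc n) x t) = min (duhamel \<theta> f \<mu> (picard \<theta> \<mu> v n) x t) (ennreal (v x t))"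
  by (simp add: min_less_iff_disj)

lemma picard_le:
  assumes "0 \<le> v x t"
  shows "picard \<theta> \<mu> v n x t \<le> v x t"
proof (cases n)
  case (Suc m)
  have "ennreal (picard \<theta> \<mu> v (Suc m) x t) \<le> ennreal (v x t)" unfolding ennreal_picard_Suc by simp
  then show ?thesis using assms by (simp add: Suc del: picard.simps)
qed (use assms in simp)

lemma picard_Suc_ge: "picard \<theta> \<mu> v n x t \<le> picard \<theta> \<mu> v (Suc n) x t"
proof (induction n arbitrary: x t)
  case (Suc n)
  have "duhamel \<theta> f \<mu> (picard \<theta> \<mu> v n) x t \<le> duhamel \<theta> f \<mu> (picard \<theta> \<mu> v (Suc n)) x t"
    using Suc by (intro duhamel_mono order_refl f_mono picard_nonneg)
  then have "ennreal (picard \<theta> \<mu> v (Suc n) x t) \<le> ennreal (picard \<theta> \<mu> v (Suc (Suc n)) x t)"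
    unfolding ennreal_picard_Suc by (intro min.mono order_refl)
  then show ?case by (simp add: picard_nonneg del: picard.simps)
qed (simp del: picard.simps(2) add: picard_nonneg)

lemma borel_measurable_picard:
  assumes \<mu>_measurable: "\<mu> \<in> borel_measurable borel"
    and [measurable]: "case_prod v \<in> borel_measurable (borel \<Otimes>\<^sub>M borel)"
  shows "case_prod (picard \<theta> \<mu> v n) \<in> borel_measurable (borel \<Otimes>\<^sub>M borel)"
proof (induction n)
  case (Suc n)
  have [measurable]: "case_prod (duhamel \<theta> f \<mu> (picard \<theta> \<mu> v n)) \<in> borel_measurable (borel \<Otimes>\<^sub>M borel)"
    using Suc by (intro borel_measurable_duhamel \<mu>_measurable borel_measurable_f_comp_pair picard_nonneg)
  have "(\<lambda>p. enn2real (min (case_prod (duhamel \<theta> f \<mu> (picard \<theta> \<mu> v n)) p) (ennreal (case_prod v p))))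
      \<in> borel_measurable (borel \<Otimes>\<^sub>M borel)"
    by measurable
  then show ?case by (simp add: split_beta')
qed simp

definition supersolution ::
  "real \<Rightarrow> ('a::euclidean_space \<Rightarrow> real) \<Rightarrow> real \<Rightarrow> ('a \<Rightarrow> real \<Rightarrow> real) \<Rightarrow> bool" where
  "supersolution \<theta> \<mu> T v \<longleftrightarrow> case_prod v \<in> borel_measurable (borel \<Otimes>\<^sub>M borel) \<and> (\<forall>x t. 0 \<le> v x t) \<and>
     (AE (x, t) in lborel. 0 < t \<and> t < T \<longrightarrow> duhamel \<theta> f \<mu> v x t \<le> ennreal (v x t))"

lemma convergent_picard:
  assumes "\<And>x t. 0 \<le> v x t"
  shows "convergent (\<lambda>n. picard \<theta> \<mu> v n x t)"
proof -
  have "incseq (\<lambda>n. picard \<theta> \<mu> v n x t)" by (intro incseq_SucI picard_Suc_ge)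
  moreover have "\<forall>n. picard \<theta> \<mu> v n x t \<le> v x t" using assms by (intro allI picard_le)
  ultimately show ?thesis by (auto elim: incseq_convergent simp: convergent_def)
qed

lemma locally_solvable_of_supersolution:
  fixes \<mu> :: "'a::euclidean_space \<Rightarrow> real"
  assumes T_pos: "0 < T" and \<mu>_measurable: "\<mu> \<in> borel_measurable borel"
    and super: "supersolution \<theta> \<mu> T v"
  shows "locally_solvable \<theta> f \<mu>"
proof -
  have v: "case_prod v \<in> borel_measurable (borel \<Otimes>\<^sub>M borel)" "\<And>x t. 0 \<le> v x t"
    and v_super: "AE (x, t) in lborel. 0 < t \<and> t < T \<longrightarrow> duhamel \<theta> f \<mu> v x t \<le> ennreal (v x t)"
    using super by (auto simp: supersolution_def)
  let ?p = "picard \<theta> \<mu> v"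
  define u where "u = (\<lambda>x t. lim (\<lambda>n. ?p n x t))"
  have lim: "(\<lambda>n. ?p n x t) \<longlonglongrightarrow> u x t" for x t
    using convergent_picard[of v, OF v(2)] by (simp add: u_def convergent_LIMSEQ_iff)
  have u_nonneg: "0 \<le> u x t" for x t using LIMSEQ_le_const[OF lim] picard_nonneg by blast
  have u_measurable: "case_prod u \<in> borel_measurable (borel \<Otimes>\<^sub>M borel)"
    using borel_measurable_picard[OF \<mu>_measurable v(1)]
    by (rule borel_measurable_LIMSEQ_real[rotated]) (auto intro: lim)
  have "(\<lambda>n. f (?p n x t)) \<longlonglongrightarrow> f (u x t)" for x t
    by (intro continuous_on_tendsto_compose[OF f_continuous lim]) (auto simp: picard_nonneg u_nonneg)
  then have duhamel_lim: "(\<lambda>n. duhamel \<theta> f \<mu> (?p n) x t) \<longlonglongrightarrow> duhamel \<theta> f \<mu> u x t" for x t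
    by (intro tendsto_duhamel borel_measurable_f_comp_pair borel_measurable_picard \<mu>_measurable v(1)
       picard_nonneg
        incseq_SucI f_mono picard_Suc_ge)
  have duhamel_le: "duhamel \<theta> f \<mu> (?p n) x t \<le> duhamel \<theta> f \<mu> v x t" for n x t
    using v(2) by (intro duhamel_mono order_refl f_mono picard_nonneg picard_le)
  have "AE (x, t) in lborel. 0 < t \<and> t < T \<longrightarrow> ennreal (u x t) = duhamel \<theta> f \<mu> u x t"
    using v_super
  proof (eventually_elim, clarify)
    fix x t assume "0 < t \<and> t < T \<longrightarrow> duhamel \<theta> f \<mu> v x t \<le> ennreal (v x t)" "0 < t" "t < T"
    then have "ennreal (?p (Suc n) x t) = duhamel \<theta> f \<mu> (?p n) x t" for n
      unfolding ennreal_picard_Suc using duhamel_le[of n x t]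
      by (auto intro!: min_absorb1 intro: order_trans)
    moreover have "(\<lambda>n. ennreal (?p (Suc n) x t)) \<longlonglongrightarrow> ennreal (u x t)"
      by (intro tendsto_ennrealI LIMSEQ_Suc lim)
    ultimately show "ennreal (u x t) = duhamel \<theta> f \<mu> u x t"
      using duhamel_lim[of x t] by (auto intro: LIMSEQ_unique)
  qed
  then show ?thesis
    unfolding locally_solvable_def she_solution_iff using T_pos u_measurable u_nonneg by blast
qed

lemma locally_solvable_imp_nonneg_solution:
  fixes \<mu> :: "'a::euclidean_space \<Rightarrow> real"
  assumes "locally_solvable \<theta> f \<mu>"
  obtains T u where "0 < T" "case_prod u \<in> borel_measurable (borel \<Otimes>\<^sub>M borel)" "\<And>x t. 0 \<le> u x t"
    "AE (x, t) in lborel. 0 < t \<and> t < T \<longrightarrow> ennreal (u x t) = duhamel \<theta> f \<mu> u x t"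
proof -
  obtain T w where T_pos: "0 < T"
    and [measurable]: "case_prod w \<in> borel_measurable (borel \<Otimes>\<^sub>M borel)"
    and w_nonneg: "\<And>x t. 0 < t \<Longrightarrow> t < T \<Longrightarrow> 0 \<le> w x t"
    and w_eq: "AE (x, t) in lborel. 0 < t \<and> t < T \<longrightarrow> ennreal (w x t) = duhamel \<theta> f \<mu> w x t"
    using assms by (auto simp: locally_solvable_def she_solution_iff)
  define u where "u = (\<lambda>x t. if 0 < t \<and> t < T then w x t else 0)"
  have "(\<lambda>p. if 0 < snd p \<and> snd p < T then case_prod w p else 0) \<in> borel_measurable (borel \<Otimes>\<^sub>M borel)"
    by measurable
  then have "case_prod u \<in> borel_measurable (borel \<Otimes>\<^sub>M borel)" by (simp add: u_def split_beta')
  moreover have duhamel_eq: "duhamel \<theta> f \<mu> u x t = duhamel \<theta> f \<mu> w x t" if "t < T" for x t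
    by (intro antisym duhamel_mono) (use that in \<open>auto simp: u_def\<close>)
  have "AE (x, t) in lborel. 0 < t \<and> t < T \<longrightarrow> ennreal (u x t) = duhamel \<theta> f \<mu> u x t"
    using w_eq by eventually_elim (auto simp: duhamel_eq, simp add: u_def)
  ultimately show ?thesis using w_nonneg by (intro that[of T u] T_pos) (auto simp: u_def)
qed

lemma locally_solvable_mono:
  fixes \<mu> \<mu>' :: "'a::euclidean_space \<Rightarrow> real"
  assumes \<mu>: "\<mu> \<in> borel_measurable borel" "\<And>x. \<mu> x \<le> \<mu>' x" and solvable: "locally_solvable \<theta> f \<mu>'"
  shows "locally_solvable \<theta> f \<mu>"
proof -
  obtain T u where T_pos: "0 < T"
    and u: "case_prod u \<in> borel_measurable (borel \<Otimes>\<^sub>M borel)" "\<And>x t. 0 \<le> u x t"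
    "AE (x, t) in lborel. 0 < t \<and> t < T \<longrightarrow> ennreal (u x t) = duhamel \<theta> f \<mu>' u x t"
    using solvable by (rule locally_solvable_imp_nonneg_solution) blast
  have "AE (x, t) in lborel. 0 < t \<and> t < T \<longrightarrow> duhamel \<theta> f \<mu> u x t \<le> ennreal (u x t)"
    using u(3) by eventually_elim (auto intro!: duhamel_mono \<mu>(2))
  then have "supersolution \<theta> \<mu> T u" using u(1,2) by (simp add: supersolution_def)
  with T_pos \<mu>(1) show ?thesis by (rule locally_solvable_of_supersolution)
qed

end

section \<open>Osgood nonlinearities\<close>

lemma integrable_on_enn2real_of_nn_integral_finite:
  fixes w :: "real \<Rightarrow> ennreal"
  assumes [measurable]: "w \<in> borel_measurable borel" and finite: "(\<integral>\<^sup>+s\<in>{0<..<t}. w s \<partial>lborel) < \<infinity>"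
  shows "(\<lambda>s. enn2real (w s)) integrable_on {0..t}"
    and "\<And>s. s \<le> t \<Longrightarrow> (\<integral>\<^sup>+r\<in>{0<..<s}. w r \<partial>lborel) = ennreal (integral {0..s} (\<lambda>r. enn2real (w r)))"
proof -
  have "AE r in lborel. w r * indicator {0<..<t} r \<noteq> \<infinity>"
    using finite by (intro nn_integral_noteq_infinite) auto
  then have w_finite: "AE r in lborel. r \<in> {0<..<t} \<longrightarrow> w r = ennreal (enn2real (w r))"
    by eventually_elim (auto simp: indicator_def less_top)
  have w_real:
      "(\<integral>\<^sup>+r\<in>{0<..<s}. w r \<partial>lborel) = (\<integral>\<^sup>+r. ennreal (indicator {0..s} r * enn2real (w r)) \<partial>lborel)"
    if "s \<le> t" for s
  proof (rule nn_integral_cong_AE)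
    show "AE r in lborel. w r * indicator {0<..<s} r = ennreal (indicator {0..s} r * enn2real (w r))"
      using w_finite AE_lborel_singleton[of 0] AE_lborel_singleton[of s]
      by eventually_elim (use that in \<open>auto simp: indicator_def\<close>)
  qed
  have w_integrable: "set_integrable lborel {0..s} (\<lambda>r. enn2real (w r))" if "s \<le> t" for s
  proof -
    have "(\<integral>\<^sup>+r\<in>{0<..<s}. w r \<partial>lborel) \<le> (\<integral>\<^sup>+s\<in>{0<..<t}. w s \<partial>lborel)"
      using that by (intro nn_integral_mono) (auto simp: indicator_def)
    then show ?thesis
      using finite w_real[OF that] unfolding set_integrable_def
      by (simp add: integrable_iff_bounded abs_mult le_less_trans)
  qed
  show "(\<lambda>s. enn2real (w s)) integrable_on {0..t}"
    by (rule set_borel_integral_eq_integral(1)[OF w_integrable]) simp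
  fix s assume s_le: "s \<le> t"
  have "(\<integral>\<^sup>+r\<in>{0<..<s}. w r \<partial>lborel) = ennreal (LINT r:{0..s}|lborel. enn2real (w r))"
    unfolding w_real[OF s_le] set_lebesgue_integral_def
    using w_integrable[OF s_le] by (subst nn_integral_eq_integral) (auto simp: set_integrable_def)
  also have "(LINT r:{0..s}|lborel. enn2real (w r)) = integral {0..s} (\<lambda>r. enn2real (w r))"
    by (rule set_borel_integral_eq_integral(2)[OF w_integrable[OF s_le]])
  finally show "(\<integral>\<^sup>+r\<in>{0<..<s}. w r \<partial>lborel) = ennreal (integral {0..s} (\<lambda>r. enn2real (w r)))" .
qed

locale osgood_source = source_term +
  fixes \<tau>0 :: real
  assumes f_pos: "\<And>u. 0 < u \<Longrightarrow> 0 < f u"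
    and \<tau>0_pos: "0 < \<tau>0"
    and osgood: "(\<integral>\<^sup>+s\<in>{\<tau>0..}. ennreal (1 / f s) \<partial>lborel) < \<infinity>"
begin

abbreviation F :: "real \<Rightarrow> real" where "F \<equiv> F_fun f"

lemma continuous_on_inverse_f: "continuous_on {\<tau>0..} (\<lambda>s. 1 / f s)"
  using \<tau>0_pos f_pos
  by (intro continuous_intros continuous_on_subset[OF f_continuous])
     (auto simp: less_imp_neq[THEN not_sym])

lemma set_integrable_inverse_f:
  "\<tau>0 \<le> u \<Longrightarrow> A \<subseteq> {u..} \<Longrightarrow> A \<in> sets borel \<Longrightarrow> set_integrable lborel A (\<lambda>s. 1 / f s)"
proof (rule set_integrable_subset[of _ "{\<tau>0..}"])
  have "(\<lambda>s. indicat_real {\<tau>0..} s *\<^sub>R (1 / f s)) \<in> borel_measurable lborel"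
    using borel_measurable_continuous_on_indicator[OF _ continuous_on_inverse_f] by simp
  moreover have "(\<integral>\<^sup>+s. ennreal (norm (indicat_real {\<tau>0..} s *\<^sub>R (1 / f s))) \<partial>lborel) =
      (\<integral>\<^sup>+s\<in>{\<tau>0..}. ennreal (1 / f s) \<partial>lborel)"
    using f_pos \<tau>0_pos by (intro nn_integral_cong) (auto simp: indicator_def less_imp_le)
  ultimately show "set_integrable lborel {\<tau>0..} (\<lambda>s. 1 / f s)"
    unfolding set_integrable_def using osgood by (simp add: integrable_iff_bounded)
qed auto

lemma F_eq_minus_integral:
  assumes "\<tau>0 \<le> u"
  shows "F u = F \<tau>0 - integral {\<tau>0..u} (\<lambda>s. 1 / f s)"
proof -
  have integrable: "set_integrable lborel A (\<lambda>s. 1 / f s)" if "A \<subseteq> {\<tau>0..}" "A \<in> sets borel" for A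
    using that by (intro set_integrable_inverse_f[of \<tau>0]) auto
  have "F \<tau>0 = (LINT s:{\<tau>0..u} \<union> {u<..}|lborel. 1 / f s)"
    using assms unfolding F_fun_def by (intro arg_cong2[where f = "set_lebesgue_integral lborel"]) auto
  also have "\<dots> = (LINT s:{\<tau>0..u}|lborel. 1 / f s) + (LINT s:{u<..}|lborel. 1 / f s)"
    using assms by (intro set_integral_Un integrable) auto
  also have "(LINT s:{u<..}|lborel. 1 / f s) = F u"
    unfolding F_fun_def
  proof (rule set_integral_cong_set)
    show "AE s in lborel. (s \<in> {u..}) = (s \<in> {u<..})"
      using AE_lborel_singleton[of u] by eventually_elim auto
    show "set_borel_measurable lborel {u<..} (\<lambda>s. 1 / f s)"
        "set_borel_measurable lborel {u..} (\<lambda>s. 1 / f s)"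
      unfolding set_borel_measurable_def
      by (intro borel_measurable_integrable integrable[unfolded set_integrable_def]; use assms in force)+
  qed
  also have "(LINT s:{\<tau>0..u}|lborel. 1 / f s) = integral {\<tau>0..u} (\<lambda>s. 1 / f s)"
    by (intro set_borel_integral_eq_integral(2) integrable) auto
  finally show ?thesis by simp
qed

lemma F_deriv:
  assumes "\<tau>0 < u"
  shows "(F has_real_derivative - (1 / f u)) (at u)"
proof (rule has_field_derivative_transform_within_open[of _ _ _ "{\<tau>0<..}"])
  have "((\<lambda>x. integral {\<tau>0..x} (\<lambda>s. 1 / f s)) has_real_derivative 1 / f u) (at u within {\<tau>0..u + 1})"
    using assms
    by (intro integral_has_real_derivative continuous_on_subset[OF continuous_on_inverse_f]) auto
  then have "((\<lambda>x. integral {\<tau>0..x} (\<lambda>s. 1 / f s)) has_real_derivative 1 / f u) (at u)"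
    using assms at_within_interior[of u "{\<tau>0..u + 1}"] by simp
  then show "((\<lambda>x. F \<tau>0 - integral {\<tau>0..x} (\<lambda>s. 1 / f s)) has_real_derivative - (1 / f u)) (at u)"
    by (auto intro!: derivative_eq_intros)
  show "F \<tau>0 - integral {\<tau>0..x} (\<lambda>s. 1 / f s) = F x" if "x \<in> {\<tau>0<..}" for x
    using F_eq_minus_integral[of x] that by simp
qed (use assms in auto)

lemma F_strict_antimono: "\<tau>0 < u \<Longrightarrow> u < v \<Longrightarrow> F v < F u"
proof (rule DERIV_neg_imp_decreasing[of u v])
  fix x assume "\<tau>0 < u" "u \<le> x"
  then show "\<exists>y. (F has_real_derivative y) (at x) \<and> y < 0"
    using F_deriv[of x] f_pos[of x] \<tau>0_pos by (intro exI[of _ "- (1 / f x)"]) auto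
qed

lemma F_antimono: "\<tau>0 < u \<Longrightarrow> u \<le> v \<Longrightarrow> F v \<le> F u"
  using F_strict_antimono[of u v] by (cases "u = v") auto

lemma F_le_iff: "\<tau>0 < u \<Longrightarrow> \<tau>0 < v \<Longrightarrow> F v \<le> F u \<longleftrightarrow> u \<le> v"
  using F_strict_antimono[of v u] F_antimono[of u v] by (meson not_le)

lemma F_pos:
  assumes "\<tau>0 < u"
  shows "0 < F u"
proof -
  have "0 \<le> F (u + 1)"
    unfolding F_fun_def set_lebesgue_integral_def
    using f_pos \<tau>0_pos assms
    by (intro Bochner_Integration.integral_nonneg) (auto simp: indicator_def less_imp_le)
  also have "\<dots> < F u" using assms by (intro F_strict_antimono) auto
  finally show ?thesis .
qed

lemma tendsto_F_0: "(F \<longlongrightarrow> 0) at_top"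
proof -
  have "((\<lambda>u. LINT s:{\<tau>0..u}|lborel. 1 / f s) \<longlongrightarrow> (LINT s:{\<tau>0..}|lborel. 1 / f s)) at_top"
    by (rule tendsto_set_lebesgue_integral_at_top) (auto intro: set_integrable_inverse_f)
  then have "((\<lambda>u. F \<tau>0 - (LINT s:{\<tau>0..u}|lborel. 1 / f s)) \<longlongrightarrow> F \<tau>0 - F \<tau>0) at_top"
    unfolding F_fun_def by (intro tendsto_intros)
  moreover have "\<forall>\<^sub>F u in at_top. F \<tau>0 - (LINT s:{\<tau>0..u}|lborel. 1 / f s) = F u"
    using eventually_ge_at_top[of \<tau>0]
  proof eventually_elim
    case (elim u)
    have "(LINT s:{\<tau>0..u}|lborel. 1 / f s) = integral {\<tau>0..u} (\<lambda>s. 1 / f s)"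
      by (intro set_borel_integral_eq_integral(2) set_integrable_inverse_f[of \<tau>0]) auto
    then show ?case using F_eq_minus_integral[OF elim] by simp
  qed
  ultimately show ?thesis by (simp add: tendsto_cong)
qed

lemma ex_F_less:
  assumes "0 < s"
  shows "\<exists>v\<ge>U. \<tau>0 < v \<and> F v < s"
proof -
  have "\<forall>\<^sub>F v in at_top. F v < s \<and> max U (\<tau>0 + 1) \<le> v"
    using order_tendstoD(2)[OF tendsto_F_0 assms] eventually_ge_at_top by (rule eventually_conj)
  then obtain v where "F v < s" "max U (\<tau>0 + 1) \<le> v" by (auto dest!: eventually_happens)
  then show ?thesis by (intro exI[of _ v]) auto
qed

lemma continuous_on_F: "A \<subseteq> {\<tau>0<..} \<Longrightarrow> continuous_on A F"
  by (intro continuous_at_imp_continuous_on ballI DERIV_isCont[OF F_deriv]) auto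

lemma ex_F_eq:
  assumes U_gt_\<tau>0: "\<tau>0 < U" and s_bounds: "0 < s" "s \<le> F U"
  shows "\<exists>v\<ge>U. F v = s"
proof -
  obtain V where "U \<le> V" "F V < s" using ex_F_less[OF s_bounds(1)] by blast
  then have "\<exists>v\<ge>U. v \<le> V \<and> F v = s" using U_gt_\<tau>0 s_bounds by (intro IVT2') (auto intro: continuous_on_F)
  then show ?thesis by auto
qed

definition F_inv :: "real \<Rightarrow> real" where
  "F_inv s = Inf {v. \<tau>0 < v \<and> F v \<le> s}"

lemma F_inv_F: "\<tau>0 < v \<Longrightarrow> F_inv (F v) = v"
proof -
  assume "\<tau>0 < v"
  then have "{w. \<tau>0 < w \<and> F w \<le> F v} = {v..}" using F_le_iff by auto
  then show ?thesis by (simp add: F_inv_def)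
qed

lemma F_F_inv:
  assumes "\<tau>0 < U" "0 < s" "s \<le> F U"
  shows "F (F_inv s) = s"
proof -
  obtain v where "U \<le> v" "F v = s" using ex_F_eq[OF assms] by blast
  then show ?thesis using assms F_inv_F[of v] by simp
qed

lemma le_F_inv_iff:
  assumes u_gt_\<tau>0: "\<tau>0 < u" and s_pos: "0 < s"
  shows "u \<le> F_inv s \<longleftrightarrow> s \<le> F u"
proof
  assume "s \<le> F u"
  then obtain v where v: "u \<le> v" "F v = s" using ex_F_eq[OF u_gt_\<tau>0 s_pos] by blast
  then show "u \<le> F_inv s" using u_gt_\<tau>0 F_inv_F[of v] by simp
next
  have level_bdd_below: "bdd_below {v. \<tau>0 < v \<and> F v \<le> s}" by (rule bdd_belowI[of _ \<tau>0]) auto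
  assume u_le: "u \<le> F_inv s"
  show "s \<le> F u"
  proof (rule ccontr)
    assume "\<not> s \<le> F u"
    define m where "m = (\<tau>0 + u) / 2"
    have m_bounds: "\<tau>0 < m" "m < u" using u_gt_\<tau>0 by (auto simp: m_def)
    obtain v where "m \<le> v" "v < u" "F v \<le> s"
    proof (cases "s \<le> F m")
      case True
      then obtain v where "m \<le> v" "F v = s" using ex_F_eq[OF m_bounds(1) s_pos] by blast
      moreover have "v < u"
        using \<open>F v = s\<close> \<open>\<not> s \<le> F u\<close> \<open>m \<le> v\<close> m_bounds(1) u_gt_\<tau>0 F_le_iff[of u v] by auto
      ultimately show ?thesis using that by auto
    qed (use that[of m] m_bounds in auto)
    then have "F_inv s \<le> v" unfolding F_inv_def using m_bounds level_bdd_below by (intro cInf_lower) auto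
    then show False using u_le \<open>v < u\<close> by simp
  qed
qed

lemma \<tau>0_le_F_inv:
  assumes "0 < s"
  shows "\<tau>0 \<le> F_inv s"
proof -
  have "{v. \<tau>0 < v \<and> F v \<le> s} \<noteq> {}" using ex_F_less[OF assms] less_imp_le by blast
  then show ?thesis unfolding F_inv_def by (intro cInf_greatest) auto
qed

lemma F_inv_antimono:
  assumes "0 < s" "s \<le> t"
  shows "F_inv t \<le> F_inv s"
proof -
  have "{v. \<tau>0 < v \<and> F v \<le> s} \<noteq> {}" using ex_F_less[OF assms(1)] less_imp_le by blast
  then show ?thesis
    unfolding F_inv_def using assms(2) by (intro cInf_superset_mono) (auto intro: bdd_belowI[of _ \<tau>0])
qed

lemma borel_measurable_F_inv_comp:
  assumes [measurable]: "g \<in> borel_measurable M" and g_pos: "\<And>x. 0 < g x"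
  shows "(\<lambda>x. F_inv (g x)) \<in> borel_measurable M"
  unfolding borel_measurable_iff_ge
proof
  fix a :: real
  show "{x \<in> space M. a \<le> F_inv (g x)} \<in> sets M"
  proof (cases "\<tau>0 < a")
    case True
    then show ?thesis using g_pos by (simp add: le_F_inv_iff)
  next
    case False
    then have "a \<le> F_inv (g x)" for x using \<tau>0_le_F_inv[OF g_pos, of x] by simp
    then show ?thesis by simp
  qed
qed

lemma blowup_time_le_F:
  assumes t_nonneg: "0 \<le> t" and continuous: "continuous_on {0..t} V"
    and V_gt_\<tau>0: "\<And>s. s \<in> {0..t} \<Longrightarrow> \<tau>0 < V s"
    and deriv: "\<And>s. 0 < s \<Longrightarrow> s < t \<Longrightarrow> (V has_real_derivative V' s) (at s) \<and> f (V s) \<le> V' s"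
  shows "t \<le> F (V 0)"
proof -
  have "F (V t) + t \<le> F (V 0) + 0"
  proof (rule DERIV_nonpos_imp_decreasing_open[OF t_nonneg])
    fix s assume s_bounds: "0 < s" "s < t"
    have "((\<lambda>s. F (V s) + s) has_real_derivative - (1 / f (V s)) * V' s + 1) (at s)"
      using deriv[OF s_bounds] V_gt_\<tau>0[of s] s_bounds
      by (intro DERIV_add DERIV_chain2[OF F_deriv] DERIV_ident) auto
    moreover have "1 \<le> V' s / f (V s)"
      using deriv[OF s_bounds] f_pos[of "V s"] V_gt_\<tau>0[of s] s_bounds \<tau>0_pos by simp
    ultimately show "\<exists>y. ((\<lambda>s. F (V s) + s) has_real_derivative y) (at s) \<and> y \<le> 0" by force
  next
    show "continuous_on {0..t} (\<lambda>s. F (V s) + s)"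
      by (intro continuous_intros continuous_on_compose2[OF continuous_on_F continuous, of "{\<tau>0<..}"])
         (auto intro: V_gt_\<tau>0)
  qed
  then show ?thesis using F_pos[of "V t"] V_gt_\<tau>0[of t] t_nonneg by simp
qed

lemma blowup_time_le_F_of_integral_inequality:
  assumes t_nonneg: "0 \<le> t" and continuous: "continuous_on {0..t} W"
    and h: "\<tau>0 < h" "\<And>s. s \<in> {0..t} \<Longrightarrow> h \<le> W s"
    and integral_le: "\<And>s. s \<in> {0..t} \<Longrightarrow> h + integral {0..s} (\<lambda>r. f (W r)) \<le> W s"
  shows "t \<le> F h"
proof -
  define V where "V = (\<lambda>s. h + integral {0..s} (\<lambda>r. f (W r)))"
  have continuous_fW: "continuous_on {0..t} (\<lambda>s. f (W s))"
    using h \<tau>0_pos by (intro continuous_on_compose2[OF f_continuous continuous]) force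
  have fW_nonneg: "0 \<le> f (W s)" if "s \<in> {0..t}" for s
    using h(1) h(2)[OF that] \<tau>0_pos by (intro f_nonneg) linarith
  have h_le_V: "h \<le> V s" if "s \<in> {0..t}" for s
    unfolding V_def using that fW_nonneg
    by (auto intro!: integral_nonneg integrable_continuous_real continuous_on_subset[OF continuous_fW])
  have "t \<le> F (V 0)"
  proof (rule blowup_time_le_F[OF t_nonneg, of V "\<lambda>s. f (W s)"])
    show "continuous_on {0..t} V"
      unfolding V_def
      by (intro continuous_intros indefinite_integral_continuous_1 integrable_continuous_real
         continuous_fW)
    show "\<tau>0 < V s" if "s \<in> {0..t}" for s using h_le_V[OF that] h(1) by simp
    fix s assume s_bounds: "0 < s" "s < t"
    have "((\<lambda>s. integral {0..s} (\<lambda>r. f (W r))) has_real_derivative f (W s)) (at s within {0..t})"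
      using s_bounds by (intro integral_has_real_derivative continuous_fW) auto
    then have "(V has_real_derivative f (W s)) (at s)"
      using s_bounds at_within_interior[of s "{0..t}"] unfolding V_def
      by (auto intro!: derivative_eq_intros)
    moreover have "f (V s) \<le> f (W s)"
      using integral_le[of s] h_le_V[of s] s_bounds h(1) \<tau>0_pos by (intro f_mono) (auto simp: V_def)
    ultimately show "(V has_real_derivative f (W s)) (at s) \<and> f (V s) \<le> f (W s)" by blast
  qed
  then show ?thesis by (simp add: V_def)
qed

lemma blowup_time_le_F_of_nn_integral_inequality:
  fixes w :: "real \<Rightarrow> ennreal"
  assumes w: "w \<in> borel_measurable borel" "(\<integral>\<^sup>+s\<in>{0<..<t}. w s \<partial>lborel) < \<infinity>" and h_gt_\<tau>0: "\<tau>0 < h"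
    and t_nonneg: "0 \<le> t"
    and f_le_w:
        "AE s in lborel. 0 < s \<and> s < t \<longrightarrow> ennreal (f (h + enn2real (\<integral>\<^sup>+r\<in>{0<..<s}. w r \<partial>lborel))) \<le> w s"
  shows "t \<le> F h"
proof (rule blowup_time_le_F_of_integral_inequality[OF t_nonneg _ h_gt_\<tau>0])
  define W where "W = (\<lambda>s. h + integral {0..s} (\<lambda>r. enn2real (w r)))"
  note integrable = integrable_on_enn2real_of_nn_integral_finite(1)[OF w]
    and nn_integral = integrable_on_enn2real_of_nn_integral_finite(2)[OF w]
  have nonneg: "0 \<le> integral {0..s} (\<lambda>r. enn2real (w r))" if "s \<le> t" for s
    using that by (intro integral_nonneg integrable_on_subinterval[OF integrable]) auto
  show continuous: "continuous_on {0..t} W"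
    unfolding W_def by (intro continuous_intros indefinite_integral_continuous_1 integrable)
  show h_le_W: "h \<le> W s" if "s \<in> {0..t}" for s using nonneg that by (simp add: W_def)
  have fW_nonneg: "0 \<le> f (W s)" if "s \<in> {0..t}" for s
    using h_le_W[OF that] h_gt_\<tau>0 \<tau>0_pos by (intro f_nonneg) simp
  fix s assume s_in: "s \<in> {0..t}"
  have fW_integrable: "(\<lambda>r. f (W r)) integrable_on {0..s}"
    using s_in h_gt_\<tau>0 h_le_W \<tau>0_pos
    by (intro integrable_continuous_real
       continuous_on_compose2[OF f_continuous continuous_on_subset[OF continuous]]) force+
  have "ennreal (integral {0..s} (\<lambda>r. f (W r))) = (\<integral>\<^sup>+r. ennreal (f (W r)) * indicator {0..s} r \<partial>lborel)"
    using fW_nonneg s_in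
    by (intro nn_integral_has_integral_lebesgue'[symmetric] integrable_integral fW_integrable) auto
  also have "\<dots> \<le> (\<integral>\<^sup>+r\<in>{0<..<s}. w r \<partial>lborel)"
  proof (rule nn_integral_mono_AE)
    show "AE r in lborel. ennreal (f (W r)) * indicator {0..s} r \<le> w r * indicator {0<..<s} r"
      using f_le_w AE_lborel_singleton[of 0] AE_lborel_singleton[of s]
      by eventually_elim (use s_in nn_integral nonneg in \<open>auto simp: indicator_def W_def\<close>)
  qed
  also have "\<dots> = ennreal (integral {0..s} (\<lambda>r. enn2real (w r)))" using s_in by (intro nn_integral) simp
  finally show "h + integral {0..s} (\<lambda>r. f (W r)) \<le> W s"
    using nonneg[of s] s_in by (simp add: W_def ennreal_le_iff)
qed

end

section \<open>Asymptotically regular nonlinearities\<close>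

lemma above_tangent_of_mono_deriv:
  fixes h h' :: "real \<Rightarrow> real"
  assumes deriv: "\<And>u. U \<le> u \<Longrightarrow> (h has_real_derivative h' u) (at u)"
    and mono: "\<And>u v. U \<le> u \<Longrightarrow> u \<le> v \<Longrightarrow> h' u \<le> h' v"
    and vw_above_U: "U \<le> v" "U \<le> w"
  shows "h v + h' v * (w - v) \<le> h w"
proof (cases v w rule: linorder_cases)
  case less
  then obtain z where z: "v < z" "z < w" "h w - h v = (w - v) * h' z"
    using MVT2[of v w h h'] deriv vw_above_U by auto
  have "(w - v) * h' v \<le> (w - v) * h' z" using z less vw_above_U by (intro mult_left_mono mono) auto
  then show ?thesis using z(3) by (simp add: algebra_simps)
next
  case greater
  then obtain z where z: "w < z" "z < v" "h v - h w = (v - w) * h' z"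
    using MVT2[of w v h h'] deriv vw_above_U by auto
  have "(v - w) * h' z \<le> (v - w) * h' v" using z greater vw_above_U by (intro mult_left_mono mono) auto
  then show ?thesis using z by (simp add: algebra_simps)
qed simp

locale nonlinearity = osgood_source +
  fixes f' :: "real \<Rightarrow> real" and \<tau>1 q :: real
  assumes f_deriv_within: "\<And>u. \<tau>0 \<le> u \<Longrightarrow> (f has_real_derivative f' u) (at u within {\<tau>0..})"
    and \<tau>1_nonneg: "0 \<le> \<tau>1"
    and f_convex: "convex_on {\<tau>1..} f"
    and tendsto_f'F: "((\<lambda>u. f' u * F_fun f u) \<longlongrightarrow> q) at_top"
    and q_ge_1: "1 \<le> q"
begin

lemma f_deriv: "\<tau>0 < u \<Longrightarrow> (f has_real_derivative f' u) (at u)"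
  using f_deriv_within[of u] at_within_interior[of u "{\<tau>0..}"] by simp

lemma f'_nonneg:
  assumes "\<tau>0 < u"
  shows "0 \<le> f' u"
proof (rule ccontr)
  assume "\<not> 0 \<le> f' u"
  then obtain d where d: "d > 0" "\<And>h. 0 < h \<Longrightarrow> h < d \<Longrightarrow> f (u + h) < f u"
    using DERIV_neg_dec_right[OF f_deriv[OF assms]] by auto
  have "f u \<le> f (u + d / 2)" using d assms \<tau>0_pos by (intro f_mono) auto
  then show False using d(2)[of "d / 2"] d(1) by simp
qed

lemma ex_f'F_between:
  assumes "a < q" "q < b"
  shows "\<exists>U>\<tau>0. \<forall>u\<ge>U. a < f' u * F u \<and> f' u * F u < b"
proof -
  have "\<forall>\<^sub>F u in at_top. a < f' u * F u \<and> f' u * F u < b"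
    using order_tendstoD[OF tendsto_f'F] assms by (auto intro: eventually_conj)
  then obtain U where "\<And>u. u \<ge> U \<Longrightarrow> a < f' u * F u \<and> f' u * F u < b"
    by (auto simp: eventually_at_top_linorder)
  then show ?thesis by (intro exI[of _ "max U (\<tau>0 + 1)"]) auto
qed

definition fF :: "real \<Rightarrow> real \<Rightarrow> real" where
  "fF \<rho> u = f u * F u powr \<rho>"

lemma fF_pos: "\<tau>0 < u \<Longrightarrow> 0 < fF \<rho> u"
  using F_pos[of u] f_pos[of u] \<tau>0_pos by (simp add: fF_def)

lemma fF_add: "fF (\<rho> + \<sigma>) u = fF \<rho> u * F u powr \<sigma>"
  by (simp add: fF_def powr_add)

lemma fF_deriv:
  assumes "\<tau>0 < u"
  shows "(fF \<rho> has_real_derivative F u powr (\<rho> - 1) * (f' u * F u - \<rho>)) (at u)"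
proof -
  have "((\<lambda>u. f u * F u powr \<rho>) has_real_derivative f' u * F u powr \<rho> +
      (\<rho> * F u powr (\<rho> - 1) * - (1 / f u)) * f u) (at u)"
    using DERIV_mult[OF f_deriv[OF assms] DERIV_fun_powr[OF F_deriv[OF assms] F_pos[OF assms], of \<rho>]]
    by simp
  moreover have "F u powr \<rho> = F u powr (\<rho> - 1) * F u"
    using F_pos[OF assms] by (simp add: powr_diff)
  ultimately show ?thesis using f_pos[of u] assms \<tau>0_pos by (simp add: fF_def[abs_def] algebra_simps)
qed

lemma fF_mono:
  assumes U_gt_\<tau>0: "\<tau>0 < U" and \<rho>_le: "\<And>u. U \<le> u \<Longrightarrow> \<rho> \<le> f' u * F u" and uv_bounds: "U \<le> u" "u \<le> v"
  shows "fF \<rho> u \<le> fF \<rho> v"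
proof (rule DERIV_nonneg_imp_nondecreasing[OF uv_bounds(2)])
  fix x assume "u \<le> x"
  then show "\<exists>y. (fF \<rho> has_real_derivative y) (at x) \<and> 0 \<le> y"
    using uv_bounds U_gt_\<tau>0 \<rho>_le[of x] fF_deriv[of x \<rho>]
    by (intro exI[of _ "F x powr (\<rho> - 1) * (f' x * F x - \<rho>)"]) auto
qed

lemma fF_antimono:
  assumes U_gt_\<tau>0: "\<tau>0 < U" and le_\<rho>: "\<And>u. U \<le> u \<Longrightarrow> f' u * F u \<le> \<rho>" and uv_bounds: "U \<le> u" "u \<le> v"
  shows "fF \<rho> v \<le> fF \<rho> u"
proof (rule DERIV_nonpos_imp_nonincreasing[OF uv_bounds(2)])
  fix x assume "u \<le> x"
  then show "\<exists>y. (fF \<rho> has_real_derivative y) (at x) \<and> y \<le> 0"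
    using uv_bounds U_gt_\<tau>0 le_\<rho>[of x] fF_deriv[of x \<rho>]
    by (intro exI[of _ "F x powr (\<rho> - 1) * (f' x * F x - \<rho>)"]) (auto intro: mult_nonneg_nonpos)
qed

lemma fF_half_at_top: "filterlim (fF (1 / 2)) at_top at_top"
proof -
  obtain U where U: "U > \<tau>0" "\<And>u. u \<ge> U \<Longrightarrow> 3 / 4 < f' u * F u"
    using ex_f'F_between[of "3 / 4" "q + 1"] q_ge_1 by auto
  define slope where "slope = F U powr (- 1 / 2) / 4"
  have slope: "slope > 0" using F_pos[OF U(1)] by (simp add: slope_def)
  have fF_half_ge: "fF (1 / 2) U + slope * (u - U) \<le> fF (1 / 2) u" if u: "u \<ge> U" for u
  proof -
    have "fF (1 / 2) U - slope * U \<le> fF (1 / 2) u - slope * u"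
    proof (rule DERIV_nonneg_imp_nondecreasing[OF u])
      fix x assume x_ge: "U \<le> x"
      have "F U powr (- 1 / 2) * (1 / 4) \<le> F x powr (- 1 / 2) * (f' x * F x - 1 / 2)"
        using U(2)[of x] x_ge U(1) F_pos[of x] F_antimono[of U x] by (intro mult_mono powr_mono2') auto
      moreover have "((\<lambda>u. fF (1 / 2) u - slope * u) has_real_derivative
          F x powr (1 / 2 - 1) * (f' x * F x - 1 / 2) - slope * 1) (at x)"
        using x_ge U by (intro DERIV_diff fF_deriv DERIV_cmult DERIV_ident) auto
      ultimately show "\<exists>y. ((\<lambda>u. fF (1 / 2) u - slope * u) has_real_derivative y) (at x) \<and> 0 \<le> y"
        by (intro exI conjI) (auto simp: slope_def)
    qed
    then show ?thesis by (simp add: algebra_simps)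
  qed
  have "filterlim (\<lambda>u. fF (1 / 2) U + slope * (u - U)) at_top at_top"
    by (intro filterlim_tendsto_add_at_top[OF tendsto_const]
        filterlim_tendsto_pos_mult_at_top[OF tendsto_const slope]) real_asymp
  then show ?thesis
    by (rule filterlim_at_top_mono)
       (rule eventually_mono[OF eventually_ge_at_top[of U]], rule fF_half_ge)
qed

lemma F_powr_above_tangent:
  assumes U_gt_\<tau>0: "\<tau>0 < U" and mono: "\<And>u v. U \<le> u \<Longrightarrow> u \<le> v \<Longrightarrow> r / fF (r + 1) u \<le> r / fF (r + 1) v"
    and vw_above_U: "U \<le> v" "U \<le> w"
  shows "F v powr - r + r / fF (r + 1) v * (w - v) \<le> F w powr - r"
proof (rule above_tangent_of_mono_deriv[where U = U, OF _ mono vw_above_U])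
  fix u assume "U \<le> u"
  then have u_gt_\<tau>0: "\<tau>0 < u" using U_gt_\<tau>0 by simp
  have "((\<lambda>u. F u powr - r) has_real_derivative - r * F u powr (- r - of_nat 1) * - (1 / f u)) (at u)"
    using u_gt_\<tau>0 by (intro DERIV_fun_powr F_deriv F_pos)
  moreover have "F u powr (- r - of_nat 1) = 1 / F u powr (r + 1)"
    using powr_minus_divide[of "F u" "r + 1"] by simp
  ultimately show "((\<lambda>u. F u powr - r) has_real_derivative r / fF (r + 1) u) (at u)"
    by (simp add: fF_def field_simps)
qed

lemma F_above_tangent:
  assumes "\<tau>0 < v" "v \<le> w"
  shows "f v * (F v - F w) \<le> w - v"
proof -
  have "F v + - (1 / f v) * (w - v) \<le> F w"
  proof (rule above_tangent_of_mono_deriv[where U = v])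
    fix u w assume "v \<le> u" "u \<le> w"
    then show "- (1 / f u) \<le> - (1 / f w)"
      using f_mono[of u w] f_pos[of u] assms \<tau>0_pos by (simp add: frac_le)
  qed (use assms in \<open>auto intro: F_deriv\<close>)
  then show ?thesis using f_pos[of v] assms \<tau>0_pos by (simp add: field_simps)
qed

lemma sqrt_F_above_tangent:
  assumes U_gt_\<tau>0: "\<tau>0 < U" and mono: "\<And>u v. U \<le> u \<Longrightarrow> u \<le> v \<Longrightarrow> fF (1 / 2) u \<le> fF (1 / 2) v"
    and vw_above_U: "U \<le> v" "U \<le> w"
  shows "2 * fF (1 / 2) v * (sqrt (F v) - sqrt (F w)) \<le> w - v"
proof -
  have fF_half_pos: "0 < fF (1 / 2) u" if "U \<le> u" for u using that U_gt_\<tau>0 by (intro fF_pos) simp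
  have "F v powr - (- 1 / 2) + (- 1 / 2) / fF (- 1 / 2 + 1) v * (w - v) \<le> F w powr - (- 1 / 2)"
    using fF_half_pos mono by (intro F_powr_above_tangent[OF U_gt_\<tau>0 _ vw_above_U]) (simp add: frac_le)
  moreover have "0 \<le> F v" "0 \<le> F w" using F_pos[of v] F_pos[of w] U_gt_\<tau>0 vw_above_U by auto
  ultimately have "sqrt (F v) - sqrt (F w) \<le> (w - v) / (2 * fF (1 / 2) v)" by (simp add: powr_half_sqrt)
  then show ?thesis using fF_half_pos[OF vw_above_U(1)] by (simp add: field_simps)
qed

lemma ex_fF_1_le_affine: "\<exists>U>\<tau>0. \<exists>a. \<forall>v\<ge>U. fF 1 v \<le> a + (q - 1 / 2) * v"
proof -
  obtain U where U: "U > \<tau>0" "\<And>u. u \<ge> U \<Longrightarrow> f' u * F u < q + 1 / 2"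
    using ex_f'F_between[of "q - 1" "q + 1 / 2"] by auto
  have "fF 1 v - (q - 1 / 2) * v \<le> fF 1 U - (q - 1 / 2) * U" if v_ge: "U \<le> v" for v
  proof (rule DERIV_nonpos_imp_nonincreasing[OF v_ge])
    fix x assume x_ge: "U \<le> x"
    have "((\<lambda>u. fF 1 u - (q - 1 / 2) * u) has_real_derivative
        F x powr (1 - 1) * (f' x * F x - 1) - (q - 1 / 2) * 1) (at x)"
      using x_ge U(1) by (intro DERIV_diff fF_deriv DERIV_cmult DERIV_ident) auto
    moreover have "F x powr (1 - 1) * (f' x * F x - 1) - (q - 1 / 2) * 1 \<le> 0"
      using U(2)[OF x_ge] F_pos[of x] x_ge U(1) by simp
    ultimately show "\<exists>y. ((\<lambda>u. fF 1 u - (q - 1 / 2) * u) has_real_derivative y) (at x) \<and> y \<le> 0" by blast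
  qed
  then show ?thesis
    using U(1)
    by (intro exI[of _ U] conjI exI[of _ "fF 1 U - (q - 1 / 2) * U"]) (auto simp: algebra_simps)
qed

text \<open>Superlinearity: the zero of the tangent at v tends to infinity with v.\<close>
lemma ex_f_le_f'_mult_diff: "\<exists>U>\<tau>0. \<forall>v\<ge>U. f v \<le> f' v * (v - a)"
proof -
  obtain U1 c where U1: "U1 > \<tau>0" "\<And>v. U1 \<le> v \<Longrightarrow> fF 1 v \<le> c + (q - 1 / 2) * v"
    using ex_fF_1_le_affine by blast
  obtain U2 where U2: "U2 > \<tau>0" "\<And>v. U2 \<le> v \<Longrightarrow> q - 1 / 4 < f' v * F v"
    using ex_f'F_between[of "q - 1 / 4" "q + 1"] by auto
  define U where "U = max (max U1 U2) (max a (4 * (c + (q - 1 / 4) * a)))"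
  have "f v \<le> f' v * (v - a)" if "U \<le> v" for v
  proof -
    have v_bounds: "U1 \<le> v" "U2 \<le> v" "a \<le> v" "4 * (c + (q - 1 / 4) * a) \<le> v" "\<tau>0 < v"
      using that U1(1) by (auto simp: U_def)
    have "f v * F v \<le> c + (q - 1 / 2) * v"
      using U1(2)[OF v_bounds(1)] F_pos[OF v_bounds(5)] by (simp add: fF_def)
    also have "\<dots> \<le> (q - 1 / 4) * (v - a)" using v_bounds(4) by (simp add: field_simps)
    also have "\<dots> \<le> f' v * F v * (v - a)"
      using U2(2)[OF v_bounds(2)] v_bounds(3) by (intro mult_right_mono) auto
    finally have "F v * f v \<le> F v * (f' v * (v - a))" by (simp add: ac_simps)
    then show ?thesis using F_pos[OF v_bounds(5)] by simp
  qed
  moreover have "\<tau>0 < U" using U1(1) by (simp add: U_def)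
  ultimately show ?thesis by blast
qed

text \<open>Although f is convex only near infinity, the tangent at a high level stays below f on all of
  [0, \<open>\<infinity>\<close>): by superlinearity it is negative wherever convexity fails.\<close>
lemma ex_f_above_tangent: "\<exists>U>\<tau>0. \<forall>v\<ge>U. \<forall>w\<ge>0. f v + f' v * (w - v) \<le> f w"
proof -
  obtain U where U: "U > \<tau>0" "\<And>v. v \<ge> U \<Longrightarrow> f v \<le> f' v * (v - \<tau>1)"
    using ex_f_le_f'_mult_diff[of \<tau>1] by blast
  have tangent: "f v + f' v * (w - v) \<le> f w" if v_ge: "max U (\<tau>1 + 1) \<le> v" and w_nonneg: "0 \<le> w" for v w
  proof (cases "\<tau>1 \<le> w")
    case True
    have "f' v * (w - v) \<le> f w - f v"
    proof (rule convex_on_imp_above_tangent[OF f_convex])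
      show "(f has_real_derivative f' v) (at v within {\<tau>1..})"
        using v_ge U(1) by (intro f_deriv[THEN has_field_derivative_at_within]) simp
      show "v \<in> interior {\<tau>1..}" using v_ge by simp
      show "w \<in> {\<tau>1..}" using True by simp
    qed simp
    then show ?thesis by simp
  next
    case False
    have "f v \<le> f' v * (v - \<tau>1)" using v_ge by (intro U(2)) simp
    also have "\<dots> \<le> f' v * (v - w)" using False v_ge U(1) by (intro mult_left_mono f'_nonneg) auto
    finally show ?thesis using f_nonneg[OF w_nonneg] by (simp add: algebra_simps)
  qed
  show ?thesis
    using U(1) by (intro exI[of _ "max U (\<tau>1 + 1)"] conjI allI impI tangent) auto
qed

end

locale nonlinearity_window = nonlinearity +
  fixes r \<kappa> U :: real
  assumes r_pos: "0 < r" and \<kappa>_pos: "0 < \<kappa>" and U: "\<tau>0 < U"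
    and f'F_window: "\<And>u. U \<le> u \<Longrightarrow> r \<le> f' u * F_fun f u \<and> f' u * F_fun f u \<le> r + 1 - \<kappa>"

lemma (in nonlinearity) ex_nonlinearity_window:
  assumes "q - 1 < p"
  shows "\<exists>r \<kappa> U0. r < p \<and> (\<forall>U\<ge>U0. nonlinearity_window f \<tau>0 f' \<tau>1 q r \<kappa> U)"
proof -
  define r where "r = (q - 1 + min q p) / 2"
  define \<kappa> where "\<kappa> = (r + 1 - q) / 2"
  have r_bounds: "0 < r" "r < p" "r < q" "q - 1 < r" using q_ge_1 assms by (auto simp: r_def)
  have \<kappa>_bounds: "0 < \<kappa>" "q < r + 1 - \<kappa>" using r_bounds(4) by (auto simp: \<kappa>_def field_simps)
  obtain U0 where U0: "U0 > \<tau>0" "\<And>u. u \<ge> U0 \<Longrightarrow> r < f' u * F u \<and> f' u * F u < r + 1 - \<kappa>"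
    using ex_f'F_between[OF r_bounds(3) \<kappa>_bounds(2)] by auto
  have "nonlinearity_window f \<tau>0 f' \<tau>1 q r \<kappa> U" if "U0 \<le> U" for U
    using r_bounds \<kappa>_bounds U0(1) that less_imp_le[OF conjunct1[OF U0(2)]]
      less_imp_le[OF conjunct2[OF U0(2)]]
    by unfold_locales auto
  then show ?thesis using r_bounds(2) by blast
qed

context nonlinearity_window
begin

lemma \<tau>0_less: "U \<le> u \<Longrightarrow> \<tau>0 < u"
  using U by simp

lemma fF_r_mono: "U \<le> u \<Longrightarrow> u \<le> v \<Longrightarrow> fF r u \<le> fF r v"
  using U f'F_window by (intro fF_mono) auto

lemma fF_r_plus_1_minus_\<kappa>_antimono: "U \<le> u \<Longrightarrow> u \<le> v \<Longrightarrow> fF (r + 1 - \<kappa>) v \<le> fF (r + 1 - \<kappa>) u"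
  using U f'F_window by (intro fF_antimono) auto

lemma fF_r_plus_1_antimono:
  assumes "U \<le> u" "u \<le> v"
  shows "fF (r + 1) v \<le> fF (r + 1) u"
proof (rule fF_antimono[OF U _ assms])
  show "f' w * F w \<le> r + 1" if "U \<le> w" for w using f'F_window[OF that] \<kappa>_pos by simp
qed

definition J :: "real \<Rightarrow> real" where
  "J v = F v powr - r"

definition J_inv :: "real \<Rightarrow> real" where
  "J_inv y = F_inv (y powr (- 1 / r))"

lemma J_pos: "U \<le> v \<Longrightarrow> 0 < J v"
  using F_pos[OF \<tau>0_less] by (simp add: J_def less_imp_neq[THEN not_sym])

lemma J_mono: "U \<le> u \<Longrightarrow> u \<le> v \<Longrightarrow> J u \<le> J v"
  unfolding J_def using r_pos F_pos[of v] F_antimono[of u v] U by (intro powr_mono2') auto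

lemma J_above_tangent:
  assumes "U \<le> v" "U \<le> w"
  shows "J v + r / fF (r + 1) v * (w - v) \<le> J w"
  unfolding J_def
proof (rule F_powr_above_tangent[OF U _ assms])
  fix u v assume "U \<le> u" "u \<le> v"
  then show "r / fF (r + 1) u \<le> r / fF (r + 1) v"
    using r_pos fF_r_plus_1_antimono fF_pos[OF \<tau>0_less] by (intro divide_left_mono mult_pos_pos) auto
qed

lemma J_powr: "U \<le> v \<Longrightarrow> J v powr (- 1 / r) = F v"
  using r_pos F_pos[OF \<tau>0_less] by (simp add: J_def powr_powr less_imp_le)

lemma F_J_inv:
  assumes "J U \<le> y"
  shows "U \<le> J_inv y" "F (J_inv y) = y powr (- 1 / r)"
proof -
  have "y powr (- 1 / r) \<le> J U powr (- 1 / r)"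
    using assms J_pos[of U] r_pos by (intro powr_mono2') auto
  then have "y powr (- 1 / r) \<le> F U" unfolding J_powr[OF order_refl] .
  moreover have "0 < y" using assms J_pos[of U] by simp
  ultimately show "U \<le> J_inv y" "F (J_inv y) = y powr (- 1 / r)"
    unfolding J_inv_def using U by (auto simp: le_F_inv_iff intro: F_F_inv)
qed

lemma J_J_inv:
  assumes "J U \<le> y"
  shows "J (J_inv y) = y"
proof -
  have "0 < y" using assms J_pos[of U] by simp
  then show ?thesis using F_J_inv(2)[OF assms] r_pos by (simp add: J_def powr_powr)
qed

lemma J_inv_mono:
  assumes "0 < x" "x \<le> y"
  shows "J_inv x \<le> J_inv y"
  unfolding J_inv_def using assms r_pos by (intro F_inv_antimono powr_mono2') auto

lemma J_inv_pos: "0 < y \<Longrightarrow> 0 < J_inv y"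
  unfolding J_inv_def using \<tau>0_le_F_inv[of "y powr (- 1 / r)"] \<tau>0_pos by simp

lemma J_inv_double_gap:
  assumes J_U_le_y: "J U \<le> y"
  shows "y * fF (r + 1) (J_inv (2 * y)) \<le> r * (J_inv (2 * y) - J_inv y)"
proof -
  have J_U_le_double_y: "J U \<le> 2 * y" using J_U_le_y J_pos[of U] by simp
  have "J (J_inv (2 * y)) + r / fF (r + 1) (J_inv (2 * y)) * (J_inv y - J_inv (2 * y)) \<le> J (J_inv y)"
    using J_U_le_y J_U_le_double_y by (intro J_above_tangent F_J_inv)
  then have "y \<le> r / fF (r + 1) (J_inv (2 * y)) * (J_inv (2 * y) - J_inv y)"
    unfolding J_J_inv[OF J_U_le_y] J_J_inv[OF J_U_le_double_y] right_diff_distrib by linarith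
  moreover have "0 < fF (r + 1) (J_inv (2 * y))"
    using F_J_inv(1)[OF J_U_le_double_y] by (intro fF_pos \<tau>0_less)
  ultimately show ?thesis by (simp add: field_simps)
qed

lemma f_le_J_mult:
  assumes v_ge: "U \<le> v" and \<sigma>_bounds: "0 < \<sigma>" "\<sigma> \<le> F v" and \<tau>_bounds: "\<sigma> \<le> \<tau>" "\<tau> \<le> F U"
  shows "f v \<le> fF (r + 1 - \<kappa>) (F_inv \<tau>) * \<sigma> powr (\<kappa> - 1) * J v"
proof -
  have v_le: "v \<le> F_inv \<sigma>" using v_ge \<sigma>_bounds by (simp add: le_F_inv_iff \<tau>0_less)
  have F_\<sigma>: "F (F_inv \<sigma>) = \<sigma>" using U \<sigma>_bounds(1) \<tau>_bounds by (intro F_F_inv[of U]) auto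
  have "f v = fF r v * J v"
    using F_pos[OF \<tau>0_less[OF v_ge]] by (simp add: fF_def J_def powr_minus_divide)
  also have "\<dots> \<le> fF r (F_inv \<sigma>) * J v"
    using v_ge v_le J_pos[OF v_ge] by (intro mult_right_mono fF_r_mono) auto
  also have "fF r (F_inv \<sigma>) = fF (r + 1 - \<kappa>) (F_inv \<sigma>) * \<sigma> powr (\<kappa> - 1)"
    using fF_add[of "r + 1 - \<kappa>" "\<kappa> - 1" "F_inv \<sigma>"] by (simp add: F_\<sigma>)
  also have "\<dots> * J v \<le> fF (r + 1 - \<kappa>) (F_inv \<tau>) * \<sigma> powr (\<kappa> - 1) * J v"
    using U \<sigma>_bounds(1) \<tau>_bounds J_pos[OF v_ge]
    by (intro mult_right_mono fF_r_plus_1_minus_\<kappa>_antimono F_inv_antimono) (auto simp: le_F_inv_iff)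
  finally show ?thesis .
qed

lemma J_max_le:
  assumes b_pos: "0 < b" and inverse_F_le: "U < m \<Longrightarrow> 1 / F m \<le> b * \<rho> powr - \<theta>"
  shows "J (max m U) \<le> J U + b powr r * \<rho> powr - (\<theta> * r)"
proof (cases "U < m")
  case True
  have F_m: "0 < F m" using True U by (intro F_pos) simp
  have "J (max m U) = (1 / F m) powr r"
    using True F_m by (simp add: J_def powr_minus_divide powr_divide max_absorb1)
  also have "\<dots> \<le> (b * \<rho> powr - \<theta>) powr r"
    using inverse_F_le[OF True] F_m r_pos by (intro powr_mono2) auto
  also have "\<dots> = b powr r * \<rho> powr - (\<theta> * r)" using b_pos by (simp add: powr_mult powr_powr)
  finally show ?thesis using J_pos[of U] by simp
next
  case False
  then show ?thesis by (simp add: max_absorb2)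
qed

lemma borel_measurable_J_max:
  assumes [measurable]: "\<mu> \<in> borel_measurable M"
  shows "(\<lambda>x. J (max (\<mu> x) U)) \<in> borel_measurable M"
proof -
  have [measurable]: "(\<lambda>m. J (max m U)) \<in> borel_measurable borel"
    by (intro borel_measurable_mono monoI J_mono) auto
  show ?thesis by measurable
qed

end

section \<open>Existence\<close>

locale semilinear_heat = nonlinearity f \<tau>0 f' \<tau>1 q + fractional_diffusion \<theta>
  for f :: "real \<Rightarrow> real" and \<tau>0 f' \<tau>1 q \<theta>

locale semilinear_heat_window = nonlinearity_window f \<tau>0 f' \<tau>1 q r \<kappa> U + semilinear_heat f \<tau>0 f' \<tau>1 q \<theta>
  for f :: "real \<Rightarrow> real" and \<tau>0 f' \<tau>1 q r \<kappa> U \<theta>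
begin

lemma locally_integrable_of_inverse_F_le:
  fixes \<mu> :: "'a::euclidean_space \<Rightarrow> real"
  assumes subcritical: "\<theta> * r < DIM('a)" and b_pos: "0 < b"
    and [measurable]: "\<mu> \<in> borel_measurable borel" and nonneg: "\<And>x. 0 \<le> \<mu> x"
    and F_le: "\<And>x. U < \<mu> x \<Longrightarrow> 1 / F (\<mu> x) \<le> b * norm x powr - \<theta>"
  shows "locally_integrable \<mu>"
proof -
  define d where "d = r / fF (r + 1) U"
  have d_pos: "0 < d" using r_pos fF_pos[OF U] by (simp add: d_def)
  have U_pos: "0 < U" using U \<tau>0_pos by simp
  have \<mu>_le: "\<mu> x \<le> U + b powr r / d * norm x powr - (\<theta> * r)" for x
  proof -
    have "d * (\<mu> x - U) \<le> d * (max (\<mu> x) U - U)" using d_pos by (intro mult_left_mono) auto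
    also have "\<dots> \<le> J (max (\<mu> x) U) - J U" using J_above_tangent[of U "max (\<mu> x) U"] by (simp add: d_def)
    also have "\<dots> \<le> b powr r * norm x powr - (\<theta> * r)"
      using J_max_le[OF b_pos F_le[of x]] by simp
    finally show ?thesis using d_pos by (simp add: field_simps)
  qed
  show ?thesis
    using \<theta>_pos r_pos subcritical nonneg U_pos d_pos \<mu>_le
    by (intro locally_integrable_of_le_norm_powr[of "\<theta> * r" \<mu> U "b powr r / d"]) auto
qed

context
  fixes \<mu> :: "'a::euclidean_space \<Rightarrow> real" and E T :: real
  assumes \<mu> [measurable]: "\<mu> \<in> borel_measurable borel" and \<mu>_nonneg: "\<And>x. 0 \<le> \<mu> x"
    and E: "0 < E" "E \<le> \<kappa> / (2 * r)"
    and caloric_le: "\<And>x t. 0 < t \<Longrightarrow> t < T \<Longrightarrow>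
      S t (\<lambda>y. ennreal (J (max (\<mu> y) U))) x \<le> ennreal ((E / t) powr r / 2)"
begin

definition caloric_J :: "'a \<Rightarrow> real \<Rightarrow> real" where
  "caloric_J x t = enn2real (S t (\<lambda>y. ennreal (J (max (\<mu> y) U))) x)"

lemma heat_semigroup_J_eq:
  assumes "0 < t" "t < T"
  shows "S t (\<lambda>y. ennreal (J (max (\<mu> y) U))) x = ennreal (caloric_J x t)"
  unfolding caloric_J_def using caloric_le[OF assms, of x]
  by (intro ennreal_enn2real[symmetric]) (simp add: le_less_trans)

lemma double_caloric_J_le:
  assumes "0 < t" "t < T"
  shows "2 * caloric_J x t \<le> (E / t) powr r"
  using caloric_le[OF assms, of x] by (simp add: heat_semigroup_J_eq[OF assms] ennreal_le_iff)

lemma J_U_le_caloric_J: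
  assumes "0 < t" "t < T"
  shows "J U \<le> caloric_J x t"
proof -
  have "ennreal (J U) = S t (\<lambda>_. ennreal (J U)) x" using assms(1) by (simp add: heat_semigroup_const)
  also have "\<dots> \<le> ennreal (caloric_J x t)"
    unfolding heat_semigroup_J_eq[OF assms, symmetric]
    by (intro heat_semigroup_mono ennreal_leI J_mono) auto
  finally show ?thesis by (simp add: caloric_J_def)
qed

lemma caloric_J_pos: "0 < t \<Longrightarrow> t < T \<Longrightarrow> 0 < caloric_J x t"
  using J_U_le_caloric_J[of t x] J_pos[of U] by simp

lemma J_U_le_double_caloric_J: "0 < t \<Longrightarrow> t < T \<Longrightarrow> J U \<le> 2 * caloric_J x t"
  using J_U_le_caloric_J[of t x] J_pos[of U] by simp

lemma heat_semigroup_initial_le: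
  assumes t_bounds: "0 < t" "t < T"
  shows "S t (\<lambda>y. ennreal (\<mu> y)) x \<le> ennreal (J_inv (caloric_J x t))"
proof -
  define v where "v = J_inv (caloric_J x t)"
  define d where "d = r / fF (r + 1) v"
  have v: "U \<le> v" "J v = caloric_J x t"
    using J_U_le_caloric_J[OF t_bounds] by (auto simp: v_def F_J_inv J_J_inv)
  have v_pos: "0 < v" using v(1) U \<tau>0_pos by simp
  have d_pos: "0 < d" using r_pos fF_pos[OF \<tau>0_less[OF v(1)]] by (simp add: d_def)
  have "ennreal (J v) + ennreal d * S t (\<lambda>y. ennreal (\<mu> y)) x \<le> ennreal (d * v) + ennreal (J v)"
    unfolding v(2) heat_semigroup_J_eq[OF t_bounds, symmetric]
  proof (rule heat_semigroup_affine_mono[OF t_bounds(1)])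
    show "AE y in lborel. S t (\<lambda>y. ennreal (J (max (\<mu> y) U))) x + ennreal d * ennreal (\<mu> y)
        \<le> ennreal (d * v) + ennreal (J (max (\<mu> y) U))"
    proof (rule AE_I2)
      fix y
      have "J v + d * (max (\<mu> y) U - v) \<le> J (max (\<mu> y) U)"
        unfolding d_def using v(1) by (intro J_above_tangent) auto
      moreover have "d * \<mu> y \<le> d * max (\<mu> y) U" using d_pos by (intro mult_left_mono) auto
      ultimately have "ennreal (J v + d * \<mu> y) \<le> ennreal (d * v + J (max (\<mu> y) U))"
        by (intro ennreal_leI) (simp add: algebra_simps)
      then show "S t (\<lambda>y. ennreal (J (max (\<mu> y) U))) x + ennreal d * ennreal (\<mu> y)
          \<le> ennreal (d * v) + ennreal (J (max (\<mu> y) U))"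
        unfolding heat_semigroup_J_eq[OF t_bounds] v(2)[symmetric]
        using d_pos v_pos \<mu>_nonneg[of y] J_pos[OF v(1)] J_pos[of "max (\<mu> y) U"]
        by (simp add: ennreal_mult)
    qed
  qed (use borel_measurable_J_max[OF \<mu>] in measurable)
  then have "ennreal d * S t (\<lambda>y. ennreal (\<mu> y)) x \<le> ennreal d * ennreal v"
    using d_pos v_pos
    by (simp add: add.commute[of "ennreal (d * v)"] ennreal_add_left_cancel_le ennreal_mult)
  then show ?thesis using d_pos by (simp add: ennreal_mult_le_mult_iff v_def)
qed

lemma f_J_inv_double_caloric_J_le:
  assumes s_bounds: "0 < s" "s \<le> t" and t_less: "t < T"
  shows "f (J_inv (2 * caloric_J y s)) \<le>
    fF (r + 1 - \<kappa>) (F_inv (t / E)) * (s / E) powr (\<kappa> - 1) * (2 * caloric_J y s)"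
proof -
  have s_less_T: "s < T" using s_bounds t_less by simp
  have t_pos: "0 < t" using s_bounds by simp
  have powr_le_iff: "c powr (- 1 / r) \<ge> u / E" if "0 < u" "0 < c" "c \<le> (E / u) powr r" for c u
  proof -
    have "((E / u) powr r) powr (- 1 / r) \<le> c powr (- 1 / r)"
      using that r_pos by (intro powr_mono2') auto
    then show ?thesis using that E r_pos by (simp add: powr_powr powr_minus_divide)
  qed
  have "J U \<le> (E / t) powr r"
    using J_U_le_double_caloric_J[OF t_pos t_less, of y] double_caloric_J_le[OF t_pos t_less, of y]
    by linarith
  then have "t / E \<le> J U powr (- 1 / r)" using t_pos J_pos[of U] by (intro powr_le_iff) auto
  then have "t / E \<le> F U" unfolding J_powr[OF order_refl] .
  moreover have "s / E \<le> F (J_inv (2 * caloric_J y s))"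
    using powr_le_iff[OF s_bounds(1) _ double_caloric_J_le[OF s_bounds(1) s_less_T]]
      caloric_J_pos[OF s_bounds(1) s_less_T, of y]
      F_J_inv(2)[OF J_U_le_double_caloric_J[OF s_bounds(1) s_less_T]] by simp
  moreover have "s / E \<le> t / E" using s_bounds E by (simp add: divide_right_mono)
  ultimately have "f (J_inv (2 * caloric_J y s)) \<le>
      fF (r + 1 - \<kappa>) (F_inv (t / E)) * (s / E) powr (\<kappa> - 1) * J (J_inv (2 * caloric_J y s))"
    using s_bounds E J_U_le_double_caloric_J[OF s_bounds(1) s_less_T, of y]
    by (intro f_le_J_mult F_J_inv) auto
  then show ?thesis unfolding J_J_inv[OF J_U_le_double_caloric_J[OF s_bounds(1) s_less_T]] .
qed

lemma integral_factor_le: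
  assumes t_bounds: "0 < t" "t < T"
  defines "M \<equiv> fF (r + 1 - \<kappa>) (F_inv (t / E)) * E powr (1 - \<kappa>)"
  shows "0 \<le> M"
    and "2 * caloric_J x t * (M * (t powr \<kappa> / \<kappa>)) \<le> J_inv (2 * caloric_J x t) - J_inv (caloric_J x t)"
proof -
  define z where "z = caloric_J x t"
  have z_bounds: "J U \<le> z" "J U \<le> 2 * z" "0 < z" "2 * z \<le> (E / t) powr r"
    using t_bounds
    by (simp_all add: z_def J_U_le_caloric_J J_U_le_double_caloric_J caloric_J_pos double_caloric_J_le)
  have "((E / t) powr r) powr (- 1 / r) = t / E"
    using t_bounds E r_pos by (simp add: powr_powr powr_minus_divide)
  moreover have "J U \<le> (E / t) powr r" using z_bounds by linarith
  ultimately have F_inv_bounds: "U \<le> F_inv (t / E)" "F (F_inv (t / E)) = t / E"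
      "J_inv (2 * z) \<le> F_inv (t / E)"
    using F_J_inv[of "(E / t) powr r"] J_inv_mono[OF _ z_bounds(4)] z_bounds(3) by (auto simp: J_inv_def)
  show "0 \<le> M" using fF_pos[OF \<tau>0_less[OF F_inv_bounds(1)]] by (simp add: M_def less_imp_le)
  have fF_nonneg: "0 \<le> fF (r + 1) (F_inv (t / E))"
    using fF_pos[OF \<tau>0_less[OF F_inv_bounds(1)]] by (rule less_imp_le)
  have "M * t powr \<kappa> = E * fF (r + 1) (F_inv (t / E))"
  proof -
    have "fF (r + 1) (F_inv (t / E)) = fF (r + 1 - \<kappa>) (F_inv (t / E)) * (t / E) powr \<kappa>"
      using fF_add[of "r + 1 - \<kappa>" \<kappa> "F_inv (t / E)"] by (simp add: F_inv_bounds(2))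
    moreover have "E powr (1 - \<kappa>) * t powr \<kappa> = E * (t / E) powr \<kappa>"
      using E t_bounds by (simp add: powr_diff powr_divide)
    ultimately show ?thesis by (simp add: M_def ac_simps)
  qed
  then have "2 * z * (M * (t powr \<kappa> / \<kappa>)) = 2 * E / \<kappa> * (z * fF (r + 1) (F_inv (t / E)))" by simp
  also have "\<dots> \<le> 1 / r * (z * fF (r + 1) (J_inv (2 * z)))"
    using z_bounds r_pos fF_nonneg
  proof (intro mult_mono mult_left_mono)
    show "2 * E / \<kappa> \<le> 1 / r" using E(2) \<kappa>_pos r_pos by (simp add: field_simps)
    show "fF (r + 1) (F_inv (t / E)) \<le> fF (r + 1) (J_inv (2 * z))"
      using F_inv_bounds(3) F_J_inv(1)[OF z_bounds(2)] by (intro fF_r_plus_1_antimono)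
  qed auto
  also have "\<dots> \<le> J_inv (2 * z) - J_inv z"
    using J_inv_double_gap[OF z_bounds(1)] r_pos by (simp add: field_simps)
  finally show "2 * caloric_J x t * (M * (t powr \<kappa> / \<kappa>)) \<le>
      J_inv (2 * caloric_J x t) - J_inv (caloric_J x t)"
    by (simp add: z_def)
qed

lemma heat_semigroup_source_le:
  assumes s_bounds: "0 < s" "s < t" and t_less: "t < T"
  shows "S (t - s) (\<lambda>y. ennreal (f (J_inv (2 * caloric_J y s)))) x \<le>
    ennreal (2 * caloric_J x t * (fF (r + 1 - \<kappa>) (F_inv (t / E)) * E powr (1 - \<kappa>))) *
      ennreal (s powr (\<kappa> - 1))"
proof -
  define M where "M = fF (r + 1 - \<kappa>) (F_inv (t / E)) * E powr (1 - \<kappa>)"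
  have M_nonneg: "0 \<le> M" unfolding M_def using s_bounds t_less by (intro integral_factor_le) auto
  have s_less_T: "s < T" and time_pos: "0 < t - s" "0 < t" using s_bounds t_less by auto
  have [measurable]: "(\<lambda>y. ennreal (J (max (\<mu> y) U))) \<in> borel_measurable borel"
    using borel_measurable_J_max[OF \<mu>] by measurable
  have "f (J_inv (2 * caloric_J y s)) \<le> 2 * (M * s powr (\<kappa> - 1)) * caloric_J y s" for y
    using f_J_inv_double_caloric_J_le[of s t y] s_bounds t_less E(1)
    by (simp add: M_def powr_divide powr_diff field_simps)
  then have "S (t - s) (\<lambda>y. ennreal (f (J_inv (2 * caloric_J y s)))) x \<le>
      S (t - s) (\<lambda>y. ennreal (2 * (M * s powr (\<kappa> - 1))) * S s (\<lambda>w. ennreal (J (max (\<mu> w) U))) y) x"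
    using M_nonneg unfolding heat_semigroup_J_eq[OF s_bounds(1) s_less_T]
    by (intro heat_semigroup_mono) (simp add: ennreal_mult[symmetric] caloric_J_def ennreal_leI)
  also have "\<dots> = ennreal (2 * (M * s powr (\<kappa> - 1))) * ennreal (caloric_J x t)"
    using s_bounds time_pos
    by (simp add: heat_semigroup_cmult heat_semigroup_compose heat_semigroup_J_eq[OF time_pos(2) t_less])
  also have "\<dots> = ennreal (2 * caloric_J x t * M) * ennreal (s powr (\<kappa> - 1))"
    using M_nonneg by (simp add: ennreal_mult[symmetric] caloric_J_def ac_simps)
  finally show ?thesis unfolding M_def .
qed

lemma nn_integral_heat_semigroup_source_le:
  assumes t_bounds: "0 < t" "t < T"
  shows "(\<integral>\<^sup>+s\<in>{0<..<t}. S (t - s) (\<lambda>y. ennreal (f (J_inv (2 * caloric_J y s)))) x \<partial>lborel)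
    \<le> ennreal (J_inv (2 * caloric_J x t) - J_inv (caloric_J x t))"
proof -
  define M where "M = fF (r + 1 - \<kappa>) (F_inv (t / E)) * E powr (1 - \<kappa>)"
  have M_nonneg: "0 \<le> M" unfolding M_def using t_bounds by (rule integral_factor_le)
  have "(\<integral>\<^sup>+s\<in>{0<..<t}. S (t - s) (\<lambda>y. ennreal (f (J_inv (2 * caloric_J y s)))) x \<partial>lborel)
      \<le> (\<integral>\<^sup>+s. ennreal (2 * caloric_J x t * M) *
        (ennreal (s powr (\<kappa> - 1)) * indicator {0<..<t} s) \<partial>lborel)"
    unfolding M_def using heat_semigroup_source_le[of _ t x] t_bounds
    by (intro nn_integral_mono) (auto simp: indicator_def)
  also have "\<dots> = ennreal (2 * caloric_J x t * (M * (t powr \<kappa> / \<kappa>)))"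
    using t_bounds M_nonneg \<kappa>_pos
    by (simp add: nn_integral_cmult nn_integral_powr_Ioo_0 ennreal_mult[symmetric] caloric_J_def
       mult.assoc)
  also have "\<dots> \<le> ennreal (J_inv (2 * caloric_J x t) - J_inv (caloric_J x t))"
    unfolding M_def using t_bounds by (intro ennreal_leI integral_factor_le)
  finally show ?thesis .
qed

text \<open>Jensen's inequality leaves \<open>J\<^bsup>-1\<^esup>(2z) - J\<^bsup>-1\<^esup>(z)\<close> of room for the Duhamel term.\<close>
lemma supersolution_J_inv_double_caloric_J:
  "supersolution \<theta> \<mu> T (\<lambda>x t. if 0 < t \<and> t < T then J_inv (2 * caloric_J x t) else 0)"
  unfolding supersolution_def
proof (intro conjI allI)
  let ?v = "\<lambda>x t. if 0 < t \<and> t < T then J_inv (2 * caloric_J x t) else 0"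
  have [measurable]: "(\<lambda>y. ennreal (J (max (\<mu> y) U))) \<in> borel_measurable borel"
    using borel_measurable_J_max[OF \<mu>] by measurable
  have [measurable]: "(\<lambda>p. caloric_J (fst p) (snd p)) \<in> borel_measurable (borel \<Otimes>\<^sub>M borel)"
    unfolding caloric_J_def by measurable
  have "(\<lambda>p. F_inv (if 0 < snd p \<and> snd p < T then (2 * caloric_J (fst p) (snd p)) powr (- 1 / r) else 1))
      \<in> borel_measurable (borel \<Otimes>\<^sub>M borel)"
    by (rule borel_measurable_F_inv_comp) (use caloric_J_pos in \<open>auto simp: less_imp_neq[THEN not_sym]\<close>)
  then have "(\<lambda>p. if 0 < snd p \<and> snd p < T then
      F_inv (if 0 < snd p \<and> snd p < T then (2 * caloric_J (fst p) (snd p)) powr (- 1 / r) else 1) else 0)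
      \<in> borel_measurable (borel \<Otimes>\<^sub>M borel)"
    by measurable
  then show "case_prod ?v \<in> borel_measurable (borel \<Otimes>\<^sub>M borel)"
    by (rule measurable_cong[THEN iffD1, rotated]) (auto simp: J_inv_def)
  show "0 \<le> ?v x t" for x t using J_inv_pos[of "2 * caloric_J x t"] caloric_J_pos[of t x] by auto
  have "duhamel \<theta> f \<mu> ?v x t \<le> ennreal (?v x t)" if t_bounds: "0 < t" "t < T" for x t
  proof -
    have "(\<integral>\<^sup>+s\<in>{0<..<t}. S (t - s) (\<lambda>y. ennreal (f (?v y s))) x \<partial>lborel) =
        (\<integral>\<^sup>+s\<in>{0<..<t}. S (t - s) (\<lambda>y. ennreal (f (J_inv (2 * caloric_J y s)))) x \<partial>lborel)"
      using t_bounds by (intro nn_integral_cong) (auto simp: indicator_def)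
    then have "duhamel \<theta> f \<mu> ?v x t \<le>
        ennreal (J_inv (caloric_J x t)) + ennreal (J_inv (2 * caloric_J x t) - J_inv (caloric_J x t))"
      unfolding duhamel_def
      using heat_semigroup_initial_le[OF t_bounds] nn_integral_heat_semigroup_source_le[OF t_bounds]
      by (simp add: add_mono)
    also have "\<dots> = ennreal (J_inv (2 * caloric_J x t))"
      using J_inv_pos[of "caloric_J x t"] J_inv_mono[of "caloric_J x t" "2 * caloric_J x t"]
        caloric_J_pos[OF t_bounds, of x]
      by (subst ennreal_plus[symmetric]) auto
    finally show ?thesis using t_bounds by simp
  qed
  then show "AE (x, t) in lborel. 0 < t \<and> t < T \<longrightarrow> duhamel \<theta> f \<mu> ?v x t \<le> ennreal (?v x t)"
    by (intro AE_I2) auto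
qed

end

lemma heat_semigroup_J_max_le:
  fixes \<mu> :: "'a::euclidean_space \<Rightarrow> real"
  assumes t_pos: "0 < t" and b_pos: "0 < b" and F_le: "\<And>x. U < \<mu> x \<Longrightarrow> 1 / F (\<mu> x) \<le> b * norm x powr - \<theta>"
    and smoothing: "S t (\<lambda>y. ennreal (norm y powr - (\<theta> * r))) x \<le> ennreal c" and c_nonneg: "0 \<le> c"
  shows "S t (\<lambda>y. ennreal (J (max (\<mu> y) U))) x \<le> ennreal (J U + b powr r * c)"
proof -
  have "S t (\<lambda>y. ennreal (J (max (\<mu> y) U))) x \<le>
      S t (\<lambda>y. ennreal (J U) + ennreal (b powr r) * ennreal (norm y powr - (\<theta> * r))) x"
  proof (rule heat_semigroup_mono)
    fix y
    have "ennreal (J (max (\<mu> y) U)) \<le> ennreal (J U + b powr r * norm y powr - (\<theta> * r))"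
      using b_pos F_le by (intro ennreal_leI J_max_le)
    then show "ennreal (J (max (\<mu> y) U)) \<le>
        ennreal (J U) + ennreal (b powr r) * ennreal (norm y powr - (\<theta> * r))"
      using J_pos[of U] by (simp add: ennreal_mult)
  qed
  also have "\<dots> = ennreal (J U) + ennreal (b powr r) * S t (\<lambda>y. ennreal (norm y powr - (\<theta> * r))) x"
    using t_pos by (simp add: heat_semigroup_add heat_semigroup_cmult heat_semigroup_const)
  also have "\<dots> \<le> ennreal (J U) + ennreal (b powr r) * ennreal c"
    by (intro add_left_mono mult_left_mono smoothing) simp
  also have "\<dots> = ennreal (J U + b powr r * c)" using J_pos[of U] c_nonneg by (simp add: ennreal_mult)
  finally show ?thesis .
qed

lemma locally_solvable_of_inverse_F_le:
  fixes \<mu> :: "'a::euclidean_space \<Rightarrow> real"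
  assumes C_pos: "0 < C"
    and smoothing:
        "\<And>t x::'a. 0 < t \<Longrightarrow> S t (\<lambda>y. ennreal (norm y powr - (\<theta> * r))) x \<le> ennreal (C * t powr - r)"
    and b_bounds: "0 < b" "b \<le> \<kappa> / (2 * r * (4 * C) powr (1 / r))"
    and \<mu>_measurable [measurable]: "\<mu> \<in> borel_measurable borel" and nonneg: "\<And>x. 0 \<le> \<mu> x"
    and F_le: "\<And>x. U < \<mu> x \<Longrightarrow> 1 / F (\<mu> x) \<le> b * norm x powr - \<theta>"
  shows "locally_solvable \<theta> f \<mu>"
proof -
  define E where "E = (4 * C) powr (1 / r) * b"
  have E: "0 < E" "E \<le> \<kappa> / (2 * r)" "E powr r = 4 * C * b powr r"
    using b_bounds C_pos r_pos by (simp_all add: E_def powr_mult powr_powr field_simps)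
  define T where "T = (C * b powr r / J U) powr (1 / r)"
  have T_pos: "0 < T" using C_pos b_bounds J_pos[of U] by (simp add: T_def)
  have "S t (\<lambda>y. ennreal (J (max (\<mu> y) U))) x \<le> ennreal ((E / t) powr r / 2)"
    if t_bounds: "0 < t" "t < T" for t x
  proof -
    have "T powr - r = J U / (C * b powr r)"
      using r_pos C_pos b_bounds J_pos[of U] by (simp add: T_def powr_powr powr_minus_divide)
    moreover have "T powr - r \<le> t powr - r" using t_bounds r_pos by (intro powr_mono2') auto
    ultimately have "J U \<le> b powr r * (C * t powr - r)"
      using C_pos b_bounds by (simp add: pos_divide_le_eq ac_simps)
    moreover have "(E / t) powr r / 2 = 2 * (b powr r * (C * t powr - r))"
      using E t_bounds by (simp add: powr_divide powr_minus_divide)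
    ultimately have "J U + b powr r * (C * t powr - r) \<le> (E / t) powr r / 2" by linarith
    moreover have "S t (\<lambda>y. ennreal (J (max (\<mu> y) U))) x \<le> ennreal (J U + b powr r * (C * t powr - r))"
      using t_bounds(1) b_bounds(1) F_le C_pos smoothing[OF t_bounds(1)]
      by (intro heat_semigroup_J_max_le) auto
    ultimately show ?thesis by (meson ennreal_leI order_trans)
  qed
  from supersolution_J_inv_double_caloric_J[OF \<mu>_measurable nonneg E(1,2) this]
  show ?thesis by (rule locally_solvable_of_supersolution[OF T_pos \<mu>_measurable])
qed

end

section \<open>Nonexistence\<close>

lemma ex_in_open_of_AE_lborel:
  fixes A :: "'a::euclidean_space set"
  assumes "open A" "x \<in> A" and AE_P: "AE x in lborel. P x"
  shows "\<exists>x\<in>A. P x"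
proof (rule ccontr)
  assume not_P: "\<not> (\<exists>x\<in>A. P x)"
  obtain e where e: "e > 0" "ball x e \<subseteq> A" using assms(1,2) by (meson open_contains_ball)
  have "AE y in lborel. y \<notin> ball x e"
    using AE_P by eventually_elim (use e not_P in blast)
  then have "emeasure lborel (ball x e) = 0"
    by (subst (asm) AE_iff_measurable[OF _ refl]) (auto simp: ball_def)
  moreover have "emeasure lborel (ball x e) > 0" using e by (simp add: emeasure_ball)
  ultimately show False by simp
qed

lemma AE_lborel_sections:
  fixes P :: "'a::euclidean_space \<Rightarrow> 'b::euclidean_space \<Rightarrow> bool"
  assumes "Measurable.pred (borel \<Otimes>\<^sub>M borel) (case_prod P)" and AE: "AE (x, y) in lborel. P x y"
  shows "AE y in lborel. AE x in lborel. P x y"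
proof -
  have "{p \<in> space (lborel \<Otimes>\<^sub>M lborel). P (fst p) (snd p)} \<in> sets (lborel \<Otimes>\<^sub>M lborel)"
    using assms(1) by (simp add: pred_def split_beta' space_pair_measure)
  moreover have "AE x in lborel. AE y in lborel. P x y"
    using lborel_pair.AE_pair[of "case_prod P"] AE unfolding lborel_prod by simp
  ultimately show ?thesis using lborel_pair.AE_commute[of P] by simp
qed

lemma (in fractional_diffusion) heat_semigroup_duhamel:
  fixes u :: "'a::euclidean_space \<Rightarrow> real \<Rightarrow> real"
  assumes s_bounds: "0 < s" "s < t" and [measurable]: "\<mu> \<in> borel_measurable borel"
    and f_u_measurable: "(\<lambda>(y, r). f (u y r)) \<in> borel_measurable (borel \<Otimes>\<^sub>M borel)"
  shows "S (t - s) (\<lambda>y. duhamel \<theta> f \<mu> u y s) x = S t (\<lambda>y. ennreal (\<mu> y)) x +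
    (\<integral>\<^sup>+r\<in>{0<..<s}. S (t - r) (\<lambda>y. ennreal (f (u y r))) x \<partial>lborel)"
proof -
  have [measurable]: "(\<lambda>y. f (u y r)) \<in> borel_measurable borel" for r
    using measurable_Pair_compose_split[OF f_u_measurable, of "\<lambda>y. y" borel "\<lambda>_. r"] by simp
  define w where "w = (\<lambda>y r. S (s - r) (\<lambda>z. ennreal (f (u z r))) y * indicator {0<..<s} r)"
  have "(\<lambda>p. S (s - snd p) (\<lambda>z. ennreal (f (u z (snd p)))) (fst p)) \<in> borel_measurable (borel \<Otimes>\<^sub>M borel)"
    using f_u_measurable
    by (intro borel_measurable_heat_semigroup_time_dependent[where h = "\<lambda>y r. ennreal (f (u y r))"])
      (auto simp: split_beta')
  then have w_measurable [measurable]: "case_prod w \<in> borel_measurable (borel \<Otimes>\<^sub>M borel)"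
    unfolding w_def split_beta' by measurable
  have [measurable]: "(\<lambda>y. \<integral>\<^sup>+r. w y r \<partial>lborel) \<in> borel_measurable borel"
    by (rule lborel.borel_measurable_nn_integral) (use w_measurable in simp)
  have "S (t - s) (\<lambda>y. w y r) x = S (t - r) (\<lambda>y. ennreal (f (u y r))) x * indicator {0<..<s} r" for r
    using s_bounds heat_semigroup_compose[of "t - s" "s - r" "\<lambda>y. ennreal (f (u y r))" x]
    by (auto simp: w_def indicator_def heat_semigroup_def)
  then have "S (t - s) (\<lambda>y. \<integral>\<^sup>+r. w y r \<partial>lborel) x =
      (\<integral>\<^sup>+r\<in>{0<..<s}. S (t - r) (\<lambda>y. ennreal (f (u y r))) x \<partial>lborel)"
    by (simp add: heat_semigroup_nn_integral[OF w_measurable])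
  moreover have "S (t - s) (S s (\<lambda>y. ennreal (\<mu> y))) x = S t (\<lambda>y. ennreal (\<mu> y)) x"
    using s_bounds by (simp add: heat_semigroup_compose)
  moreover have "(\<lambda>y. duhamel \<theta> f \<mu> u y s) = (\<lambda>y. S s (\<lambda>y. ennreal (\<mu> y)) y + (\<integral>\<^sup>+r. w y r \<partial>lborel))"
    by (simp add: duhamel_def w_def)
  ultimately show ?thesis by (simp add: heat_semigroup_add)
qed

context semilinear_heat
begin

lemma f_heat_semigroup_le:
  fixes w :: "'a::euclidean_space \<Rightarrow> real"
  assumes tangent: "\<And>z. 0 \<le> z \<Longrightarrow> f v + f' v * (z - v) \<le> f z" and v_gt_\<tau>0: "\<tau>0 < v"
    and t_pos: "0 < t" and w_measurable [measurable]: "w \<in> borel_measurable borel"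
    and nonneg: "\<And>y. 0 \<le> w y"
    and mean: "S t (\<lambda>y. ennreal (w y)) x = ennreal v"
  shows "ennreal (f v) \<le> S t (\<lambda>y. ennreal (f (w y))) x"
proof -
  have v_pos: "0 < v" using v_gt_\<tau>0 \<tau>0_pos by simp
  note signs = v_pos f'_nonneg[OF v_gt_\<tau>0] f_nonneg[of v]
  have [measurable]: "(\<lambda>y. f (w y)) \<in> borel_measurable borel"
    using w_measurable nonneg by (rule borel_measurable_f_comp)
  have "ennreal (f v) + ennreal (f' v) * S t (\<lambda>y. ennreal (w y)) x \<le>
      ennreal (f' v * v) + S t (\<lambda>y. ennreal (f (w y))) x"
  proof (rule heat_semigroup_affine_mono[OF t_pos])
    show "AE y in lborel. ennreal (f v) + ennreal (f' v) * ennreal (w y) \<le>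
        ennreal (f' v * v) + ennreal (f (w y))"
    proof (rule AE_I2)
      fix y
      have "ennreal (f v + f' v * w y) \<le> ennreal (f' v * v + f (w y))"
        using tangent[OF nonneg[of y]] by (intro ennreal_leI) (simp add: algebra_simps)
      then show "ennreal (f v) + ennreal (f' v) * ennreal (w y) \<le> ennreal (f' v * v) + ennreal (f (w y))"
        using signs nonneg[of y] f_nonneg[of "w y"] by (simp add: ennreal_mult)
    qed
  qed measurable
  then show ?thesis
    using signs
    by (simp add: mean ennreal_mult[symmetric] add.commute[of "ennreal (f v)"]
       ennreal_add_left_cancel_le)
qed

lemma f_duhamel_mean_le:
  fixes u :: "'a::euclidean_space \<Rightarrow> real \<Rightarrow> real"
  assumes s_bounds: "0 < s" "s < t" and \<mu>_measurable: "\<mu> \<in> borel_measurable borel"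
    and u: "case_prod u \<in> borel_measurable (borel \<Otimes>\<^sub>M borel)" "\<And>x t. 0 \<le> u x t"
    and solution: "AE y in lborel. ennreal (u y s) = duhamel \<theta> f \<mu> u y s"
    and mean: "S t (\<lambda>y. ennreal (\<mu> y)) x = ennreal h" "0 \<le> h"
    and source: "(\<integral>\<^sup>+r\<in>{0<..<s}. S (t - r) (\<lambda>y. ennreal (f (u y r))) x \<partial>lborel) = ennreal A" "0 \<le> A"
    and tangent: "\<And>z. 0 \<le> z \<Longrightarrow> f (h + A) + f' (h + A) * (z - (h + A)) \<le> f z" and level: "\<tau>0 < h + A"
  shows "ennreal (f (h + A)) \<le> S (t - s) (\<lambda>y. ennreal (f (u y s))) x"
proof (rule f_heat_semigroup_le[OF tangent level])
  have "S (t - s) (\<lambda>y. ennreal (u y s)) x = S (t - s) (\<lambda>y. duhamel \<theta> f \<mu> u y s) x"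
    using solution by (rule heat_semigroup_cong_AE)
  also have "\<dots> = ennreal h + ennreal A"
    unfolding mean(1)[symmetric] source(1)[symmetric]
    using s_bounds \<mu>_measurable borel_measurable_f_comp_pair[OF u] by (rule heat_semigroup_duhamel)
  also have "\<dots> = ennreal (h + A)" using mean(2) source(2) by simp
  finally show "S (t - s) (\<lambda>y. ennreal (u y s)) x = ennreal (h + A)" .
  show "(\<lambda>y. u y s) \<in> borel_measurable borel"
    using measurable_Pair_compose_split[OF u(1), of "\<lambda>y. y" borel "\<lambda>_. s"] by simp
qed (use s_bounds u(2) in auto)

context
  fixes \<mu> :: "'a::euclidean_space \<Rightarrow> real" and u :: "'a \<Rightarrow> real \<Rightarrow> real" and U T :: real
  assumes \<mu> [measurable]: "\<mu> \<in> borel_measurable borel" and U: "\<tau>0 < U"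
    and tangent: "\<And>v w. U \<le> v \<Longrightarrow> 0 \<le> w \<Longrightarrow> f v + f' v * (w - v) \<le> f w"
    and u [measurable]: "case_prod u \<in> borel_measurable (borel \<Otimes>\<^sub>M borel)" and u_nonneg: "\<And>x t. 0 \<le> u x t"
begin

text \<open>Along a solution the average \<open>h(s) = S(t - s)u(s)(x)\<close> satisfies \<open>h' \<ge> f(h)\<close> by Jensen's
  inequality, so it would blow up before time t if it started above \<open>F\<^bsup>-1\<^esup>(t)\<close>.\<close>
lemma solution_sections_imp_time_le_F:
  assumes t_bounds: "0 < t" "t < T" and finite: "duhamel \<theta> f \<mu> u x t < \<infinity>"
    and sections: "AE s in lborel. AE y in lborel. 0 < s \<and> s < T \<longrightarrow> ennreal (u y s) = duhamel \<theta> f \<mu> u y s"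
  shows "\<exists>h\<ge>0. S t (\<lambda>y. ennreal (\<mu> y)) x = ennreal h \<and> (U \<le> h \<longrightarrow> t \<le> F h)"
proof -
  define w where "w = (\<lambda>s. S (t - s) (\<lambda>y. ennreal (f (u y s))) x)"
  have w_measurable [measurable]: "w \<in> borel_measurable borel"
    unfolding w_def using borel_measurable_f_comp_pair[OF u u_nonneg]
    by (intro borel_measurable_heat_semigroup_time_dependent[where h = "\<lambda>y s. ennreal (f (u y s))"])
       (auto simp: split_beta')
  define h where "h = enn2real (S t (\<lambda>y. ennreal (\<mu> y)) x)"
  have h: "S t (\<lambda>y. ennreal (\<mu> y)) x = ennreal h" "0 \<le> h"
    and w_finite: "(\<integral>\<^sup>+s\<in>{0<..<t}. w s \<partial>lborel) < \<infinity>"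
    using finite by (auto simp: h_def duhamel_def w_def ennreal_add_less_top)
  have "t \<le> F h" if "U \<le> h"
  proof (rule blowup_time_le_F_of_nn_integral_inequality[OF w_measurable w_finite])
    show "AE s in lborel. 0 < s \<and> s < t \<longrightarrow> ennreal (f (h + enn2real (\<integral>\<^sup>+r\<in>{0<..<s}. w r \<partial>lborel))) \<le> w s"
      using sections
    proof (eventually_elim, clarify)
      fix s assume s_bounds: "0 < s" "s < t"
        and solution: "AE y in lborel. 0 < s \<and> s < T \<longrightarrow> ennreal (u y s) = duhamel \<theta> f \<mu> u y s"
      define A where "A = enn2real (\<integral>\<^sup>+r\<in>{0<..<s}. w r \<partial>lborel)"
      have "(\<integral>\<^sup>+r\<in>{0<..<s}. w r \<partial>lborel) \<le> (\<integral>\<^sup>+r\<in>{0<..<t}. w r \<partial>lborel)"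
        using s_bounds by (intro nn_integral_mono) (auto simp: indicator_def)
      then have A: "(\<integral>\<^sup>+r\<in>{0<..<s}. w r \<partial>lborel) = ennreal A" "0 \<le> A"
        using w_finite by (auto simp: A_def intro!: ennreal_enn2real[symmetric] intro: le_less_trans)
      have "AE y in lborel. ennreal (u y s) = duhamel \<theta> f \<mu> u y s"
        using solution s_bounds t_bounds by (auto elim!: eventually_mono)
      then have "ennreal (f (h + A)) \<le> w s"
        unfolding w_def using s_bounds \<mu> u u_nonneg h A U \<open>U \<le> h\<close>
        by (intro f_duhamel_mean_le tangent) (auto simp: w_def)
      then show "ennreal (f (h + enn2real (\<integral>\<^sup>+r\<in>{0<..<s}. w r \<partial>lborel))) \<le> w s" by (simp add: A_def)
    qed
  qed (use U \<open>U \<le> h\<close> t_bounds in auto)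
  then show ?thesis using h by blast
qed

lemma solution_imp_time_le_F:
  assumes solution: "AE (x, t) in lborel. 0 < t \<and> t < T \<longrightarrow> ennreal (u x t) = duhamel \<theta> f \<mu> u x t"
  shows "AE (x, t) in lborel. 0 < t \<and> t < T \<longrightarrow>
    (\<exists>h\<ge>0. S t (\<lambda>y. ennreal (\<mu> y)) x = ennreal h \<and> (U \<le> h \<longrightarrow> t \<le> F h))"
proof -
  have [measurable]: "case_prod (duhamel \<theta> f \<mu> u) \<in> borel_measurable (borel \<Otimes>\<^sub>M borel)"
    using \<mu> borel_measurable_f_comp_pair[OF u u_nonneg] by (rule borel_measurable_duhamel)
  have "Measurable.pred (borel \<Otimes>\<^sub>M borel)
      (\<lambda>p. 0 < snd p \<and> snd p < T \<longrightarrow> ennreal (case_prod u p) = case_prod (duhamel \<theta> f \<mu> u) p)"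
    by measurable
  then have sections:
      "AE s in lborel. AE y in lborel. 0 < s \<and> s < T \<longrightarrow> ennreal (u y s) = duhamel \<theta> f \<mu> u y s"
    using solution by (intro AE_lborel_sections) (auto simp: split_beta')
  from solution show ?thesis
  proof (eventually_elim, clarify)
    fix x t assume "0 < t \<and> t < T \<longrightarrow> ennreal (u x t) = duhamel \<theta> f \<mu> u x t" and t_bounds: "0 < t" "t < T"
    then have "duhamel \<theta> f \<mu> u x t < \<infinity>" using ennreal_less_top[of "u x t"] by simp
    then show "\<exists>h\<ge>0. S t (\<lambda>y. ennreal (\<mu> y)) x = ennreal h \<and> (U \<le> h \<longrightarrow> t \<le> F h)"
      using t_bounds sections by (intro solution_sections_imp_time_le_F)
  qed
qed

end

lemma locally_solvable_imp_small_time_le_F: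
  fixes \<mu> :: "'a::euclidean_space \<Rightarrow> real"
  assumes \<mu>_measurable: "\<mu> \<in> borel_measurable borel" and U_gt_\<tau>0: "\<tau>0 < U"
    and tangent: "\<And>v w. U \<le> v \<Longrightarrow> 0 \<le> w \<Longrightarrow> f v + f' v * (w - v) \<le> f w"
    and solvable: "locally_solvable \<theta> f \<mu>" and t0_pos: "0 < t0"
  obtains x t h where "0 < t" "t \<le> t0" "norm x \<le> t powr (1 / \<theta>)"
    "0 \<le> h" "S t (\<lambda>y. ennreal (\<mu> y)) x = ennreal h" "U \<le> h \<Longrightarrow> t \<le> F h"
proof -
  obtain T u where T_pos: "0 < T"
    and u: "case_prod u \<in> borel_measurable (borel \<Otimes>\<^sub>M borel)" "\<And>x t. 0 \<le> u x t"
    and solution: "AE (x, t) in lborel. 0 < t \<and> t < T \<longrightarrow> ennreal (u x t) = duhamel \<theta> f \<mu> u x t"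
    using solvable by (rule locally_solvable_imp_nonneg_solution) blast
  define t1 where "t1 = min T t0"
  have t1_pos: "0 < t1" using T_pos t0_pos by (simp add: t1_def)
  define D where "D = ball (0::'a) ((t1 / 2) powr (1 / \<theta>)) \<times> {t1 / 2<..<t1}"
  have "open D" "(0, 3 * t1 / 4) \<in> D" using t1_pos by (auto simp: D_def intro!: open_Times)
  moreover note solution_imp_time_le_F[OF \<mu>_measurable U_gt_\<tau>0 tangent u solution]
  ultimately obtain x t where xt_in_D: "(x, t) \<in> D"
    and lifespan: "0 < t \<and> t < T \<longrightarrow> (\<exists>h\<ge>0. S t (\<lambda>y. ennreal (\<mu> y)) x = ennreal h \<and> (U \<le> h \<longrightarrow> t \<le> F h))"
    using ex_in_open_of_AE_lborel by fast
  have "0 < t" "t < T" "t \<le> t0" "norm x \<le> t powr (1 / \<theta>)"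
    using xt_in_D t1_pos \<theta>_pos powr_mono2[of "1 / \<theta>" "t1 / 2" t] by (auto simp: D_def t1_def)
  then show ?thesis using lifespan that by blast
qed

lemma above_sqrt_F_tangent:
  assumes U_gt_\<tau>0: "\<tau>0 < U" and mono: "\<And>u v. U \<le> u \<Longrightarrow> u \<le> v \<Longrightarrow> fF (1 / 2) u \<le> fF (1 / 2) v"
    and v_ge: "U \<le> v" and m_nonneg: "0 \<le> m" and a: "0 \<le> a" "a\<^sup>2 \<le> F U \<Longrightarrow> \<tau>0 < m \<and> F m \<le> a\<^sup>2"
  shows "v + 2 * fF (1 / 2) v * sqrt (F v) \<le> m + (U / sqrt (F U) + 2 * fF (1 / 2) v) * a"
proof -
  define P where "P = 2 * fF (1 / 2) v"
  have P_pos: "0 < P" using fF_pos[of v "1 / 2"] U_gt_\<tau>0 v_ge by (simp add: P_def)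
  have sqrt_FU_pos: "0 < sqrt (F U)" using F_pos[OF U_gt_\<tau>0] by simp
  have U_pos: "0 < U" using U_gt_\<tau>0 \<tau>0_pos by simp
  show ?thesis
  proof (cases "a \<le> sqrt (F U)")
    case True
    have "a\<^sup>2 \<le> F U" using power_mono[OF True a(1), of 2] sqrt_FU_pos by simp
    then have F_m: "\<tau>0 < m" "F m \<le> a\<^sup>2" "F m \<le> F U" using a(2) by auto
    have "U \<le> m" using F_le_iff[OF U_gt_\<tau>0 F_m(1)] F_m(3) by simp
    then have "P * (sqrt (F v) - sqrt (F m)) \<le> m - v"
      unfolding P_def using v_ge by (intro sqrt_F_above_tangent[OF U_gt_\<tau>0 mono]) auto
    moreover have "P * sqrt (F m) \<le> P * a"
      using P_pos a(1) F_m(2) by (intro mult_left_mono real_le_lsqrt) auto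
    moreover have "0 \<le> U / sqrt (F U) * a" using U_pos sqrt_FU_pos a(1) by simp
    ultimately show ?thesis by (simp add: algebra_simps flip: P_def)
  next
    case False
    have "P * (sqrt (F v) - sqrt (F U)) \<le> U - v"
      unfolding P_def using v_ge by (intro sqrt_F_above_tangent[OF U_gt_\<tau>0 mono]) auto
    moreover have "P * sqrt (F U) \<le> P * a" using P_pos False by (intro mult_left_mono) auto
    moreover have "U \<le> U / sqrt (F U) * a" using False U_pos sqrt_FU_pos by (simp add: field_simps)
    ultimately show ?thesis using m_nonneg by (simp add: algebra_simps flip: P_def)
  qed
qed

lemma above_sqrt_F_tangent_norm_powr:
  assumes U_gt_\<tau>0: "\<tau>0 < U" and mono: "\<And>u v. U \<le> u \<Longrightarrow> u \<le> v \<Longrightarrow> fF (1 / 2) u \<le> fF (1 / 2) v"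
    and v_ge: "U \<le> v" and m_nonneg: "0 \<le> m" and e_pos: "0 < e"
    and F_le: "e * norm y powr \<theta> \<le> F U \<Longrightarrow> \<tau>0 < m \<and> F m \<le> e * norm y powr \<theta>"
  shows "v + 2 * fF (1 / 2) v * sqrt (F v) \<le>
    m + (U / sqrt (F U) + 2 * fF (1 / 2) v) * (sqrt e * norm y powr (\<theta> / 2))"
proof (rule above_sqrt_F_tangent[OF U_gt_\<tau>0 mono v_ge m_nonneg])
  have "(norm y powr (\<theta> / 2))\<^sup>2 = norm y powr \<theta>" by (simp add: power2_eq_square flip: powr_add)
  then have square: "(sqrt e * norm y powr (\<theta> / 2))\<^sup>2 = e * norm y powr \<theta>"
    using e_pos by (simp add: power_mult_distrib)
  assume "(sqrt e * norm y powr (\<theta> / 2))\<^sup>2 \<le> F U"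
  then show "\<tau>0 < m \<and> F m \<le> (sqrt e * norm y powr (\<theta> / 2))\<^sup>2"
    using F_le unfolding square by blast
qed (use e_pos in auto)

text \<open>Jensen's inequality for the convex function \<open>a \<mapsto> F\<^bsup>-1\<^esup>(a\<^sup>2)\<close>: unlike \<open>F\<^bsup>-1\<^esup>(|x|\<^sup>\<theta>)\<close>, it only
  involves the moment of order \<open>\<theta>/2\<close> of the kernel, which is finite.\<close>
lemma heat_semigroup_ge_of_F_le:
  fixes \<mu> :: "'a::euclidean_space \<Rightarrow> real"
  assumes [measurable]: "\<mu> \<in> borel_measurable borel" and nonneg: "\<And>x. 0 \<le> \<mu> x"
    and U_gt_\<tau>0: "\<tau>0 < U" and mono: "\<And>u v. U \<le> u \<Longrightarrow> u \<le> v \<Longrightarrow> fF (1 / 2) u \<le> fF (1 / 2) v"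
    and e_pos: "0 < e"
    and F_le: "\<And>x. x \<noteq> 0 \<Longrightarrow> e * norm x powr \<theta> \<le> F U \<Longrightarrow> \<tau>0 < \<mu> x \<and> F (\<mu> x) \<le> e * norm x powr \<theta>"
    and t_pos: "0 < t" and C_pos: "0 < C"
    and moment: "S t (\<lambda>y. ennreal (norm y powr (\<theta> / 2))) x \<le> ennreal (C * sqrt t)"
    and v: "U \<le> v" "F v = e * C\<^sup>2 * t"
  shows "ennreal v \<le> S t (\<lambda>y. ennreal (\<mu> y)) x + ennreal (U / sqrt (F U) * sqrt (F v))"
proof -
  define P where "P = 2 * fF (1 / 2) v"
  define Q where "Q = U / sqrt (F U)"
  have P_pos: "0 < P" using fF_pos[of v "1 / 2"] U_gt_\<tau>0 v by (simp add: P_def)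
  have Q_pos: "0 < Q" using F_pos[OF U_gt_\<tau>0] U_gt_\<tau>0 \<tau>0_pos by (simp add: Q_def)
  have v_pos: "0 < v" using U_gt_\<tau>0 v \<tau>0_pos by simp
  have sqrt_Fv: "sqrt (F v) = sqrt e * (C * sqrt t)" using C_pos by (simp add: v(2) real_sqrt_mult)
  have F_v: "0 \<le> sqrt (F v)" using e_pos C_pos t_pos by (simp add: v(2))
  have pointwise: "v + P * sqrt (F v) \<le> \<mu> y + (Q + P) * (sqrt e * norm y powr (\<theta> / 2))"
    if "y \<noteq> 0" for y
    unfolding P_def Q_def using U_gt_\<tau>0 mono v(1) nonneg e_pos F_le[OF that]
    by (rule above_sqrt_F_tangent_norm_powr)
  let ?S\<mu> = "S t (\<lambda>y. ennreal (\<mu> y)) x"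
  have "ennreal (v + P * sqrt (F v)) = S t (\<lambda>_. ennreal (v + P * sqrt (F v))) x"
    using t_pos by (simp add: heat_semigroup_const)
  also have "\<dots> \<le> S t (\<lambda>y. ennreal (\<mu> y) + ennreal ((Q + P) * sqrt e) * ennreal (norm y powr (\<theta> / 2))) x"
  proof (rule heat_semigroup_mono_AE)
    show "AE y in lborel. ennreal (v + P * sqrt (F v)) \<le>
        ennreal (\<mu> y) + ennreal ((Q + P) * sqrt e) * ennreal (norm y powr (\<theta> / 2))"
      using AE_lborel_singleton[of "0::'a"]
    proof eventually_elim
      case (elim y)
      have "ennreal (v + P * sqrt (F v)) \<le> ennreal (\<mu> y + (Q + P) * (sqrt e * norm y powr (\<theta> / 2)))"
        using pointwise[OF elim] by (rule ennreal_leI)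
      then show ?case
        using nonneg[of y] P_pos Q_pos e_pos by (simp add: ennreal_mult[symmetric] mult.assoc)
    qed
  qed
  also have "\<dots> = ?S\<mu> + ennreal ((Q + P) * sqrt e) * S t (\<lambda>y. ennreal (norm y powr (\<theta> / 2))) x"
    by (simp add: heat_semigroup_add heat_semigroup_cmult)
  also have "\<dots> \<le> ?S\<mu> + ennreal ((Q + P) * sqrt e) * ennreal (C * sqrt t)"
    by (intro add_left_mono mult_left_mono moment) simp
  also have "ennreal ((Q + P) * sqrt e) * ennreal (C * sqrt t) =
      ennreal (P * sqrt (F v) + Q * sqrt (F v))"
    using P_pos Q_pos e_pos C_pos t_pos by (simp add: sqrt_Fv ennreal_mult[symmetric] algebra_simps)
  finally have "ennreal (P * sqrt (F v)) + ennreal v \<le>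
      ennreal (P * sqrt (F v)) + (?S\<mu> + ennreal (Q * sqrt (F v)))"
    using v_pos P_pos Q_pos F_v by (simp add: ac_simps)
  then show ?thesis by (simp add: ennreal_add_left_cancel_le Q_def)
qed

lemma ex_inverse_F_gap:
  "\<exists>V>\<tau>0. \<forall>u\<ge>V. \<forall>v\<ge>u. F v \<le> F u / 2 \<longrightarrow> M * sqrt (F u) < v - u"
proof -
  obtain V where V_large: "\<And>u. V \<le> u \<Longrightarrow> 2 * M < fF (1 / 2) u"
    using fF_half_at_top by (auto simp: filterlim_at_top_dense eventually_at_top_linorder)
  have "M * sqrt (F u) < v - u" if u_ge: "max V (\<tau>0 + 1) \<le> u"
    and v_bounds: "u \<le> v" "F v \<le> F u / 2" for u v
  proof -
    have u': "\<tau>0 < u" "0 < u" using u_ge \<tau>0_pos by auto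
    have F_u: "0 < F u" by (rule F_pos[OF u'(1)])
    have "2 * M * sqrt (F u) < fF (1 / 2) u * sqrt (F u)"
      using V_large[of u] u_ge F_u by (intro mult_strict_right_mono) auto
    also have "\<dots> = f u * F u" using F_u by (simp add: fF_def powr_half_sqrt mult.assoc)
    also have "\<dots> \<le> f u * (2 * (F u - F v))" using v_bounds f_pos[OF u'(2)] by (intro mult_left_mono) auto
    also have "\<dots> = 2 * (f u * (F u - F v))" by simp
    also have "\<dots> \<le> 2 * (v - u)" using F_above_tangent[OF u'(1) v_bounds(1)] by simp
    finally show ?thesis by simp
  qed
  then show ?thesis by (intro exI[of _ "max V (\<tau>0 + 1)"]) auto
qed

lemma ex_tangent_level_fF_half_mono:
  "\<exists>W\<ge>U. \<tau>0 < W \<and> (\<forall>v\<ge>W. \<forall>w\<ge>0. f v + f' v * (w - v) \<le> f w) \<and>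
    (\<forall>u\<ge>W. \<forall>v\<ge>u. fF (1 / 2) u \<le> fF (1 / 2) v)"
proof -
  obtain U1 where tangent: "U1 > \<tau>0" "\<And>v w. U1 \<le> v \<Longrightarrow> 0 \<le> w \<Longrightarrow> f v + f' v * (w - v) \<le> f w"
    using ex_f_above_tangent by blast
  obtain U2 where half_less: "U2 > \<tau>0" "\<And>u. U2 \<le> u \<Longrightarrow> 1 / 2 < f' u * F u"
    using ex_f'F_between[of "1 / 2" "q + 1"] q_ge_1 by auto
  define W where "W = max U (max U1 U2)"
  have W_bounds: "\<tau>0 < W" "U \<le> W" "U1 \<le> W" "U2 \<le> W" using tangent(1) by (auto simp: W_def)
  have "fF (1 / 2) u \<le> fF (1 / 2) v" if "W \<le> u" "u \<le> v" for u v
    using that W_bounds half_less(2) by (intro fF_mono[OF W_bounds(1)]) (auto intro!: less_imp_le)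
  moreover have "f v + f' v * (w - v) \<le> f w" if "W \<le> v" "0 \<le> w" for v w
    using that W_bounds(3) tangent(2) by simp
  ultimately show ?thesis using W_bounds by blast
qed

lemma not_locally_solvable_of_F_le:
  fixes \<mu> :: "'a::euclidean_space \<Rightarrow> real"
  assumes C_pos: "0 < C" and moment: "\<And>t x::'a. 0 < t \<Longrightarrow> norm x \<le> t powr (1 / \<theta>) \<Longrightarrow>
      S t (\<lambda>y. ennreal (norm y powr (\<theta> / 2))) x \<le> ennreal (C * sqrt t)"
    and e_bounds: "0 < e" "e \<le> 1 / (2 * C\<^sup>2)" and U_gt_\<tau>0: "\<tau>0 < U"
    and \<mu>_measurable [measurable]: "\<mu> \<in> borel_measurable borel" and nonneg: "\<And>x. 0 \<le> \<mu> x"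
    and F_le: "\<And>x. x \<noteq> 0 \<Longrightarrow> e * norm x powr \<theta> \<le> F U \<Longrightarrow> \<tau>0 < \<mu> x \<and> F (\<mu> x) \<le> e * norm x powr \<theta>"
  shows "\<not> locally_solvable \<theta> f \<mu>"
proof
  assume solvable: "locally_solvable \<theta> f \<mu>"
  obtain W where W_bounds: "U \<le> W" "\<tau>0 < W"
    and tangent: "\<And>v w. W \<le> v \<Longrightarrow> 0 \<le> w \<Longrightarrow> f v + f' v * (w - v) \<le> f w"
    and mono: "\<And>u v. W \<le> u \<Longrightarrow> u \<le> v \<Longrightarrow> fF (1 / 2) u \<le> fF (1 / 2) v"
    using ex_tangent_level_fF_half_mono[of U] by blast
  define M where "M = W / sqrt (F W)"
  have M_pos: "0 < M" using F_pos[OF W_bounds(2)] W_bounds(2) \<tau>0_pos by (simp add: M_def)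
  obtain V where V: "\<tau>0 < V" "\<And>u v. V \<le> u \<Longrightarrow> u \<le> v \<Longrightarrow> F v \<le> F u / 2 \<Longrightarrow> M * sqrt (F u) < v - u"
    using ex_inverse_F_gap by blast
  define V' where "V' = max V W"
  have V'_bounds: "\<tau>0 < V'" "V \<le> V'" "W \<le> V'" using W_bounds by (auto simp: V'_def)
  obtain x t h where t_bounds: "0 < t" "t \<le> F V'" and norm_x_le: "norm x \<le> t powr (1 / \<theta>)"
    and h: "0 \<le> h" "S t (\<lambda>y. ennreal (\<mu> y)) x = ennreal h" "W \<le> h \<Longrightarrow> t \<le> F h"
    using locally_solvable_imp_small_time_le_F[OF \<mu>_measurable W_bounds(2) tangent solvable
       F_pos[OF V'_bounds(1)]] by blast
  obtain vt where vt: "V' \<le> vt" "F vt = t" using ex_F_eq[OF V'_bounds(1) t_bounds(1,2)] by auto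
  have "e * C\<^sup>2 \<le> 1 / 2" using e_bounds C_pos by (simp add: field_simps)
  then have half_bounds: "0 < e * C\<^sup>2 * t" "e * C\<^sup>2 * t \<le> t / 2"
    using e_bounds C_pos t_bounds mult_right_mono[of "e * C\<^sup>2" "1 / 2" t] by auto
  then obtain v where v: "vt \<le> v" "F v = e * C\<^sup>2 * t"
    using ex_F_eq[of vt "e * C\<^sup>2 * t"] V'_bounds vt t_bounds by auto
  have "h \<le> vt"
    using h(3) vt V'_bounds W_bounds(2) F_le_iff[of h vt] by (cases "W \<le> h") auto
  have "ennreal v \<le> ennreal h + ennreal (M * sqrt (F v))"
    unfolding h(2)[symmetric] M_def
  proof (rule heat_semigroup_ge_of_F_le[OF \<mu>_measurable nonneg W_bounds(2) mono e_bounds(1) _ t_bounds(1)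
     C_pos moment[OF t_bounds(1) norm_x_le] _ v(2)])
    show "\<tau>0 < \<mu> y \<and> F (\<mu> y) \<le> e * norm y powr \<theta>" if "y \<noteq> 0" "e * norm y powr \<theta> \<le> F W" for y
      using F_le[OF that(1)] that(2) F_antimono[OF U_gt_\<tau>0 W_bounds(1)] by simp
  qed (use v vt V'_bounds in auto)
  moreover have "0 \<le> M * sqrt (F v)" using M_pos half_bounds(1) by (simp add: v(2))
  ultimately have "v \<le> h + M * sqrt (F v)" using h(1) by (simp add: ennreal_le_iff flip: ennreal_plus)
  also have "\<dots> \<le> vt + M * sqrt (F vt)"
    using \<open>h \<le> vt\<close> M_pos half_bounds t_bounds by (intro add_mono mult_left_mono) (auto simp: vt v)
  finally have "v - vt \<le> M * sqrt (F vt)" by simp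
  moreover have "M * sqrt (F vt) < v - vt" using V'_bounds vt v half_bounds by (intro V(2)) auto
  ultimately show False by simp
qed

end

section \<open>The critical dilation\<close>

lemma ex1_threshold:
  fixes A :: "real set"
  assumes A_pos: "A \<subseteq> {0<..}" and nonempty: "A \<noteq> {}" and A_bdd_above: "bdd_above A"
    and down_closed: "\<And>l m. l \<in> A \<Longrightarrow> 0 < m \<Longrightarrow> m \<le> l \<Longrightarrow> m \<in> A"
  shows "\<exists>!l. 0 < l \<and> (\<forall>m. 0 < m \<and> m < l \<longrightarrow> m \<in> A) \<and> (\<forall>m>l. m \<notin> A)"
proof (rule ex1I)
  obtain a where a_in: "a \<in> A" using nonempty by blast
  have "0 < a" using A_pos a_in by auto
  also have "a \<le> Sup A" using a_in A_bdd_above by (rule cSup_upper)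
  finally have "0 < Sup A" .
  moreover have "m \<in> A" if m_bounds: "0 < m" "m < Sup A" for m
  proof -
    obtain l where l: "l \<in> A" "m < l" using less_cSupD[OF nonempty m_bounds(2)] by blast
    show ?thesis using l(1) m_bounds(1) less_imp_le[OF l(2)] by (rule down_closed)
  qed
  moreover have "m \<notin> A" if "Sup A < m" for m using that cSup_upper[OF _ A_bdd_above] by (meson not_less)
  ultimately show "0 < Sup A \<and> (\<forall>m. 0 < m \<and> m < Sup A \<longrightarrow> m \<in> A) \<and> (\<forall>m>Sup A. m \<notin> A)" by blast
next
  fix l assume l: "0 < l \<and> (\<forall>m. 0 < m \<and> m < l \<longrightarrow> m \<in> A) \<and> (\<forall>m>l. m \<notin> A)"
  show "l = Sup A"
  proof (rule antisym)
    show "l \<le> Sup A"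
      by (rule dense_le_bounded[of 0]) (use l in \<open>auto intro: cSup_upper[OF _ A_bdd_above]\<close>)
    show "Sup A \<le> l" using nonempty by (rule cSup_least) (use l in \<open>meson not_le\<close>)
  qed
qed

lemma supercritical_bounds:
  fixes q \<theta> n :: real
  assumes "0 < \<theta>" "0 < n" "p_of_q q > ereal (1 + \<theta> / n)"
  shows "1 \<le> q" and "q - 1 < n / \<theta>"
proof -
  have "1 \<le> q \<and> q - 1 < n / \<theta>"
  proof (cases "q = 1")
    case False
    then have "1 + \<theta> / n < q / (q - 1)" using assms by (simp add: p_of_q_def)
    also have "q / (q - 1) = 1 + 1 / (q - 1)" using False by (simp add: field_simps)
    finally have quotient_less: "\<theta> / n < 1 / (q - 1)" by simp
    moreover have "0 < \<theta> / n" using assms by simp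
    ultimately have "0 < 1 / (q - 1)" by linarith
    then have "0 < q - 1" by (simp add: zero_less_divide_iff)
    then show ?thesis using quotient_less assms by (simp add: field_simps)
  qed (use assms in simp)
  then show "1 \<le> q" and "q - 1 < n / \<theta>" by auto
qed

lemma powr_less_powr_iff_base:
  fixes p x y :: real
  assumes "0 < p" "0 < x" "0 < y"
  shows "x powr p < y powr p \<longleftrightarrow> x < y"
  using assms powr_less_mono2[of p x y] powr_mono2[of p y x] by force

lemma all_dilations_iff:
  fixes l \<theta> :: real
  assumes l_pos: "0 < l" and \<theta>_pos: "0 < \<theta>"
  shows "(\<forall>c. 0 < c \<and> c < 1 \<longrightarrow> P (l * c powr \<theta>)) \<longleftrightarrow> (\<forall>m. 0 < m \<and> m < l \<longrightarrow> P m)"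
    and "(\<forall>c>1. P (l * c powr \<theta>)) \<longleftrightarrow> (\<forall>m>l. P m)"
proof -
  have scaled_less_iff: "l * c powr \<theta> < l \<longleftrightarrow> c < 1" "l < l * c powr \<theta> \<longleftrightarrow> 1 < c" if "0 < c" for c
    using that l_pos \<theta>_pos powr_less_powr_iff_base[of \<theta> c 1] powr_less_powr_iff_base[of \<theta> 1 c] by auto
  have surj: "\<exists>c>0. m = l * c powr \<theta>" if "0 < m" for m
    using that l_pos \<theta>_pos by (intro exI[of _ "(m / l) powr (1 / \<theta>)"]) (simp add: powr_powr)
  show "(\<forall>c. 0 < c \<and> c < 1 \<longrightarrow> P (l * c powr \<theta>)) \<longleftrightarrow> (\<forall>m. 0 < m \<and> m < l \<longrightarrow> P m)"
    using surj scaled_less_iff l_pos by (metis mult_pos_pos powr_gt_zero less_irrefl)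
  show "(\<forall>c>1. P (l * c powr \<theta>)) \<longleftrightarrow> (\<forall>m>l. P m)"
    using surj scaled_less_iff l_pos by (metis less_trans zero_less_one)
qed

definition radial_profile :: "(real \<Rightarrow> real) \<Rightarrow> real \<Rightarrow> real \<Rightarrow> 'a::real_normed_vector \<Rightarrow> real" where
  "radial_profile \<psi> \<theta> l x = \<psi> (l * norm x powr - \<theta>)"

lemma radial_profile_dilation:
  "0 < c \<Longrightarrow> radial_profile \<psi> \<theta> l ((1 / c) *\<^sub>R x) = radial_profile \<psi> \<theta> (l * c powr \<theta>) x"
  by (simp add: radial_profile_def powr_divide powr_minus_divide)

lemma borel_measurable_radial_profile:
  assumes \<psi>_mono: "mono_on {0..} \<psi>" and l_pos: "0 < l"
  shows "radial_profile \<psi> \<theta> l \<in> borel_measurable (borel :: 'a::euclidean_space measure)"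
proof -
  have [measurable]: "(\<lambda>s. \<psi> (max 0 s)) \<in> borel_measurable borel"
    by (intro borel_measurable_mono monoI mono_onD[OF \<psi>_mono]) auto
  have "(\<lambda>x::'a. \<psi> (max 0 (l * norm x powr - \<theta>))) \<in> borel_measurable borel" by measurable
  then show ?thesis using l_pos by (simp add: radial_profile_def[abs_def] max_absorb2)
qed

lemma radial_profile_mono:
  assumes "mono_on {0..} \<psi>" "0 < l" "l \<le> m"
  shows "radial_profile \<psi> \<theta> l x \<le> radial_profile \<psi> \<theta> m x"
  unfolding radial_profile_def using assms by (intro mono_onD[OF assms(1)] mult_right_mono) auto

lemma in_B_radial_profile:
  assumes \<psi>_mono_nonneg: "mono_on {0..} \<psi>" "\<And>s. 0 \<le> s \<Longrightarrow> 0 \<le> \<psi> s" and l_pos: "0 < l" and \<theta>_pos: "0 < \<theta>"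
  shows "in_B (radial_profile \<psi> \<theta> l :: 'a::euclidean_space \<Rightarrow> real)"
  unfolding in_B_def
proof (intro conjI allI impI)
  show "radial_profile \<psi> \<theta> l \<in> borel_measurable (lborel :: 'a measure)"
    using borel_measurable_radial_profile[OF \<psi>_mono_nonneg(1) l_pos] by simp
  fix r :: real assume r_pos: "0 < r"
  have "\<bar>radial_profile \<psi> \<theta> l x\<bar> \<le> \<psi> (l * r powr - \<theta>)" if "r \<le> norm x" for x :: 'a
  proof -
    have "norm x powr - \<theta> \<le> r powr - \<theta>" using that r_pos \<theta>_pos by (intro powr_mono2') auto
    then have "radial_profile \<psi> \<theta> l x \<le> \<psi> (l * r powr - \<theta>)"
      unfolding radial_profile_def using l_pos
      by (intro mono_onD[OF \<psi>_mono_nonneg(1)] mult_left_mono) auto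
    then show ?thesis using \<psi>_mono_nonneg(2) l_pos by (simp add: radial_profile_def)
  qed
  then show "\<exists>M. AE x in (lborel :: 'a measure). r \<le> norm x \<longrightarrow> \<bar>radial_profile \<psi> \<theta> l x\<bar> \<le> M"
    by (intro exI AE_I2) auto
qed

lemma dilation_critical_radial_profile_iff:
  fixes f \<psi> :: "real \<Rightarrow> real"
  assumes \<psi>_mono_nonneg: "mono_on {0..} \<psi>" "\<And>s. 0 \<le> s \<Longrightarrow> 0 \<le> \<psi> s" and l_pos: "0 < l" and \<theta>_pos: "0 < \<theta>"
    and integrable: "locally_integrable (radial_profile \<psi> \<theta> l :: 'a::euclidean_space \<Rightarrow> real)"
  shows "dilation_critical \<theta> f (radial_profile \<psi> \<theta> l :: 'a \<Rightarrow> real) \<longleftrightarrow>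
    (\<forall>m. 0 < m \<and> m < l \<longrightarrow> locally_solvable \<theta> f (radial_profile \<psi> \<theta> m :: 'a \<Rightarrow> real)) \<and>
    (\<forall>m>l. \<not> locally_solvable \<theta> f (radial_profile \<psi> \<theta> m :: 'a \<Rightarrow> real))"
proof -
  have "0 \<le> radial_profile \<psi> \<theta> l x" for x :: 'a
    using \<psi>_mono_nonneg(2) l_pos by (simp add: radial_profile_def)
  moreover have "(\<lambda>x::'a. radial_profile \<psi> \<theta> l ((1 / c) *\<^sub>R x)) = radial_profile \<psi> \<theta> (l * c powr \<theta>)"
    if "0 < c" for c
    using that by (intro ext radial_profile_dilation)
  ultimately show ?thesis
    unfolding dilation_critical_def all_dilations_iff[OF l_pos \<theta>_pos, symmetric]
    using in_B_radial_profile[OF \<psi>_mono_nonneg l_pos \<theta>_pos] integrable by auto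
qed

lemma ex_ge_of_le_mult_mono_comp:
  fixes \<phi> \<psi> :: "real \<Rightarrow> real"
  assumes \<phi>_mono: "mono_on {0..} \<phi>" and \<psi>_nonneg: "\<And>s. 0 \<le> s \<Longrightarrow> 0 \<le> \<psi> s"
    and s_le_\<phi>_\<psi>: "\<And>s. L \<le> s \<Longrightarrow> s \<le> D * \<phi> (\<psi> s)" "0 < D" and L_pos: "0 < L" and B_nonneg: "0 \<le> B"
  shows "\<exists>s0\<ge>L. \<forall>s\<ge>s0. B \<le> \<psi> s"
proof (intro exI[of _ "max L (D * \<phi> B + 1)"] conjI allI impI)
  fix s assume s_ge: "max L (D * \<phi> B + 1) \<le> s"
  show "B \<le> \<psi> s"
  proof (rule ccontr)
    assume "\<not> B \<le> \<psi> s"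
    then have "\<phi> (\<psi> s) \<le> \<phi> B"
      using \<psi>_nonneg[of s] s_ge L_pos B_nonneg by (intro mono_onD[OF \<phi>_mono]) auto
    then have "D * \<phi> (\<psi> s) \<le> D * \<phi> B" using s_le_\<phi>_\<psi>(2) by simp
    then show False using s_le_\<phi>_\<psi>(1)[of s] s_ge by simp
  qed
qed simp

lemma (in osgood_source) inverse_F_comp_asymp:
  assumes \<phi>_mono: "mono_on {0..} \<phi>" and \<psi>_nonneg: "\<And>s. 0 \<le> s \<Longrightarrow> 0 \<le> \<psi> s"
    and \<phi>_G: "asymp_equiv \<phi> (G_fun f)" and \<phi>\<psi>: "asymp_equiv (\<phi> \<circ> \<psi>) id"
  shows "\<exists>a b L. 0 < a \<and> 0 < b \<and> 0 < L \<and> (\<forall>s\<ge>L. \<tau>0 < \<psi> s \<and> a * s \<le> 1 / F (\<psi> s) \<and> 1 / F (\<psi> s) \<le> b * s)"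
proof -
  obtain C1 C2 L1 where C: "0 < C1" "0 < C2" "0 < L1"
      "\<And>u. L1 \<le> u \<Longrightarrow> C1 * \<phi> u \<le> G_fun f u \<and> G_fun f u \<le> C2 * \<phi> u"
    using \<phi>_G by (auto simp: asymp_equiv_def)
  obtain D1 D2 L2 where D: "0 < D1" "0 < D2" "0 < L2" "\<And>s. L2 \<le> s \<Longrightarrow> D1 * \<phi> (\<psi> s) \<le> s \<and> s \<le> D2 * \<phi> (\<psi> s)"
    using \<phi>\<psi> by (auto simp: asymp_equiv_def)
  have "\<exists>L\<ge>L2. \<forall>s\<ge>L. max L1 (\<tau>0 + 1) \<le> \<psi> s"
    using D C(3) by (intro ex_ge_of_le_mult_mono_comp[OF \<phi>_mono \<psi>_nonneg, where D = D2]) auto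
  then obtain L where L: "L2 \<le> L" "\<And>s. L \<le> s \<Longrightarrow> max L1 (\<tau>0 + 1) \<le> \<psi> s" by blast
  have "\<tau>0 < \<psi> s \<and> C1 / D2 * s \<le> 1 / F (\<psi> s) \<and> 1 / F (\<psi> s) \<le> C2 / D1 * s" if s_ge: "L \<le> s" for s
  proof -
    have \<psi>s: "L1 \<le> \<psi> s" "\<tau>0 < \<psi> s" using L(2)[OF s_ge] by auto
    have G_\<psi>: "G_fun f (\<psi> s) = 1 / F (\<psi> s)" using \<psi>s \<tau>0_pos by (simp add: G_fun_def)
    have bounds: "D1 * \<phi> (\<psi> s) \<le> s" "s \<le> D2 * \<phi> (\<psi> s)" using D(4)[of s] s_ge L by auto
    have "C1 / D2 * s \<le> C1 * \<phi> (\<psi> s)" using bounds D C by (simp add: field_simps)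
    moreover have "C2 * \<phi> (\<psi> s) \<le> C2 / D1 * s" using bounds D C by (simp add: field_simps)
    ultimately show ?thesis using C(4)[OF \<psi>s(1)] \<psi>s(2) unfolding G_\<psi> by auto
  qed
  then show ?thesis using C D L by (intro exI[of _ "C1 / D2"] exI[of _ "C2 / D1"] exI[of _ L]) auto
qed

locale singular_profile = semilinear_heat +
  fixes \<psi> :: "real \<Rightarrow> real" and a b L :: real
  assumes \<psi>_mono: "mono_on {0..} \<psi>" and \<psi>_nonneg: "\<And>s. 0 \<le> s \<Longrightarrow> 0 \<le> \<psi> s"
    and a_pos: "0 < a" and b_pos: "0 < b" and L_pos: "0 < L"
    and \<psi>_asymp: "\<And>s. L \<le> s \<Longrightarrow> \<tau>0 < \<psi> s \<and> a * s \<le> 1 / F_fun f (\<psi> s) \<and> 1 / F_fun f (\<psi> s) \<le> b * s"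
begin

abbreviation \<mu> :: "real \<Rightarrow> 'a::euclidean_space \<Rightarrow> real" where
  "\<mu> \<equiv> radial_profile \<psi> \<theta>"

lemma \<mu>_nonneg: "0 < l \<Longrightarrow> 0 \<le> \<mu> l x"
  by (simp add: radial_profile_def \<psi>_nonneg)

lemma \<mu>_measurable: "0 < l \<Longrightarrow> \<mu> l \<in> borel_measurable borel"
  using \<psi>_mono by (rule borel_measurable_radial_profile)

lemma inverse_F_\<mu>_le:
  assumes l_pos: "0 < l" and \<mu>_above_\<psi>_L: "\<psi> L < \<mu> l x"
  shows "1 / F (\<mu> l x) \<le> b * l * norm x powr - \<theta>"
proof -
  have "L \<le> l * norm x powr - \<theta>"
  proof (rule ccontr)
    assume "\<not> L \<le> l * norm x powr - \<theta>"
    then have "\<mu> l x \<le> \<psi> L" unfolding radial_profile_def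
      using l_pos L_pos by (intro mono_onD[OF \<psi>_mono]) auto
    then show False using \<mu>_above_\<psi>_L by simp
  qed
  then show ?thesis using \<psi>_asymp by (simp add: radial_profile_def mult.assoc)
qed

lemma F_\<mu>_le:
  assumes l_pos: "0 < l" and x_near_0: "x \<noteq> 0" "1 / (a * l) * norm x powr \<theta> \<le> 1 / (a * L)"
  shows "\<tau>0 < \<mu> l x \<and> F (\<mu> l x) \<le> 1 / (a * l) * norm x powr \<theta>"
proof -
  define s where "s = l * norm x powr - \<theta>"
  have s: "0 < s" "1 / (a * l) * norm x powr \<theta> = 1 / (a * s)"
    using l_pos x_near_0 by (auto simp: s_def powr_minus_divide)
  have "1 / (a * s) \<le> 1 / (a * L)" using x_near_0(2) unfolding s(2) .
  then have "L \<le> s" using s(1) a_pos L_pos by (simp add: field_simps)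
  then have \<mu>_above: "\<tau>0 < \<mu> l x" "a * s \<le> 1 / F (\<mu> l x)"
    using \<psi>_asymp[of s] by (auto simp: radial_profile_def s_def)
  then have "F (\<mu> l x) \<le> 1 / (a * s)" using F_pos[OF \<mu>_above(1)] a_pos s by (simp add: field_simps)
  then show ?thesis using \<mu>_above(1) s(2) by simp
qed

lemma ex_window_beyond_\<psi>_L:
  assumes "q - 1 < p"
  shows "\<exists>r \<kappa> U. r < p \<and> \<psi> L \<le> U \<and> semilinear_heat_window f \<tau>0 f' \<tau>1 q r \<kappa> U \<theta>"
proof -
  obtain r \<kappa> U0 where "r < p" and "\<forall>U\<ge>U0. nonlinearity_window f \<tau>0 f' \<tau>1 q r \<kappa> U"
    using ex_nonlinearity_window[OF assms] by blast
  then have "nonlinearity_window f \<tau>0 f' \<tau>1 q r \<kappa> (max U0 (\<psi> L))" by simp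
  then have "semilinear_heat_window f \<tau>0 f' \<tau>1 q r \<kappa> (max U0 (\<psi> L)) \<theta>"
    by (intro semilinear_heat_window.intro semilinear_heat_axioms)
  then show ?thesis using \<open>r < p\<close> max.cobounded2 by blast
qed

lemma locally_integrable_\<mu>:
  assumes q_supercritical: "q - 1 < DIM('a::euclidean_space) / \<theta>" and l_pos: "0 < l"
  shows "locally_integrable (\<mu> l :: 'a \<Rightarrow> real)"
proof -
  obtain r \<kappa> U where r_less: "r < DIM('a) / \<theta>" and \<psi>_L_le_U: "\<psi> L \<le> U"
    and window: "semilinear_heat_window f \<tau>0 f' \<tau>1 q r \<kappa> U \<theta>"
    using ex_window_beyond_\<psi>_L[OF q_supercritical] by blast
  interpret window: semilinear_heat_window f \<tau>0 f' \<tau>1 q r \<kappa> U \<theta> by (rule window)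
  show ?thesis
  proof (rule window.locally_integrable_of_inverse_F_le)
    show "\<theta> * r < DIM('a)" using r_less \<theta>_pos by (simp add: field_simps)
    show "1 / F (\<mu> l x) \<le> b * l * norm x powr - \<theta>" if "U < \<mu> l x" for x :: 'a
      using that \<psi>_L_le_U l_pos by (intro inverse_F_\<mu>_le) auto
  qed (use b_pos l_pos \<mu>_measurable \<mu>_nonneg in auto)
qed

lemma ex_locally_solvable_\<mu>:
  assumes q_supercritical: "q - 1 < DIM('a::euclidean_space) / \<theta>"
  shows "\<exists>l>0. locally_solvable \<theta> f (\<mu> l :: 'a \<Rightarrow> real)"
proof -
  obtain r \<kappa> U where r_less: "r < DIM('a) / \<theta>" and \<psi>_L_le_U: "\<psi> L \<le> U"
    and window: "semilinear_heat_window f \<tau>0 f' \<tau>1 q r \<kappa> U \<theta>"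
    using ex_window_beyond_\<psi>_L[OF q_supercritical] by blast
  interpret window: semilinear_heat_window f \<tau>0 f' \<tau>1 q r \<kappa> U \<theta> by (rule window)
  have "\<theta> * r < DIM('a)" using r_less \<theta>_pos by (simp add: field_simps)
  then obtain C where C_pos: "0 < C"
    and smoothing:
        "\<And>t x::'a. 0 < t \<Longrightarrow> S t (\<lambda>y. ennreal (norm y powr - (\<theta> * r))) x \<le> ennreal (C * t powr - r)"
    using heat_semigroup_norm_powr_le[OF window.r_pos, where 'a = 'a] by blast
  define l where "l = \<kappa> / (2 * r * (4 * C) powr (1 / r)) / b"
  have l_pos: "0 < l" using C_pos b_pos window.r_pos window.\<kappa>_pos by (simp add: l_def)
  have "locally_solvable \<theta> f (\<mu> l :: 'a \<Rightarrow> real)"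
  proof (rule window.locally_solvable_of_inverse_F_le[OF C_pos smoothing])
    show "b * l \<le> \<kappa> / (2 * r * (4 * C) powr (1 / r))" using b_pos by (simp add: l_def)
    show "1 / F (\<mu> l x) \<le> b * l * norm x powr - \<theta>" if "U < \<mu> l x" for x :: 'a
      using that \<psi>_L_le_U l_pos by (intro inverse_F_\<mu>_le) auto
  qed (use b_pos l_pos \<mu>_measurable \<mu>_nonneg in auto)
  then show ?thesis using l_pos by blast
qed

lemma locally_solvable_\<mu>_bounded:
  "\<exists>B. \<forall>l>0. locally_solvable \<theta> f (\<mu> l :: 'a::euclidean_space \<Rightarrow> real) \<longrightarrow> l \<le> B"
proof -
  have half: "0 < \<theta> / 2" "\<theta> / 2 < \<theta>" "\<theta> / 2 / \<theta> = 1 / 2" using \<theta>_pos by auto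
  obtain C where C_pos: "0 < C" and moment: "\<And>t x::'a. 0 < t \<Longrightarrow> norm x \<le> t powr (1 / \<theta>) \<Longrightarrow>
      S t (\<lambda>y. ennreal (norm y powr (\<theta> / 2))) x \<le> ennreal (C * sqrt t)"
    using heat_semigroup_moment_le[OF half(1,2), where 'a = 'a] unfolding half(3)
    by (auto simp: powr_half_sqrt)
  obtain U where U_bounds: "\<tau>0 < U" "F U < 1 / (a * L)"
    using ex_F_less[of "1 / (a * L)"] a_pos L_pos by auto
  have "l \<le> 2 * C\<^sup>2 / a" if l: "0 < l" "locally_solvable \<theta> f (\<mu> l :: 'a \<Rightarrow> real)" for l
  proof (rule ccontr)
    assume "\<not> l \<le> 2 * C\<^sup>2 / a"
    then have small: "1 / (a * l) \<le> 1 / (2 * C\<^sup>2)" using a_pos C_pos l(1) by (simp add: field_simps)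
    have "\<not> locally_solvable \<theta> f (\<mu> l :: 'a \<Rightarrow> real)"
    proof (rule not_locally_solvable_of_F_le[OF C_pos moment _ small U_bounds(1)])
      show "\<tau>0 < \<mu> l x \<and> F (\<mu> l x) \<le> 1 / (a * l) * norm x powr \<theta>"
        if "x \<noteq> 0" "1 / (a * l) * norm x powr \<theta> \<le> F U" for x :: 'a
        using that l(1) U_bounds(2) by (intro F_\<mu>_le) auto
    qed (use a_pos l(1) in \<open>auto intro: \<mu>_measurable \<mu>_nonneg\<close>)
    then show False using l(2) by simp
  qed
  then show ?thesis by blast
qed

lemma ex1_dilation_critical_\<mu>:
  assumes q_supercritical: "q - 1 < DIM('a::euclidean_space) / \<theta>"
  shows "\<exists>!l. 0 < l \<and> dilation_critical \<theta> f (\<mu> l :: 'a \<Rightarrow> real)"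
proof -
  define A where "A = {l. 0 < l \<and> locally_solvable \<theta> f (\<mu> l :: 'a \<Rightarrow> real)}"
  have "\<exists>!l. 0 < l \<and> (\<forall>m. 0 < m \<and> m < l \<longrightarrow> m \<in> A) \<and> (\<forall>m>l. m \<notin> A)"
  proof (rule ex1_threshold)
    show "A \<noteq> {}" using ex_locally_solvable_\<mu>[OF q_supercritical] by (auto simp: A_def)
    show "bdd_above A"
      using locally_solvable_\<mu>_bounded[where 'a = 'a] by (auto simp: A_def bdd_above_def)
    show "m \<in> A" if "l \<in> A" "0 < m" "m \<le> l" for l m
      using that locally_solvable_mono[OF \<mu>_measurable radial_profile_mono[OF \<psi>_mono]]
      by (auto simp: A_def)
  qed (auto simp: A_def)
  moreover have "0 < l \<and> dilation_critical \<theta> f (\<mu> l :: 'a \<Rightarrow> real) \<longleftrightarrow>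
      0 < l \<and> (\<forall>m. 0 < m \<and> m < l \<longrightarrow> m \<in> A) \<and> (\<forall>m>l. m \<notin> A)" for l
    using dilation_critical_radial_profile_iff[OF \<psi>_mono \<psi>_nonneg _ \<theta>_pos
       locally_integrable_\<mu>[OF q_supercritical]]
    by (auto simp: A_def)
  ultimately show ?thesis by simp
qed

end

theorem theorem1p2:
  fixes f f' \<phi> \<psi> :: "real \<Rightarrow> real" and \<theta> \<tau>0 \<tau>1 q :: real
  assumes theta: "0 < \<theta>" "\<theta> \<le> 2"
    and f_range: "\<forall>u \<ge> 0. 0 \<le> f u"
    (* (M) *)
    and M_cont: "continuous_on {0..} f"
    and M_mono: "mono_on {0..} f"
    and M_pos: "\<forall>u > 0. 0 < f u"
    (* (S) *)
    and S_tau0: "0 < \<tau>0"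
    and S_deriv: "\<forall>u \<ge> \<tau>0. (f has_real_derivative f' u) (at u within {\<tau>0..})"
    and S_C1: "continuous_on {\<tau>0..} f'"
    and S_int: "(\<integral>\<^sup>+ s \<in> {\<tau>0..}. ennreal (1 / f s) \<partial>lborel) < \<infinity>"
    (* (C) *)
    and C_tau1: "0 \<le> \<tau>1"
    and C_convex: "convex_on {\<tau>1..} f"
    (* (L) *)
    and L_lim: "((\<lambda>u. f' u * F_fun f u) \<longlongrightarrow> q) at_top"
    (* supercritical *)
    and supercrit: "p_of_q q > ereal (1 + \<theta> / real DIM('a::euclidean_space))"
    (* phi, psi *)
    and phi_range: "\<forall>u \<ge> 0. 0 \<le> \<phi> u" and phi_mono: "mono_on {0..} \<phi>"
    and psi_range: "\<forall>u \<ge> 0. 0 \<le> \<psi> u" and psi_mono: "mono_on {0..} \<psi>"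
    and phi_G: "asymp_equiv \<phi> (G_fun f)"
    and phi_psi: "asymp_equiv (\<phi> \<circ> \<psi>) id"
  shows "\<exists>!l0. 0 < l0 \<and>
           dilation_critical \<theta> f (\<lambda>x::'a. \<psi> (l0 * norm x powr (- \<theta>)))"
proof -
  have q: "1 \<le> q" "q - 1 < DIM('a) / \<theta>"
    using supercritical_bounds[OF theta(1) _ supercrit] by auto
  interpret semilinear_heat f \<tau>0 f' \<tau>1 q \<theta>
    using theta f_range M_cont M_mono M_pos S_tau0 S_deriv S_int C_tau1 C_convex L_lim q(1)
    by unfold_locales auto
  obtain a b L where "singular_profile f \<tau>0 f' \<tau>1 q \<theta> \<psi> a b L"
  proof -
    obtain a b L where "0 < a" "0 < b" "0 < L"
      and "\<forall>s\<ge>L. \<tau>0 < \<psi> s \<and> a * s \<le> 1 / F (\<psi> s) \<and> 1 / F (\<psi> s) \<le> b * s"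
      using inverse_F_comp_asymp[OF phi_mono _ phi_G phi_psi] psi_range by blast
    then have "singular_profile f \<tau>0 f' \<tau>1 q \<theta> \<psi> a b L"
      using psi_mono psi_range by unfold_locales auto
    then show ?thesis by (rule that)
  qed
  then interpret singular_profile f \<tau>0 f' \<tau>1 q \<theta> \<psi> a b L .
  show ?thesis using ex1_dilation_critical_\<mu>[OF q(2)] by (simp add: radial_profile_def[abs_def])
qed

end
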